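(* Let $\alpha,\beta>0$ with $\alpha+\beta>1$, and consider the integro-partial dynamic equation $$\frac{\partial^{\boldsymbol 1}y(\boldsymbol x)}{\Delta\boldsymbol x^{\boldsymbol 1}}=\zeta\left(\boldsymbol x,\frac{\partial^{\boldsymbol 1}y(\boldsymbol x)}{\Delta\boldsymbol x^{\boldsymbol 1}},I(y(\boldsymbol x))\right),\quad\boldsymbol x\in\Omega,\qquad I(y(\boldsymbol x))=\int_{\Omega_{\boldsymbol x}}\Phi\left(\boldsymbol t,y(\boldsymbol t),\frac{\partial^{\boldsymbol 1}y(\boldsymbol t)}{\Delta\boldsymbol t^{\boldsymbol 1}}\right)\Delta\boldsymbol t,$$ with initial conditions $y(\boldsymbol x)|_{x_j=a_j}=0$ for all $j=1,\dots,n$. Suppose that $\Phi\left(\boldsymbol x,y(\boldsymbol x),\frac{\partial^{\boldsymbol 1}y(\boldsymbol x)}{\Delta\boldsymbol x^{\boldsymbol 1}}\right)\le\omega(\boldsymbol x)|y(\boldsymbol x)|^\beta\left|\frac{\partial^{\boldsymbol 1}y(\boldsymbol x)}{\Delta\boldsymbol x^{\boldsymbol 1}}\right|^\alpha$, where $\omega\in\mathcal{W}(\Omega)$, and $$\left|\zeta\left(\boldsymbol x,\frac{\partial^{\boldsymbol 1}y(\boldsymbol x)}{\Delta\boldsymbol x^{\boldsymbol 1}},I(y(\boldsymbol x))\right)\right|\le w_1(\boldsymbol x)+w_2(\boldsymbol x)\left|\frac{\partial^{\boldsymbol 1}y(\boldsymbol x)}{\Delta\boldsymbol x^{\boldsymbol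 1}}\right|^\gamma+w_3(\boldsymbol x)|I(y(\boldsymbol x))|,$$ where $\gamma\in(0,1)$, $w_1,w_2,w_3$ are non-negative on $\Omega$, and $w_2(\boldsymbol x)<1$ for all $\boldsymbol x\in\Omega$. If the equation has a solution $y\in\mathcal{L}^{\alpha+\beta}_{\boldsymbol a}(\Omega,1,\boldsymbol 1)$, then $$y(\boldsymbol x)\le\int_{\Omega_{\boldsymbol x}}\left[A^{1-\alpha-\beta}(\boldsymbol t)+(1-\alpha-\beta)B(\boldsymbol t)\operatorname{Vol}(\Omega_{\boldsymbol t})\right]^{\frac{1}{1-\alpha-\beta}}\Delta\boldsymbol t$$ as long as the right-hand side integral exists, where $$B(\boldsymbol x)=\sup_{\boldsymbol t\in\Omega_{\boldsymbol x}}\frac{w_3(\boldsymbol t)K(\boldsymbol t)}{1-w_2(\boldsymbol t)},\qquad A(\boldsymbol x)=\sup_{\boldsymbol t\in\Omega_{\boldsymbol x}}\frac{w_1(\boldsymbol t)+(1-\gamma)\gamma^{\frac{\gamma}{1-\gamma}}}{1-w_2(\boldsymbol t)},$$ $\operatorname{Vol}(\Omega_{\boldsymbol t})$ is the volume of the rectangular region $\Omega_{\boldsymbol t}$, and $$K(\boldsymbol x)=\left(\frac{\alpha}{\alpha+\beta}\right)^{\frac{\alpha}{\alpha+\beta}}\left(\int_{\Omega_{\boldsymbol x}}(\operatorname{Vol}(\Omega_{\boldsymbol t}))^{\alpha+\beta-1}\omega^{\frac{\alpha+\beta}{\beta}}(\boldsymbol t)\Delta\boldsymbol t\right)^{\frac{\beta}{\alpha+\beta}},\qquad\boldsymbol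 x\in\Omega.$$
   Context: Let $n\in\mathbb{N}$, let $\mathbb{T}_1,\dots,\mathbb{T}_n$ be time scales (nonempty closed subsets of $\mathbb{R}$) with forward jump operators $\sigma_j$, $\Lambda^n=\mathbb{T}_1\times\cdots\times\mathbb{T}_n$; inequalities between vectors are componentwise; $\boldsymbol a,\boldsymbol b\in\Lambda^n$ with $\boldsymbol a<\boldsymbol b$ in every component. $\Omega=\{\boldsymbol x\in\Lambda^n:\boldsymbol a\le\boldsymbol x\le\boldsymbol b\}$, $\Omega_{\boldsymbol x}=\{\boldsymbol t\in\Lambda^n:\boldsymbol a\le\boldsymbol t\le\boldsymbol x\}$; integrals over these sets are $n$-fold iterated delta integrals. The volume of $\Omega_{\boldsymbol t}$ is $\prod_{j=1}^n(t_j-a_j)$. The partial delta derivative $\frac{\partial f(\boldsymbol x)}{\Delta_jx_j}$ is $\lim_{t_j\to x_j,\ t_j\ne\sigma_j(x_j)}\frac{f(x_1,\dots,\sigma_j(x_j),\dots,x_n)-f(x_1,\dots,t_j,\dots,x_n)}{\sigma_j(x_j)-t_j}$, and $\frac{\partial^{\boldsymbol 1}f}{\Delta\boldsymbol x^{\boldsymbol 1}}=\frac{\partial^nf}{\Delta_1x_1\cdots\Delta_nx_n}$, $\boldsymbol 1=(1,\dots,1)$. $\mathcal{W}(\Omega)$ is the set of positive-valued rd-continuous functions on $\Omega$. For $p\ge1$, $\mathcal{L}^p_{\boldsymbol a}(\Omega,1,\boldsymbol 1)$ is the set of all $f:\Omega\to\mathbb{R}$ having rd-continuous derivatives $\frac{\partial^jf}{\Delta_1x_1\cdots\Delta_jx_j}$,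 $j=1,\dots,n$, with $f|_{x_j=a_j}=0$ for $j=1,\dots,n$ and $\int_\Omega\left|\frac{\partial^{\boldsymbol 1}f(\boldsymbol x)}{\Delta\boldsymbol x^{\boldsymbol 1}}\right|^p\Delta\boldsymbol x<\infty$. $\zeta$ and $\Phi$ are given real-valued functions.
   Formalization: The bound on Φ is assumed for its absolute value, |Φ| ≤ ω|y|^β|∂y|^α; with the one-sided bound as printed the claim is false (e.g. n=1, T=ℝ on [0,1], α=β=1, γ=1/2, w1=w3=1, w2=0, ω small, Φ=−10, ζ=1+|I|). *)

theory Defs
  imports "HOL-Analysis.Analysis"
begin

section \<open>Time scales\<close>

definition time_scale :: "real set \<Rightarrow> bool" where
  "time_scale T \<longleftrightarrow> closed T \<and> T \<noteq> {}"

text \<open>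
  The jump operators are defined at every real \<open>t\<close>, with the usual conventions
  \<open>inf {} = sup T\<close> and \<open>sup {} = inf T\<close>.
\<close>

definition forward_jump :: "real set \<Rightarrow> real \<Rightarrow> real" where
  "forward_jump T t = (if \<exists>s\<in>T. t < s then Inf {s\<in>T. t < s} else Sup T)"

definition backward_jump :: "real set \<Rightarrow> real \<Rightarrow> real" where
  "backward_jump T t = (if \<exists>s\<in>T. s < t then Sup {s\<in>T. s < t} else Inf T)"

definition right_dense :: "real set \<Rightarrow> real \<Rightarrow> bool" where
  "right_dense T t \<longleftrightarrow> (\<exists>s\<in>T. t < s) \<and> forward_jump T t = t"

text \<open>The set usually written \<open>T\<^sup>\<kappa>\<close>: a left-scattered maximum is removed.  These are the
  points at which a delta derivative makes sense.\<close>

definition ts_kappa :: "real set \<Rightarrow> real set" where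
  "ts_kappa T = {t\<in>T. \<not> ((\<forall>s\<in>T. s \<le> t) \<and> backward_jump T t < t)}"

section \<open>Boxes, volume and rd-continuity\<close>

text \<open>
  A point of \<open>n\<close>-space is a function \<open>nat \<Rightarrow> real\<close> that is \<open>undefined\<close> outside \<open>{..<n}\<close>;
  coordinates are counted from \<open>0\<close>.  On the set of these points the product
  topology of \<open>nat \<Rightarrow> real\<close> is the Euclidean one.
\<close>

definition Omega :: "nat \<Rightarrow> (nat \<Rightarrow> real set) \<Rightarrow> (nat \<Rightarrow> real) \<Rightarrow> (nat \<Rightarrow> real) \<Rightarrow> (nat \<Rightarrow> real) set" where
  "Omega n T a x = PiE {..<n} (\<lambda>j. T j \<inter> {a j..x j})"

definition vol :: "nat \<Rightarrow> (nat \<Rightarrow> real) \<Rightarrow> (nat \<Rightarrow> real) \<Rightarrow> real" where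
  "vol n a t = (\<Prod>j<n. t j - a j)"

text \<open>
  Joint rd-continuity on \<open>X\<close>.  The set \<open>J\<close> selects the coordinates in which \<open>x\<close> is approached
  strictly from the left, the others being approached from the right (or kept fixed).  All these
  limits have to exist, and to agree with the value at \<open>x\<close> when the coordinates in \<open>J\<close> are
  right-dense.  For \<open>n = 1\<close> this says: continuous at right-dense points, finite left limits at
  left-dense points.  If every \<open>T j\<close> is the real line it is continuity on \<open>X\<close>.
\<close>

definition rd_continuous_on ::
    "nat \<Rightarrow> (nat \<Rightarrow> real set) \<Rightarrow> (nat \<Rightarrow> real) set \<Rightarrow> ((nat \<Rightarrow> real) \<Rightarrow> real) \<Rightarrow> bool" where
  "rd_continuous_on n T X f \<longleftrightarrow>
     (\<forall>x\<in>X. \<forall>J\<subseteq>{..<n}.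
        let F = inf (nhds x)
                  (principal {t\<in>X. (\<forall>j\<in>J. t j < x j) \<and> (\<forall>j\<in>{..<n} - J. x j \<le> t j)})
        in (\<exists>l. (f \<longlongrightarrow> l) F) \<and>
           ((\<forall>j\<in>J. right_dense (T j) (x j)) \<longrightarrow> (f \<longlongrightarrow> f x) F))"

definition W_class ::
    "nat \<Rightarrow> (nat \<Rightarrow> real set) \<Rightarrow> (nat \<Rightarrow> real) \<Rightarrow> (nat \<Rightarrow> real) \<Rightarrow> ((nat \<Rightarrow> real) \<Rightarrow> real) set" where
  "W_class n T a b =
     {f. (\<forall>x\<in>Omega n T a b. 0 < f x) \<and> rd_continuous_on n T (Omega n T a b) f}"

section \<open>Iterated delta integrals\<close>

text \<open>
  Lebesgue delta measure: the completed Lebesgue--Stieltjes measure generated by the (monotone and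
  right-continuous) forward jump operator.  For \<open>s \<le> t\<close> in \<open>T\<close> it gives \<open>{s..<t}\<close> the measure
  \<open>t - s\<close>, and it gives \<open>{t}\<close> the measure \<open>forward_jump T t - t\<close>.
\<close>

definition delta_measure :: "real set \<Rightarrow> real measure" where
  "delta_measure T = completion (interval_measure (forward_jump T))"

definition delta_integrable :: "real set \<Rightarrow> real \<Rightarrow> real \<Rightarrow> (real \<Rightarrow> real) \<Rightarrow> bool" where
  "delta_integrable T c d f \<longleftrightarrow> set_integrable (delta_measure T) (T \<inter> {c..<d}) f"

definition delta_integral :: "real set \<Rightarrow> real \<Rightarrow> real \<Rightarrow> (real \<Rightarrow> real) \<Rightarrow> real" where
  "delta_integral T c d f = set_lebesgue_integral (delta_measure T) (T \<inter> {c..<d}) f"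

text \<open>Iterated integral over the coordinates in the list, the head of the list being the
  outermost variable; the remaining coordinates are those of \<open>t\<close>.\<close>

fun iter_integral ::
    "(nat \<Rightarrow> real set) \<Rightarrow> (nat \<Rightarrow> real) \<Rightarrow> (nat \<Rightarrow> real) \<Rightarrow> nat list
      \<Rightarrow> ((nat \<Rightarrow> real) \<Rightarrow> real) \<Rightarrow> (nat \<Rightarrow> real) \<Rightarrow> real" where
  "iter_integral T a x [] f t = f t"
| "iter_integral T a x (j # js) f t =
     delta_integral (T j) (a j) (x j) (\<lambda>s. iter_integral T a x js f (t(j := s)))"

fun iter_integrable ::
    "(nat \<Rightarrow> real set) \<Rightarrow> (nat \<Rightarrow> real) \<Rightarrow> (nat \<Rightarrow> real) \<Rightarrow> nat list
      \<Rightarrow> ((nat \<Rightarrow> real) \<Rightarrow> real) \<Rightarrow> (nat \<Rightarrow> real) \<Rightarrow> bool" where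
  "iter_integrable T a x [] f t \<longleftrightarrow> True"
| "iter_integrable T a x (j # js) f t \<longleftrightarrow>
     (AE s in delta_measure (T j). s \<in> T j \<inter> {a j..<x j} \<longrightarrow>
        iter_integrable T a x js f (t(j := s))) \<and>
     delta_integrable (T j) (a j) (x j) (\<lambda>s. iter_integral T a x js f (t(j := s)))"

definition Omega_integral ::
    "nat \<Rightarrow> (nat \<Rightarrow> real set) \<Rightarrow> (nat \<Rightarrow> real) \<Rightarrow> (nat \<Rightarrow> real) \<Rightarrow> ((nat \<Rightarrow> real) \<Rightarrow> real) \<Rightarrow> real" where
  "Omega_integral n T a x f = iter_integral T a x [0..<n] f (\<lambda>_. undefined)"

definition Omega_integrable ::
    "nat \<Rightarrow> (nat \<Rightarrow> real set) \<Rightarrow> (nat \<Rightarrow> real) \<Rightarrow> (nat \<Rightarrow> real) \<Rightarrow> ((nat \<Rightarrow> real) \<Rightarrow> real) \<Rightarrow> bool" where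
  "Omega_integrable n T a x f \<longleftrightarrow> iter_integrable T a x [0..<n] f (\<lambda>_. undefined)"

section \<open>Partial delta derivatives\<close>

text \<open>
  The limit runs over \<open>s \<rightarrow> x j\<close> in \<open>S j\<close> with only \<open>s = forward_jump (S j) (x j)\<close> excluded; thus
  \<open>s = x j\<close> is allowed when \<open>x j\<close> is right-scattered, and \<open>at\<close> cannot be used.
\<close>

definition delta_filter :: "real set \<Rightarrow> real \<Rightarrow> real filter" where
  "delta_filter S t = inf (nhds t) (principal (S - {forward_jump S t}))"

definition delta_quotient ::
    "(nat \<Rightarrow> real set) \<Rightarrow> nat \<Rightarrow> ((nat \<Rightarrow> real) \<Rightarrow> real) \<Rightarrow> (nat \<Rightarrow> real) \<Rightarrow> real \<Rightarrow> real" where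
  "delta_quotient S j f x s =
     (f (x(j := forward_jump (S j) (x j))) - f (x(j := s))) / (forward_jump (S j) (x j) - s)"

definition partial_delta_differentiable ::
    "(nat \<Rightarrow> real set) \<Rightarrow> nat \<Rightarrow> ((nat \<Rightarrow> real) \<Rightarrow> real) \<Rightarrow> (nat \<Rightarrow> real) \<Rightarrow> bool" where
  "partial_delta_differentiable S j f x \<longleftrightarrow>
     (\<exists>l. (delta_quotient S j f x \<longlongrightarrow> l) (delta_filter (S j) (x j)))"

definition partial_delta_deriv ::
    "(nat \<Rightarrow> real set) \<Rightarrow> nat \<Rightarrow> ((nat \<Rightarrow> real) \<Rightarrow> real) \<Rightarrow> (nat \<Rightarrow> real) \<Rightarrow> real" where
  "partial_delta_deriv S j f x = Lim (delta_filter (S j) (x j)) (delta_quotient S j f x)"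

text \<open>\<open>delta_D S f k\<close> is the mixed derivative of order \<open>k\<close>, once in each of the first \<open>k\<close>
  variables, the first variable being differentiated first.\<close>

fun delta_D ::
    "(nat \<Rightarrow> real set) \<Rightarrow> ((nat \<Rightarrow> real) \<Rightarrow> real) \<Rightarrow> nat \<Rightarrow> (nat \<Rightarrow> real) \<Rightarrow> real" where
  "delta_D S f 0 = f"
| "delta_D S f (Suc k) = partial_delta_deriv S k (delta_D S f k)"

text \<open>
  Functions on \<open>Omega n T a b\<close> are differentiated along the time scales \<open>T j \<inter> {a j..b j}\<close>.  Their
  forward jump agrees with that of \<open>T j\<close> at every point below \<open>b j\<close>, whereas at \<open>b j\<close> the jump of
  \<open>T j\<close> may leave the domain of the function.
\<close>

definition cut :: "(nat \<Rightarrow> real set) \<Rightarrow> (nat \<Rightarrow> real) \<Rightarrow> (nat \<Rightarrow> real) \<Rightarrow> nat \<Rightarrow> real set" where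
  "cut T a b j = T j \<inter> {a j..b j}"

definition Omega_kappa ::
    "nat \<Rightarrow> (nat \<Rightarrow> real set) \<Rightarrow> (nat \<Rightarrow> real) \<Rightarrow> (nat \<Rightarrow> real) \<Rightarrow> nat \<Rightarrow> (nat \<Rightarrow> real) set" where
  "Omega_kappa n T a b k =
     PiE {..<n} (\<lambda>j. if j < k then ts_kappa (cut T a b j) else cut T a b j)"

definition mixed_deriv ::
    "nat \<Rightarrow> (nat \<Rightarrow> real set) \<Rightarrow> (nat \<Rightarrow> real) \<Rightarrow> (nat \<Rightarrow> real)
      \<Rightarrow> ((nat \<Rightarrow> real) \<Rightarrow> real) \<Rightarrow> (nat \<Rightarrow> real) \<Rightarrow> real" where
  "mixed_deriv n T a b f = delta_D (cut T a b) f n"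

text \<open>The derivative of order \<open>k\<close> lives on \<open>Omega_kappa n T a b k\<close>, so \<open>mixed_deriv\<close> on
  \<open>Omega_kappa n T a b n\<close>.\<close>

definition L_class ::
    "nat \<Rightarrow> (nat \<Rightarrow> real set) \<Rightarrow> (nat \<Rightarrow> real) \<Rightarrow> (nat \<Rightarrow> real) \<Rightarrow> real
      \<Rightarrow> ((nat \<Rightarrow> real) \<Rightarrow> real) set" where
  "L_class n T a b p =
     {f. (\<forall>k<n. (\<forall>x\<in>Omega_kappa n T a b (Suc k).
                   partial_delta_differentiable (cut T a b) k (delta_D (cut T a b) f k) x) \<and>
                rd_continuous_on n T (Omega_kappa n T a b (Suc k))
                   (delta_D (cut T a b) f (Suc k))) \<and>
         (\<forall>j<n. \<forall>x\<in>Omega n T a b. x j = a j \<longrightarrow> f x = 0) \<and>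
         Omega_integrable n T a b (\<lambda>x. \<bar>mixed_deriv n T a b f x\<bar> powr p)}"

end

theory Submission
  imports Defs
begin

text \<open>
  Put \<open>p = \<alpha> + \<beta>\<close>, \<open>g = \<bar>dy\<bar>\<close> and let \<open>G x\<close> be the integral of \<open>g powr p\<close> over the box below \<open>x\<close>.
  Since \<open>y\<close> is the iterated integral of \<open>dy\<close>, Hoelder's inequality bounds \<open>\<bar>y\<bar>\<close> by \<open>G\<close> and the
  volume, and an inequality of Opial type gives \<open>\<bar>I x\<bar> \<le> K x * G x\<close>.  With Young's inequality for
  \<open>g powr \<gamma>\<close> the equation becomes \<open>g s \<le> A t + B t * G s\<close> for all \<open>s \<le> t\<close>, and Bihari's inequality
  with the frozen coefficients \<open>A t\<close>, \<open>B t\<close> bounds \<open>A t + B t * G t\<close> by the bracket in the conclusion.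

  Both inequalities reduce to dimension one: on the box below \<open>t\<close> the function \<open>G\<close> is at most the
  function \<open>u\<close> of the first coordinate alone that has all other upper limits fixed at those of \<open>t\<close>.
  In place of a chain rule, which time scales lack, there is the inequality
  \<open>\<integral> c(u) \<Delta>u \<le> \<psi>(u(x)) - \<psi>(u(a))\<close> for convex \<open>\<psi>\<close> with \<open>\<psi>' = c\<close>.  It is used with
  \<open>\<psi> z = \<alpha> / p * z powr (p / \<alpha>)\<close> for Opial and \<open>\<psi> z = z powr (1 - p) / (p - 1)\<close> for Bihari.
\<close>

section \<open>The delta measure\<close>

text \<open>The shape of the development is dictated by where things are meaningful. The mixed
  derivative is specified only on \<open>Omega_kappa\<close>, which omits left-scattered top faces,
  while a delta integral never sees the upper end points. All estimates are therefore made on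
  half-open boxes: these lie inside \<open>Omega_kappa\<close>, and on them rd-continuous functions
  are bounded and Borel, so every iterated integral of them exists. Only the integrand containing
  \<open>\<Phi>\<close> and the bracket of the conclusion come with mere integrability. The passage
  to one variable loses nothing where it matters: \<open>u\<close> dominates \<open>G\<close> on the
  box, yet agrees with it at the corner \<open>t\<close>. The remaining coordinates integrate to the
  product of their side lengths, which is how the volume gets into the bracket. Convexity replaces
  the chain rule because across a jump of \<open>u\<close> the increment of \<open>\<psi>\<close> is
  a secant, and the tangent at the left end lies below it. Freezing the coefficients costs nothing,
  since the bound is wanted only at \<open>t\<close>.\<close>

lemma forward_jump_ge:
  assumes "time_scale T" "t \<in> T"
  shows "t \<le> forward_jump T t"
proof (cases "\<exists>s\<in>T. t < s")
  case True
  then show ?thesis by (auto simp: forward_jump_def intro!: cInf_greatest)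
next
  case False
  then have "Sup T = t" using assms(2) by (intro cSup_eq_maximum) auto
  then show ?thesis using False by (simp add: forward_jump_def)
qed

lemma forward_jump_le:
  assumes "s \<in> T" "t < s"
  shows "forward_jump T t \<le> s"
proof -
  have "bdd_below {s \<in> T. t < s}" by (rule bdd_belowI[of _ t]) auto
  then have "Inf {s \<in> T. t < s} \<le> s" using assms by (intro cInf_lower) auto
  then show ?thesis using assms by (auto simp: forward_jump_def)
qed

text \<open>The measure lives on the whole line, so the bound is also needed at reals outside
  \<open>T\<close>; a later point of \<open>T\<close> takes the place of membership.\<close>

lemma forward_jump_lower:
  assumes "s \<in> T" "t < s"
  shows "t \<le> forward_jump T t"
  using assms by (auto simp: forward_jump_def intro!: cInf_greatest)

lemma forward_jump_in:
  assumes "time_scale T" "t \<in> T"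
  shows "forward_jump T t \<in> T"
proof (cases "\<exists>s\<in>T. t < s")
  case True
  have "bdd_below {s \<in> T. t < s}" by (rule bdd_belowI[of _ t]) auto
  then have "Inf {s \<in> T. t < s} \<in> closure {s \<in> T. t < s}"
    using True by (intro closure_contains_Inf) auto
  also have "\<dots> \<subseteq> T" using assms by (intro closure_minimal) (auto simp: time_scale_def)
  finally show ?thesis using True by (simp add: forward_jump_def)
next
  case False
  then have "Sup T = t" using assms(2) by (intro cSup_eq_maximum) auto
  then show ?thesis using False assms by (simp add: forward_jump_def)
qed

lemma forward_jump_gap:
  assumes "s \<in> T" "t < s" "s < forward_jump T t"
  shows False
  using forward_jump_le[OF assms(1,2)] assms(3) by simp

lemma forward_jump_mono:
  assumes "x \<le> y"
  shows "forward_jump T x \<le> forward_jump T y"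
proof (cases "\<exists>s\<in>T. y < s")
  case True
  then have "{s \<in> T. y < s} \<noteq> {}" by auto
  then have "forward_jump T x \<le> Inf {s \<in> T. y < s}"
    using assms by (intro cInf_greatest) (auto intro: forward_jump_le)
  then show ?thesis using True by (simp add: forward_jump_def)
next
  \<comment> \<open>Past the last point of \<open>T\<close> the jump has the default value
    \<open>Sup T\<close>, which dominates every point of \<open>T\<close> after
    \<open>x\<close>.\<close>
  case False
  then have y: "forward_jump T y = Sup T" by (simp add: forward_jump_def)
  show ?thesis
  proof (cases "\<exists>s\<in>T. x < s")
    case True
    then obtain s where s: "s \<in> T" "x < s" by auto
    have "bdd_above T" using False by (intro bdd_aboveI[of _ y]) force
    then have "s \<le> Sup T" using s by (intro cSup_upper)
    then show ?thesis using forward_jump_le[OF s] y by simp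
  next
    case False
    then show ?thesis using y by (simp add: forward_jump_def)
  qed
qed

text \<open>A point of \<open>T\<close> just above the infimum \<open>forward_jump T a\<close>
  bounds the jump at all reals below it; with no point to the right the jump is constant. With
  monotonicity this makes the jump an admissible distribution function.\<close>

lemma forward_jump_right_continuous:
  "continuous (at_right a) (forward_jump T)"
proof (subst continuous_at_right_real_increasing)
  show "forward_jump T x \<le> forward_jump T y" if "x \<le> y" for x y
    by (rule forward_jump_mono[OF that])
  show "\<forall>e>0. \<exists>d>0. forward_jump T (a + d) - forward_jump T a < e"
  proof (intro allI impI)
    fix e :: real assume e: "e > 0"
    show "\<exists>d>0. forward_jump T (a + d) - forward_jump T a < e"
    proof (cases "\<exists>s\<in>T. a < s")
      case True
      let ?S = "{s \<in> T. a < s}"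
      have "\<exists>s\<in>?S. s < Inf ?S + e" using True e by (intro cInf_lessD) auto
      then obtain s where s: "s \<in> T" "a < s" "s < forward_jump T a + e"
        using True by (auto simp: forward_jump_def)
      have "forward_jump T (a + (s - a) / 2) \<le> s"
        using s by (intro forward_jump_le) (auto simp: field_simps)
      then show ?thesis using s by (intro exI[of _ "(s - a) / 2"]) auto
    next
      case False
      then have "forward_jump T (a + 1) = forward_jump T a"
        by (force simp: forward_jump_def)
      then show ?thesis using e by (intro exI[of _ 1]) auto
    qed
  qed
qed

text \<open>The Borel measure whose completion is \<open>delta_measure\<close>. Measurability
  arguments run over \<open>borel\<close>, and integrals of Borel functions agree for both.\<close>

definition ts_measure :: "real set \<Rightarrow> real measure" where
  "ts_measure T = interval_measure (forward_jump T)"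

lemma sets_ts_measure [simp, measurable_cong]: "sets (ts_measure T) = sets borel"
  and space_ts_measure [simp]: "space (ts_measure T) = UNIV"
  by (simp_all add: ts_measure_def)

lemma emeasure_ts_measure_Ioc:
  assumes "u \<le> v"
  shows "emeasure (ts_measure T) {u<..v} = ennreal (forward_jump T v - forward_jump T u)"
  unfolding ts_measure_def
  using emeasure_interval_measure_Ioc[OF assms forward_jump_mono forward_jump_right_continuous]
  by blast

text \<open>For \<open>v < t\<close> with \<open>t\<close> in \<open>T\<close> the jump at
  \<open>v\<close> lies between \<open>v\<close> and \<open>t\<close>, so its left limit at
  \<open>t\<close> is \<open>t\<close>. Half-open intervals ending just before \<open>t\<close> then
  exhaust the open one.\<close>

lemma emeasure_ts_measure_Ioo:
  assumes "t \<in> T" "u < t"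
  shows "emeasure (ts_measure T) {u<..<t} = ennreal (t - forward_jump T u)"
proof -
  define v where "v k = t - (t - u) / real (Suc k)" for k
  have v: "u \<le> v k" "v k < t" "incseq v" "v \<longlonglongrightarrow> t" for k
  proof -
    have "(t - u) / real (Suc k) \<le> (t - u) / 1" using assms by (intro divide_left_mono) auto
    then show "u \<le> v k" by (simp add: v_def)
    show "v k < t" using assms by (simp add: v_def)
    show "incseq v" unfolding v_def incseq_def
      using assms by (auto intro!: divide_left_mono)
    have "(\<lambda>k. t - (t - u) / real (Suc k)) \<longlonglongrightarrow> t - 0"
      by (intro tendsto_intros LIMSEQ_Suc[OF lim_const_over_n])
    then show "v \<longlonglongrightarrow> t" by (simp add: v_def[abs_def])
  qed
  have "(\<lambda>k. emeasure (ts_measure T) {u<..v k}) \<longlonglongrightarrow> emeasure (ts_measure T) (\<Union>k. {u<..v k})"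
  proof (rule Lim_emeasure_incseq)
    show "incseq (\<lambda>k. {u<..v k})"
    proof (rule monoI)
      fix i j :: nat assume "i \<le> j"
      then have "v i \<le> v j" using v(3) by (auto simp: incseq_def)
      then show "{u<..v i} \<le> {u<..v j}" by auto
    qed
  qed auto
  moreover have "(\<Union>k. {u<..v k}) = {u<..<t}"
  proof (intro equalityI subsetI)
    fix x assume "x \<in> {u<..<t}"
    then have "eventually (\<lambda>k. x < v k) sequentially" and ux: "u < x"
      using v(4) by (auto intro: order_tendstoD)
    then obtain k where "x < v k" using eventually_happens'[OF sequentially_bot] by blast
    then show "x \<in> (\<Union>k. {u<..v k})" using ux by (intro UN_I[of k]) auto
  next
    fix x assume "x \<in> (\<Union>k. {u<..v k})"
    then obtain k where "u < x" "x \<le> v k" by auto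
    then show "x \<in> {u<..<t}" using v(2)[of k] by auto
  qed
  moreover have "(\<lambda>k. emeasure (ts_measure T) {u<..v k}) \<longlonglongrightarrow> ennreal (t - forward_jump T u)"
  proof -
    have "(\<lambda>k. forward_jump T (v k)) \<longlonglongrightarrow> t"
    proof (rule tendsto_sandwich[OF _ _ v(4) tendsto_const])
      show "\<forall>\<^sub>F k in sequentially. v k \<le> forward_jump T (v k)"
        using v(2) assms by (intro always_eventually allI forward_jump_lower[of t])
      show "\<forall>\<^sub>F k in sequentially. forward_jump T (v k) \<le> t"
        using v(2) assms by (intro always_eventually allI forward_jump_le)
    qed
    then have "(\<lambda>k. ennreal (forward_jump T (v k) - forward_jump T u)) \<longlonglongrightarrow> ennreal (t - forward_jump T u)"
      by (intro tendsto_intros)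
    then show ?thesis using v(1) by (simp add: emeasure_ts_measure_Ioc)
  qed
  ultimately show ?thesis using LIMSEQ_unique by metis
qed

text \<open>The atom is the difference of the two interval formulas; \<open>t - 1\<close> stands for
  any point to the left.\<close>

lemma emeasure_ts_measure_singleton:
  assumes "time_scale T" "t \<in> T"
  shows "emeasure (ts_measure T) {t} = ennreal (forward_jump T t - t)"
proof -
  have *: "forward_jump T (t - 1) \<le> t" "t \<le> forward_jump T t"
    using forward_jump_le[OF assms(2), of "t - 1"] forward_jump_ge[OF assms] by auto
  have eq: "{t - 1<..t} = {t - 1<..<t} \<union> {t}" by auto
  have "emeasure (ts_measure T) {t - 1<..t}
      = emeasure (ts_measure T) {t - 1<..<t} + emeasure (ts_measure T) {t}"
    unfolding eq by (rule plus_emeasure[symmetric]) auto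
  moreover have "emeasure (ts_measure T) {t - 1<..t} = ennreal (forward_jump T t - forward_jump T (t - 1))"
    by (rule emeasure_ts_measure_Ioc) simp
  moreover have "emeasure (ts_measure T) {t - 1<..<t} = ennreal (t - forward_jump T (t - 1))"
    by (rule emeasure_ts_measure_Ioo) (use assms in auto)
  moreover have "ennreal (forward_jump T t - forward_jump T (t - 1))
      = ennreal (t - forward_jump T (t - 1)) + ennreal (forward_jump T t - t)"
    using * by (subst ennreal_plus[symmetric]) auto
  ultimately have "ennreal (t - forward_jump T (t - 1)) + emeasure (ts_measure T) {t}
      = ennreal (t - forward_jump T (t - 1)) + ennreal (forward_jump T t - t)"
    by (auto simp only:)
  then show ?thesis by (subst (asm) ennreal_add_left_cancel) simp
qed

text \<open>The open complement is a countable union of rational intervals \<open>{p<..q}\<close>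
  with \<open>{p..q}\<close> disjoint from \<open>T\<close>. No point of \<open>T\<close> separates
  \<open>p\<close> from \<open>q\<close>, so the jump agrees at both and the interval has no
  mass.\<close>

lemma null_sets_ts_measure:
  assumes "time_scale T"
  shows "- T \<in> null_sets (ts_measure T)"
proof -
  let ?P = "{(p, q). p \<in> \<rat> \<and> q \<in> \<rat> \<and> p \<le> q \<and> {p..q} \<inter> T = {}}"
  have cov: "- T = (\<Union>(p, q)\<in>?P. {p<..q})"
  proof (intro equalityI subsetI)
    fix u assume u: "u \<in> - T"
    have "open (- T)" using assms by (auto simp: time_scale_def)
    then obtain e where e: "e > 0" "ball u e \<subseteq> - T" using u openE by blast
    obtain p where p: "p \<in> \<rat>" "u - e < p" "p < u" using Rats_dense_in_real[of "u - e" u] e by auto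
    obtain q where q: "q \<in> \<rat>" "u < q" "q < u + e" using Rats_dense_in_real[of u "u + e"] e by auto
    have "{p..q} \<subseteq> ball u e" using p q by (auto simp: dist_real_def)
    then have "(p, q) \<in> ?P" using p q e by auto
    then show "u \<in> (\<Union>(p, q)\<in>?P. {p<..q})" using p q by force
  next
    fix u assume "u \<in> (\<Union>(p, q)\<in>?P. {p<..q})"
    then obtain p q where pq: "{p..q} \<inter> T = {}" "p < u" "u \<le> q" by auto
    then have "u \<in> {p..q}" by simp
    then show "u \<in> - T" using pq(1) by blast
  qed
  have "countable ?P"
    by (rule countable_subset[of _ "\<rat> \<times> \<rat>"]) (auto intro: countable_rat)
  moreover have "{p<..q} \<in> null_sets (ts_measure T)" if "(p, q) \<in> ?P" for p q
  proof -
    have pq: "p \<le> q" and none: "\<And>s. s \<in> T \<Longrightarrow> p \<le> s \<Longrightarrow> s \<le> q \<Longrightarrow> False"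
      using that by (auto simp: disjoint_iff)
    have "{s \<in> T. p < s} = {s \<in> T. q < s}"
      using none pq by (auto intro: le_less_trans) (metis less_imp_le not_le)
    moreover from this have "(\<exists>s\<in>T. p < s) \<longleftrightarrow> (\<exists>s\<in>T. q < s)" by blast
    ultimately have "forward_jump T p = forward_jump T q" by (simp add: forward_jump_def)
    then show ?thesis using that by (simp add: null_sets_def emeasure_ts_measure_Ioc)
  qed
  ultimately show ?thesis unfolding cov by (intro null_sets_UN') auto
qed

text \<open>The atom at \<open>s\<close> contributes \<sigma>(s) - s and the open rest t -
  \<sigma>(s); intersecting with \<open>T\<close> removes only a null set.\<close>

lemma emeasure_ts_measure_Ico:
  assumes T: "time_scale T" and "s \<in> T" "t \<in> T" "s \<le> t"
  shows "emeasure (ts_measure T) (T \<inter> {s..<t}) = ennreal (t - s)"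
proof (cases "s = t")
  case False
  then have st: "s < t" using assms by simp
  have [measurable]: "T \<in> sets borel" using T by (auto simp: time_scale_def)
  have "AE x in ts_measure T. x \<in> T \<inter> {s..<t} \<longleftrightarrow> x \<in> {s..<t}"
    using AE_not_in[OF null_sets_ts_measure[OF T]] by eventually_elim auto
  then have "emeasure (ts_measure T) (T \<inter> {s..<t}) = emeasure (ts_measure T) {s..<t}"
    by (intro emeasure_eq_AE) auto
  also have "\<dots> = emeasure (ts_measure T) ({s} \<union> {s<..<t})"
    using st by (intro arg_cong[where f="emeasure (ts_measure T)"]) auto
  also have "emeasure (ts_measure T) ({s} \<union> {s<..<t})
      = emeasure (ts_measure T) {s} + emeasure (ts_measure T) {s<..<t}"
    by (intro plus_emeasure[symmetric]) auto
  also have "\<dots> = ennreal (forward_jump T s - s) + ennreal (t - forward_jump T s)"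
    using assms st by (simp add: emeasure_ts_measure_Ioo emeasure_ts_measure_singleton)
  also have "\<dots> = ennreal (t - s)"
    using forward_jump_ge[OF T \<open>s \<in> T\<close>] forward_jump_le[OF \<open>t \<in> T\<close> st]
    by (simp flip: ennreal_plus)
  finally show ?thesis .
qed simp

lemma measure_ts_measure_Ico:
  assumes "time_scale T" "s \<in> T" "t \<in> T" "s \<le> t"
  shows "measure (ts_measure T) (T \<inter> {s..<t}) = t - s"
  using emeasure_ts_measure_Ico[OF assms] assms by (simp add: measure_def)

section \<open>Induction on time scales\<close>

text \<open>A substitute for the mean value inequality, proved by a supremum argument. The points
  \<open>s\<close> satisfying the claim have a supremum \<open>m\<close> in \<open>T\<close>;
  \<open>left\<close> carries the claim to \<open>m\<close>, and if \<open>m < x\<close> one of the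
  other two hypotheses yields a larger point. The slack \<open>e\<close> leaves room for a limit of
  quotients at right-dense points.\<close>

lemma ts_growth:
  fixes V :: "real \<Rightarrow> real"
  assumes T: "time_scale T" and ax: "a \<in> T" "x \<in> T" "a \<le> x"
    and scattered: "\<And>t. t \<in> T \<Longrightarrow> a \<le> t \<Longrightarrow> t < x \<Longrightarrow> t < forward_jump T t \<Longrightarrow>
        V t - e * (forward_jump T t - t) \<le> V (forward_jump T t)"
    and dense: "\<And>t. t \<in> T \<Longrightarrow> a \<le> t \<Longrightarrow> t < x \<Longrightarrow> forward_jump T t = t \<Longrightarrow>
        \<exists>d>0. \<forall>s\<in>T. t < s \<longrightarrow> s < t + d \<longrightarrow> s \<le> x \<longrightarrow> V t - e * (s - t) \<le> V s"
    and left: "\<And>t \<eta>. t \<in> T \<Longrightarrow> a < t \<Longrightarrow> t \<le> x \<Longrightarrow> (\<forall>d>0. \<exists>s\<in>T. t - d < s \<and> s < t) \<Longrightarrow> 0 < \<eta> \<Longrightarrow>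
        \<exists>d>0. \<forall>s\<in>T. a \<le> s \<longrightarrow> t - d < s \<longrightarrow> s < t \<longrightarrow> V s - \<eta> \<le> V t"
    and e: "0 \<le> e"
  shows "V a - e * (x - a) \<le> V x"
proof -
  define S where "S = {s \<in> T. a \<le> s \<and> s \<le> x \<and> V a - e * (s - a) \<le> V s}"
  define m where "m = Sup S"
  have aS: "a \<in> S" using ax by (simp add: S_def)
  have bdd: "bdd_above S" by (rule bdd_aboveI[of _ x]) (auto simp: S_def)
  have "m \<in> closure S" unfolding m_def using aS bdd by (intro closure_contains_Sup) auto
  also have "\<dots> \<subseteq> T" using T by (intro closure_minimal) (auto simp: S_def time_scale_def)
  finally have mT: "m \<in> T" .
  have am: "a \<le> m" unfolding m_def using aS bdd by (rule cSup_upper)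
  have mx: "m \<le> x" unfolding m_def using aS by (intro cSup_least) (auto simp: S_def)
  have mS: "m \<in> S"
  proof (rule ccontr)
    assume n: "m \<notin> S"
    have near: "\<exists>s\<in>S. m - d < s \<and> s < m" if d: "d > 0" for d
    proof -
      have "\<exists>s\<in>S. m - d < s" unfolding m_def using aS d bdd
        by (intro less_cSupD) auto
      then obtain s where s: "s \<in> S" "m - d < s" by blast
      have "s \<le> m" unfolding m_def using s bdd by (intro cSup_upper)
      then show ?thesis using s n by (intro bexI[of _ s]) (auto simp: order_le_less)
    qed
    have am': "a < m" using am aS n by (auto simp: order_le_less)
    \<comment> \<open>If \<open>m\<close> were not in \<open>S\<close>, points of \<open>S\<close>
      would accumulate at it from the left, and the semicontinuity in \<open>left\<close> passes the
      inequality to the limit.\<close>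
    have "V a - e * (m - a) \<le> V m"
    proof (rule field_le_epsilon)
      fix \<eta> :: real assume \<eta>: "0 < \<eta>"
      have "\<forall>d>0. \<exists>s\<in>T. m - d < s \<and> s < m" using near by (fastforce simp: S_def)
      from left[OF mT am' mx this \<eta>] obtain d where d: "d > 0"
        "\<forall>s\<in>T. a \<le> s \<longrightarrow> m - d < s \<longrightarrow> s < m \<longrightarrow> V s - \<eta> \<le> V m" by blast
      from near[OF d(1)] obtain s where s: "s \<in> S" "m - d < s" "s < m" by blast
      have "V s - \<eta> \<le> V m" using d(2) s by (auto simp: S_def)
      moreover have "V a - e * (s - a) \<le> V s" using s by (auto simp: S_def)
      moreover have "e * (s - a) \<le> e * (m - a)" using s e by (intro mult_left_mono) auto
      ultimately show "V a - e * (m - a) \<le> V m + \<eta>" by linarith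
    qed
    then show False using n mT am mx by (simp add: S_def)
  qed
  have up: "s \<le> m" if "s \<in> S" for s unfolding m_def using that bdd by (rule cSup_upper)
  have "m = x"
  proof (rule ccontr)
    assume "m \<noteq> x"
    then have mx': "m < x" using mx by simp
    have "\<exists>s\<in>T. m < s \<and> s \<le> x \<and> V m - e * (s - m) \<le> V s"
    proof (cases "m < forward_jump T m")
      case True
      have "forward_jump T m \<le> x" using mx' ax by (intro forward_jump_le)
      then show ?thesis using True scattered[OF mT am mx' True] forward_jump_in[OF T mT] by blast
    next
      case False
      then have eq: "forward_jump T m = m" using forward_jump_ge[OF T mT] by simp
      from dense[OF mT am mx' eq] obtain d where d: "d > 0"
        "\<forall>s\<in>T. m < s \<longrightarrow> s < m + d \<longrightarrow> s \<le> x \<longrightarrow> V m - e * (s - m) \<le> V s" by blast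
      have ex: "\<exists>s\<in>T. m < s" using mx' ax by blast
      \<comment> \<open>At a right-dense point the infimum of the later points is \<open>m\<close>
        itself; the bound \<open>x - m\<close> keeps the chosen point below
        \<open>x\<close>.\<close>
      have "\<exists>s\<in>{s \<in> T. m < s}. s < m + min d (x - m)"
        using eq ex d(1) mx' by (intro cInf_lessD) (auto simp: forward_jump_def)
      then show ?thesis using d(2) by force
    qed
    then obtain s where s: "s \<in> T" "m < s" "s \<le> x" "V m - e * (s - m) \<le> V s" by blast
    have "V a - e * (m - a) \<le> V m" using mS by (simp add: S_def)
    then have "V a - e * (s - a) \<le> V s" using s(4) by (simp add: algebra_simps)
    then have "s \<in> S" using s am by (simp add: S_def)
    then show False using up s by fastforce
  qed
  then show ?thesis using mS by (simp add: S_def)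
qed

section \<open>Delta integrals of bounded functions\<close>

text \<open>Such functions are integrable over every bounded stretch of a time scale and are stable
  under restriction and products, so no integrability conditions have to be carried along.\<close>

definition bdd_meas :: "real set \<Rightarrow> (real \<Rightarrow> real) \<Rightarrow> bool" where
  "bdd_meas S h \<longleftrightarrow> h \<in> borel_measurable (restrict_space borel S) \<and> (\<exists>C. \<forall>s\<in>S. \<bar>h s\<bar> \<le> C)"

abbreviation ts_int :: "real set \<Rightarrow> real \<Rightarrow> real \<Rightarrow> (real \<Rightarrow> real) \<Rightarrow> real" where
  "ts_int T c d h \<equiv> set_lebesgue_integral (ts_measure T) (T \<inter> {c..<d}) h"

lemma bdd_meas_subset: "bdd_meas S h \<Longrightarrow> R \<subseteq> S \<Longrightarrow> bdd_meas R h"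
  unfolding bdd_meas_def by (meson measurable_restrict_mono subset_iff)

lemma time_scale_borel [measurable_dest]: "time_scale T \<Longrightarrow> T \<in> sets borel"
  by (auto simp: time_scale_def)

lemma ts_set_measurable:
  assumes "time_scale T" "bdd_meas (T \<inter> {c..<d}) h"
  shows "(\<lambda>s. indicator (T \<inter> {c..<d}) s *\<^sub>R h s) \<in> borel_measurable (interval_measure (forward_jump T))"
proof -
  have [measurable]: "T \<in> sets borel" using assms(1) by (rule time_scale_borel)
  show ?thesis using assms(2) unfolding bdd_meas_def
    by (subst (asm) borel_measurable_restrict_space_iff) auto
qed

lemma ts_set_integrable:
  assumes T: "time_scale T" and "c \<in> T" "d \<in> T" and h: "bdd_meas (T \<inter> {c..<d}) h"
  shows "set_integrable (ts_measure T) (T \<inter> {c..<d}) h"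
proof -
  let ?A = "T \<inter> {c..<d}"
  have [measurable]: "T \<in> sets borel" using T by (rule time_scale_borel)
  obtain C where C: "\<And>s. s \<in> ?A \<Longrightarrow> \<bar>h s\<bar> \<le> C" using h unfolding bdd_meas_def by blast
  have fin: "emeasure (ts_measure T) ?A < \<infinity>"
  proof (cases "c \<le> d")
    case True
    then show ?thesis using emeasure_ts_measure_Ico[OF T assms(2,3)] by simp
  qed simp
  \<comment> \<open>\<open>h\<close> is measurable only on \<open>?A\<close>. The rule for bounded
    functions is applied to \<open>h\<close> already cut off by the indicator, and the doubled
    indicator is then collapsed.\<close>
  have "integrable (ts_measure T) (\<lambda>x. indicator ?A x *\<^sub>R (indicator ?A x *\<^sub>R h x))"
    using ts_set_measurable[OF T h] fin C
    by (intro integrableI_bounded_set_indicator[where B=C]) (auto simp: ts_measure_def)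
  then show ?thesis
    unfolding set_integrable_def by (rule Bochner_Integration.integrable_cong[THEN iffD1, rotated -1])
      (auto simp: indicator_def)
qed

text \<open>Completion changes neither integrability nor the integral of a Borel function, so the
  delta integrals can be computed with \<open>ts_measure\<close>.\<close>

lemma delta_integrable_ts_int:
  assumes T: "time_scale T" and "c \<in> T" "d \<in> T" and h: "bdd_meas (T \<inter> {c..<d}) h"
  shows "delta_integrable T c d h" "delta_integral T c d h = ts_int T c d h"
proof -
  note m = ts_set_measurable[OF T h]
  show "delta_integrable T c d h"
    using ts_set_integrable[OF assms] m
    by (simp add: delta_integrable_def delta_measure_def set_integrable_def ts_measure_def integrable_completion)
  show "delta_integral T c d h = ts_int T c d h"
    using m by (simp add: delta_integral_def delta_measure_def set_lebesgue_integral_def ts_measure_def integral_completion)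
qed

lemma bdd_meas_const: "bdd_meas S (\<lambda>_. k)"
  by (auto simp: bdd_meas_def)

lemma bdd_meas_mult:
  assumes "bdd_meas S f" "bdd_meas S g"
  shows "bdd_meas S (\<lambda>s. f s * g s)"
proof -
  obtain C D where C: "\<And>s. s \<in> S \<Longrightarrow> \<bar>f s\<bar> \<le> C" and D: "\<And>s. s \<in> S \<Longrightarrow> \<bar>g s\<bar> \<le> D"
    using assms unfolding bdd_meas_def by metis
  have "\<bar>f s * g s\<bar> \<le> C * D" if "s \<in> S" for s
    unfolding abs_mult using C[OF that] D[OF that] by (intro mult_mono) auto
  moreover have "(\<lambda>s. f s * g s) \<in> borel_measurable (restrict_space borel S)"
    using assms unfolding bdd_meas_def by (intro borel_measurable_times) auto
  ultimately show ?thesis unfolding bdd_meas_def by blast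
qed

lemma bdd_meas_uminus: "bdd_meas S f \<Longrightarrow> bdd_meas S (\<lambda>s. - f s)"
  using bdd_meas_mult[OF bdd_meas_const[of S "-1"]] by simp

lemma ts_int_const:
  assumes T: "time_scale T" and "c \<in> T" "d \<in> T" "c \<le> d"
  shows "ts_int T c d (\<lambda>_. k) = k * (d - c)"
  using measure_ts_measure_Ico[OF assms] time_scale_borel[OF T]
  by (simp add: set_lebesgue_integral_def mult.commute)

lemma ts_int_upper:
  assumes T: "time_scale T" and cd: "c \<in> T" "d \<in> T" "c \<le> d" and h: "bdd_meas (T \<inter> {c..<d}) h"
    and "\<And>s. s \<in> T \<Longrightarrow> c \<le> s \<Longrightarrow> s < d \<Longrightarrow> h s \<le> k"
  shows "ts_int T c d h \<le> k * (d - c)"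
proof -
  have "ts_int T c d h \<le> ts_int T c d (\<lambda>_. k)"
    using assms by (intro set_integral_mono ts_set_integrable bdd_meas_const) auto
  then show ?thesis using ts_int_const[OF T cd] by simp
qed

lemma ts_int_lower:
  assumes T: "time_scale T" and cd: "c \<in> T" "d \<in> T" "c \<le> d" and h: "bdd_meas (T \<inter> {c..<d}) h"
    and "\<And>s. s \<in> T \<Longrightarrow> c \<le> s \<Longrightarrow> s < d \<Longrightarrow> k \<le> h s"
  shows "k * (d - c) \<le> ts_int T c d h"
proof -
  have "ts_int T c d (\<lambda>_. k) \<le> ts_int T c d h"
    using assms by (intro set_integral_mono ts_set_integrable bdd_meas_const) auto
  then show ?thesis using ts_int_const[OF T cd] by simp
qed

lemma ts_int_split:
  assumes T: "time_scale T" and cd: "c \<in> T" "r \<in> T" "d \<in> T" "c \<le> r" "r \<le> d"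
    and h: "bdd_meas (T \<inter> {c..<d}) h"
  shows "ts_int T c d h = ts_int T c r h + ts_int T r d h"
proof -
  have eq: "T \<inter> {c..<d} = (T \<inter> {c..<r}) \<union> (T \<inter> {r..<d})" using cd by auto
  show ?thesis unfolding eq
    using T cd h by (intro set_integral_Un ts_set_integrable) (auto elim: bdd_meas_subset)
qed

text \<open>The range contains no point of \<open>T\<close> other than \<open>t\<close>, so the
  upper and the lower constant bound coincide.\<close>

lemma ts_int_scattered:
  assumes T: "time_scale T" and t: "t \<in> T" and h: "bdd_meas (T \<inter> {t..<forward_jump T t}) h"
  shows "ts_int T t (forward_jump T t) h = h t * (forward_jump T t - t)"
proof -
  have "s = t" if "s \<in> T" "t \<le> s" "s < forward_jump T t" for s
    using forward_jump_gap[of s T t] that by (cases "s = t") auto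
  then show ?thesis
    using ts_int_upper[OF T t forward_jump_in[OF T t] forward_jump_ge[OF T t] h, of "h t"]
      ts_int_lower[OF T t forward_jump_in[OF T t] forward_jump_ge[OF T t] h, of "h t"]
    by fastforce
qed

lemma ts_int_Lipschitz:
  assumes T: "time_scale T" and h: "bdd_meas (T \<inter> {a..<b}) h"
  obtains C where "0 < C" "\<And>c d. c \<in> T \<Longrightarrow> d \<in> T \<Longrightarrow> a \<le> c \<Longrightarrow> c \<le> d \<Longrightarrow> d \<le> b \<Longrightarrow>
    \<bar>ts_int T c d h\<bar> \<le> C * (d - c)"
proof -
  obtain C where C: "\<And>s. s \<in> T \<inter> {a..<b} \<Longrightarrow> \<bar>h s\<bar> \<le> C" using h unfolding bdd_meas_def by blast
  \<comment> \<open>The constant \<open>\<bar>C\<bar> + 1\<close> is positive even for a degenerate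
    bound, which allows division by it.\<close>
  have "\<bar>ts_int T c d h\<bar> \<le> (\<bar>C\<bar> + 1) * (d - c)" if cd: "c \<in> T" "d \<in> T" "a \<le> c" "c \<le> d" "d \<le> b" for c d
  proof -
    have h': "bdd_meas (T \<inter> {c..<d}) h" using h cd by (elim bdd_meas_subset) auto
    have "ts_int T c d h \<le> (\<bar>C\<bar> + 1) * (d - c)"
      using cd C by (intro ts_int_upper[OF T _ _ _ h']) force+
    moreover have "(- (\<bar>C\<bar> + 1)) * (d - c) \<le> ts_int T c d h"
      using cd C by (intro ts_int_lower[OF T _ _ _ h']) (auto simp: abs_le_iff, force)
    moreover have "(- (\<bar>C\<bar> + 1)) * (d - c) = - ((\<bar>C\<bar> + 1) * (d - c))" by (rule mult_minus_left)
    ultimately show ?thesis by linarith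
  qed
  then show ?thesis using that[of "\<bar>C\<bar> + 1"] by simp
qed

section \<open>The fundamental theorem of calculus\<close>

text \<open>Truncation at \<open>b\<close> keeps \<open>b\<close> as a competitor in the infimum, so
  only points beyond \<open>b\<close>, which cannot attain it, are lost.\<close>

lemma forward_jump_cut:
  assumes "b \<in> T" "a \<le> t" "t < b"
  shows "forward_jump (T \<inter> {a..b}) t = forward_jump T t"
proof -
  let ?A = "{s \<in> T. t < s}" and ?B = "{s \<in> T \<inter> {a..b}. t < s}"
  have "bdd_below ?A" by (rule bdd_belowI[of _ t]) auto
  moreover have B: "b \<in> ?B" using assms by auto
  ultimately have "Inf ?A \<le> Inf ?B" by (intro cInf_superset_mono) auto
  moreover have "Inf ?B \<le> Inf ?A"
  proof (rule cInf_greatest)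
    show "?A \<noteq> {}" using assms by auto
    fix s assume s: "s \<in> ?A"
    have bdd: "bdd_below ?B" by (rule bdd_belowI[of _ t]) auto
    show "Inf ?B \<le> s"
    proof (cases "s \<le> b")
      case True
      then show ?thesis using s assms by (intro cInf_lower[OF _ bdd]) auto
    next
      case False
      then show ?thesis using cInf_lower[OF B bdd] by simp
    qed
  qed
  ultimately show ?thesis using assms by (auto simp: forward_jump_def)
qed

lemma ts_kappa_below_max: "b \<in> S \<Longrightarrow> t \<in> S \<Longrightarrow> t < b \<Longrightarrow> t \<in> ts_kappa S"
  by (force simp: ts_kappa_def)

lemma eventually_delta_filter:
  "eventually P (delta_filter S t) \<longleftrightarrow>
    (\<exists>d>0. \<forall>s\<in>S. s \<noteq> forward_jump S t \<longrightarrow> \<bar>s - t\<bar> < d \<longrightarrow> P s)"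
  unfolding delta_filter_def eventually_inf_principal eventually_nhds_metric
  by (auto simp: dist_real_def)

lemma time_scale_cut: "time_scale T \<Longrightarrow> b \<in> T \<Longrightarrow> a \<le> b \<Longrightarrow> time_scale (T \<inter> {a..b})"
  by (auto simp: time_scale_def)

text \<open>A right-scattered point is itself a member of the set along which the quotient converges,
  so there the limit is a value.\<close>

lemma delta_deriv_scattered:
  fixes g :: "real \<Rightarrow> real"
  assumes "t \<in> S" "t \<noteq> forward_jump S t" and lim: "(g \<longlongrightarrow> l) (delta_filter S t)"
  shows "g t = l"
proof (rule ccontr)
  assume "g t \<noteq> l"
  then have "0 < dist (g t) l" by simp
  from tendstoD[OF lim this] obtain d where "d > 0"
    "\<forall>s\<in>S. s \<noteq> forward_jump S t \<longrightarrow> \<bar>s - t\<bar> < d \<longrightarrow> dist (g s) l < dist (g t) l"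
    unfolding eventually_delta_filter by blast
  then show False using assms(1,2) by force
qed

text \<open>Solve the difference quotient for \<open>f s\<close> and pass to the limit. The limit is
  \<open>f t\<close> trivially when \<open>t\<close> is its own jump; otherwise the derivative is
  the quotient at \<open>t\<close> itself.\<close>

lemma delta_differentiable_continuous:
  fixes f :: "real \<Rightarrow> real"
  assumes t: "t \<in> S"
    and lim: "((\<lambda>s. (f (forward_jump S t) - f s) / (forward_jump S t - s)) \<longlongrightarrow> l) (delta_filter S t)"
  shows "(f \<longlongrightarrow> f t) (delta_filter S t)"
proof -
  let ?\<sigma> = "forward_jump S t"
  let ?q = "\<lambda>s. (f ?\<sigma> - f s) / (?\<sigma> - s)"
  have id: "((\<lambda>s. s) \<longlongrightarrow> t) (delta_filter S t)"
    unfolding delta_filter_def by (rule tendsto_mono[OF inf_le1 filterlim_ident])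
  have "((\<lambda>s. f ?\<sigma> - ?q s * (?\<sigma> - s)) \<longlongrightarrow> f ?\<sigma> - l * (?\<sigma> - t)) (delta_filter S t)"
    by (intro tendsto_intros lim id)
  moreover have "f ?\<sigma> - l * (?\<sigma> - t) = f t"
  proof (cases "t = ?\<sigma>")
    case False
    then have "?q t = l" using delta_deriv_scattered[OF t False lim] by simp
    then show ?thesis using False by (auto simp: field_simps)
  qed simp
  moreover have "\<forall>\<^sub>F s in delta_filter S t. f ?\<sigma> - ?q s * (?\<sigma> - s) = f s"
    unfolding eventually_delta_filter by (auto intro!: exI[of _ 1])
  ultimately show ?thesis by (simp add: filterlim_cong)
qed

text \<open>\<open>ts_growth\<close> applied to \<open>f\<close> minus the integral of
  \<open>f'\<close>. This difference does not change across a gap. At a right-dense \<open>t\<close>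
  the quotient of \<open>f\<close> and the values of \<open>f'\<close> just after \<open>t\<close>
  both lie within \<open>e / 2\<close> of \<open>f' t\<close>. From the left, \<open>f\<close> is
  continuous because it is differentiable, and the integral is Lipschitz.\<close>

lemma ts_FTC_le:
  fixes f f' :: "real \<Rightarrow> real"
  assumes T: "time_scale T" and ab: "a \<in> T" "b \<in> T" "x \<in> T" "a \<le> x" "x \<le> b"
    and f': "bdd_meas (T \<inter> {a..<b}) f'"
    and S: "S = T \<inter> {a..b}"
    and deriv: "\<And>t. t \<in> ts_kappa S \<Longrightarrow>
       ((\<lambda>s. (f (forward_jump S t) - f s) / (forward_jump S t - s)) \<longlongrightarrow> f' t) (delta_filter S t)"
    and rc: "\<And>t e. t \<in> T \<Longrightarrow> a \<le> t \<Longrightarrow> t < b \<Longrightarrow> 0 < e \<Longrightarrow>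
       \<exists>d>0. \<forall>s\<in>T. t < s \<longrightarrow> s < t + d \<longrightarrow> s < b \<longrightarrow> \<bar>f' s - f' t\<bar> < e"
  shows "ts_int T a x f' \<le> f x - f a"
proof -
  define V where "V s = f s - ts_int T a s f'" for s
  have sub: "bdd_meas (T \<inter> {c..<d}) f'" if "a \<le> c" "d \<le> b" for c d
    using f' by (rule bdd_meas_subset) (use that in auto)
  have V_diff: "V s - V t = f s - f t - ts_int T t s f'"
    if "t \<in> T" "s \<in> T" "a \<le> t" "t \<le> s" "s \<le> b" for s t
    using ts_int_split[OF T ab(1) that(1,2,3,4) sub] that by (simp add: V_def)
  have kappa: "t \<in> ts_kappa S" if "t \<in> T" "a \<le> t" "t < b" for t
    using that ab by (intro ts_kappa_below_max[of b]) (auto simp: S)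
  have main: "V a - e * (x - a) \<le> V x" if e: "0 < e" for e
  proof (rule ts_growth[OF T ab(1,3,4)])
    show "0 \<le> e" using e by simp
  next
    fix t assume t: "t \<in> T" "a \<le> t" "t < x" "t < forward_jump T t"
    let ?\<sigma> = "forward_jump T t"
    have \<sigma>: "?\<sigma> \<in> T" "?\<sigma> \<le> b" "forward_jump S t = ?\<sigma>"
      using forward_jump_in[OF T t(1)] forward_jump_le[OF ab(3) t(3)] ab t
      by (auto simp: S forward_jump_cut)
    have "(f ?\<sigma> - f t) / (?\<sigma> - t) = f' t"
      using delta_deriv_scattered[OF _ _ deriv[of t]] t ab kappa[of t] \<sigma> by (auto simp: S)
    then have "f ?\<sigma> - f t = f' t * (?\<sigma> - t)" using t by (auto simp: field_simps)
    moreover have "ts_int T t ?\<sigma> f' = f' t * (?\<sigma> - t)"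
      using t \<sigma> by (intro ts_int_scattered[OF T] sub)
    ultimately have "V ?\<sigma> - V t = 0" using V_diff[of t ?\<sigma>] t \<sigma> by simp
    then show "V t - e * (?\<sigma> - t) \<le> V ?\<sigma>" using e t by (simp add: mult_nonneg_nonneg)
  next
    fix t assume t: "t \<in> T" "a \<le> t" "t < x" "forward_jump T t = t"
    have \<sigma>: "forward_jump S t = t" using forward_jump_cut[of b T a t] ab t by (simp add: S)
    have k: "t \<in> ts_kappa S" using kappa t ab by simp
    obtain d1 where d1: "d1 > 0" "\<And>s. s \<in> S \<Longrightarrow> s \<noteq> t \<Longrightarrow> \<bar>s - t\<bar> < d1 \<Longrightarrow>
        \<bar>(f t - f s) / (t - s) - f' t\<bar> < e / 2"
      using tendstoD[OF deriv[OF k], of "e / 2"] e \<sigma>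
      unfolding eventually_delta_filter by (auto simp: dist_real_def)
    obtain d2 where d2: "d2 > 0" "\<And>s. s \<in> T \<Longrightarrow> t < s \<Longrightarrow> s < t + d2 \<Longrightarrow> s < b \<Longrightarrow> \<bar>f' s - f' t\<bar> < e / 2"
    proof -
      have "\<exists>d>0. \<forall>s\<in>T. t < s \<longrightarrow> s < t + d \<longrightarrow> s < b \<longrightarrow> \<bar>f' s - f' t\<bar> < e / 2"
        using t ab e by (intro rc) auto
      then show ?thesis using that by blast
    qed
    show "\<exists>d>0. \<forall>s\<in>T. t < s \<longrightarrow> s < t + d \<longrightarrow> s \<le> x \<longrightarrow> V t - e * (s - t) \<le> V s"
    proof (intro exI[of _ "min d1 d2"] conjI ballI impI)
      fix s assume s: "s \<in> T" "t < s" "s < t + min d1 d2" "s \<le> x"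
      have "\<bar>(f t - f s) / (t - s) - f' t\<bar> < e / 2" using d1(2)[of s] s t ab by (auto simp: S)
      moreover have "(f t - f s) / (t - s) = (f s - f t) / (s - t)"
        by (metis minus_diff_eq minus_divide_divide)
      ultimately have "f' t - e / 2 < (f s - f t) / (s - t)"
        by (simp only: abs_less_iff) linarith
      then have "(f' t - e / 2) * (s - t) < f s - f t" using s by (simp add: pos_less_divide_eq)
      moreover have "ts_int T t s f' \<le> (f' t + e / 2) * (s - t)"
      proof (rule ts_int_upper[OF T t(1) s(1)])
        fix r assume r: "r \<in> T" "t \<le> r" "r < s"
        show "f' r \<le> f' t + e / 2"
        proof (cases "r = t")
          case False
          then have "\<bar>f' r - f' t\<bar> < e / 2" using r s ab by (intro d2(2)) auto
          then show ?thesis by linarith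
        qed (use e in simp)
      qed (use s t ab sub in auto)
      moreover have "V s - V t = f s - f t - ts_int T t s f'" using t s ab by (intro V_diff) auto
      moreover have "(f' t + e / 2) * (s - t) = (f' t - e / 2) * (s - t) + e * (s - t)"
        by (simp add: field_simps)
      ultimately show "V t - e * (s - t) \<le> V s" by linarith
    qed (use d1 d2 in auto)
  next
    fix t \<eta> :: real
    assume t: "t \<in> T" "a < t" "t \<le> x" "\<forall>d>0. \<exists>s\<in>T. t - d < s \<and> s < t" and \<eta>: "0 < \<eta>"
    have tS: "t \<in> S" using t ab by (auto simp: S)
    have near: "\<exists>s\<in>S. t - d < s \<and> s < t" if "d > 0" for d
      using t(4)[rule_format, of "min d (t - a)"] that t(2,3) ab by (force simp: S)
    \<comment> \<open>A left-dense point belongs to \<open>ts_kappa S\<close> even when it is the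
      maximum of \<open>S\<close>, so differentiability, hence continuity, is available
      there.\<close>
    have "\<not> backward_jump S t < t"
    proof
      assume less: "backward_jump S t < t"
      have ex: "\<exists>s\<in>S. s < t" using near[of 1] by auto
      then have bj: "backward_jump S t = Sup {s \<in> S. s < t}" by (simp add: backward_jump_def)
      obtain s where s: "s \<in> S" "backward_jump S t < s" "s < t"
        using near[of "t - backward_jump S t"] less by auto
      have "s \<le> Sup {s \<in> S. s < t}"
        using s by (intro cSup_upper) (auto intro!: bdd_aboveI[of _ t])
      then show False using s bj by simp
    qed
    then have k: "t \<in> ts_kappa S" using tS by (simp add: ts_kappa_def)
    have tsS: "time_scale S" unfolding S using T ab by (intro time_scale_cut) auto
    obtain d1 where d1: "d1 > 0" "\<And>s. s \<in> S \<Longrightarrow> s \<noteq> forward_jump S t \<Longrightarrow> \<bar>s - t\<bar> < d1 \<Longrightarrow>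
        \<bar>f s - f t\<bar> < \<eta> / 2"
      using tendstoD[OF delta_differentiable_continuous[OF tS deriv[OF k]], of "\<eta> / 2"] \<eta>
      unfolding eventually_delta_filter by (auto simp: dist_real_def)
    obtain C where C: "0 < C" "\<And>c d. c \<in> T \<Longrightarrow> d \<in> T \<Longrightarrow> a \<le> c \<Longrightarrow> c \<le> d \<Longrightarrow> d \<le> b \<Longrightarrow>
        \<bar>ts_int T c d f'\<bar> \<le> C * (d - c)" using ts_int_Lipschitz[OF T f'] by blast
    show "\<exists>d>0. \<forall>s\<in>T. a \<le> s \<longrightarrow> t - d < s \<longrightarrow> s < t \<longrightarrow> V s - \<eta> \<le> V t"
    proof (intro exI[of _ "min d1 (\<eta> / (2 * C))"] conjI ballI impI)
      fix s assume s: "s \<in> T" "a \<le> s" "t - min d1 (\<eta> / (2 * C)) < s" "s < t"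
      have "\<bar>f s - f t\<bar> < \<eta> / 2"
        using d1(2)[of s] s t ab forward_jump_ge[OF tsS tS] by (auto simp: S)
      moreover have "\<bar>ts_int T s t f'\<bar> \<le> C * (t - s)" using C(2) s t ab by simp
      moreover have "C * (t - s) \<le> \<eta> / 2"
      proof -
        have "t - s \<le> \<eta> / (2 * C)" using s by auto
        then have "C * (t - s) \<le> C * (\<eta> / (2 * C))" using C(1) by (intro mult_left_mono) auto
        then show ?thesis using C(1) by simp
      qed
      ultimately show "V s - \<eta> \<le> V t" using V_diff[of s t] s t ab by linarith
    qed (use d1 C \<eta> in auto)
  qed
  have "V a \<le> V x"
  proof (rule field_le_epsilon)
    fix e :: real assume e: "0 < e"
    \<comment> \<open>The accumulated slack stays below \<open>e\<close>; the summand 1 covers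
      \<open>x = a\<close>.\<close>
    have "e / (x - a + 1) * (x - a) \<le> e" using e ab by (simp add: field_simps)
    then show "V a \<le> V x + e" using main[of "e / (x - a + 1)"] e ab by simp
  qed
  then show ?thesis by (simp add: V_def set_lebesgue_integral_def)
qed

text \<open>The inequality applied to \<open>-f\<close> and \<open>-f'\<close> supplies the other
  half.\<close>

lemma ts_FTC:
  fixes f f' :: "real \<Rightarrow> real"
  assumes T: "time_scale T" and ab: "a \<in> T" "b \<in> T" "x \<in> T" "a \<le> x" "x \<le> b"
    and f': "bdd_meas (T \<inter> {a..<b}) f'"
    and S: "S = T \<inter> {a..b}"
    and deriv: "\<And>t. t \<in> ts_kappa S \<Longrightarrow>
       ((\<lambda>s. (f (forward_jump S t) - f s) / (forward_jump S t - s)) \<longlongrightarrow> f' t) (delta_filter S t)"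
    and rc: "\<And>t e. t \<in> T \<Longrightarrow> a \<le> t \<Longrightarrow> t < b \<Longrightarrow> 0 < e \<Longrightarrow>
       \<exists>d>0. \<forall>s\<in>T. t < s \<longrightarrow> s < t + d \<longrightarrow> s < b \<longrightarrow> \<bar>f' s - f' t\<bar> < e"
  shows "ts_int T a x f' = f x - f a"
proof (rule antisym)
  show "ts_int T a x f' \<le> f x - f a" using assms by (rule ts_FTC_le)
  have "ts_int T a x (\<lambda>s. - f' s) \<le> (\<lambda>s. - f s) x - (\<lambda>s. - f s) a"
  proof (rule ts_FTC_le[OF T ab bdd_meas_uminus[OF f'] S])
    fix t assume "t \<in> ts_kappa S"
    from tendsto_minus[OF deriv[OF this]]
    show "((\<lambda>s. (- f (forward_jump S t) - - f s) / (forward_jump S t - s)) \<longlongrightarrow> - f' t) (delta_filter S t)"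
      by (rule filterlim_mono_eventually) (auto simp: divide_simps)
  next
    fix t e :: real assume "t \<in> T" "a \<le> t" "t < b" "0 < e"
    from rc[OF this] show "\<exists>d>0. \<forall>s\<in>T. t < s \<longrightarrow> s < t + d \<longrightarrow> s < b \<longrightarrow> \<bar>- f' s - - f' t\<bar> < e"
      by (simp add: abs_minus_commute)
  qed
  moreover have "ts_int T a x (\<lambda>s. - f' s) = - ts_int T a x f'"
    by (simp add: set_lebesgue_integral_def)
  ultimately show "f x - f a \<le> ts_int T a x f'" by simp
qed

section \<open>A chain rule inequality for convex functions\<close>

text \<open>\<open>ts_growth\<close> applied to \<psi>(u) minus the integral of c(u) h. On a gap,
  c(u) h integrates to c(u t) times the increment of \<open>u\<close>, which the supporting line
  \<open>conv\<close> bounds by the increment of \<open>\<psi>\<close>. On short stretches c(u) is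
  almost constant by uniform continuity, so the same comparison holds up to \<open>e\<close>. The
  sign of \<open>c\<close> is free, as Bihari's inequality requires.\<close>

lemma ts_convex_chain:
  fixes h c \<psi> :: "real \<Rightarrow> real"
  assumes T: "time_scale T" and ax: "a \<in> T" "x \<in> T" "a \<le> x"
    and h: "bdd_meas (T \<inter> {a..<x}) h" and h0: "\<And>s. s \<in> T \<Longrightarrow> a \<le> s \<Longrightarrow> s < x \<Longrightarrow> 0 \<le> h s"
    and u: "u = (\<lambda>r. u0 + ts_int T a r h)"
    and c: "continuous_on {u0..u x} c"
    and conv: "\<And>z z'. u0 \<le> z \<Longrightarrow> z \<le> z' \<Longrightarrow> z' \<le> u x \<Longrightarrow> \<psi> z + c z * (z' - z) \<le> \<psi> z'"
  shows "bdd_meas (T \<inter> {a..<x}) (\<lambda>s. c (u s))"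
    and "ts_int T a x (\<lambda>s. c (u s) * h s) \<le> \<psi> (u x) - \<psi> u0"
proof -
  have sub: "bdd_meas (T \<inter> {r..<s}) h" if "a \<le> r" "s \<le> x" for r s
    using h by (rule bdd_meas_subset) (use that in auto)
  have u_diff: "u s - u r = ts_int T r s h"
    if "r \<in> T" "s \<in> T" "a \<le> r" "r \<le> s" "s \<le> x" for s r
    using ts_int_split[OF T ax(1) that(1,2,3,4) sub] that by (simp add: u)
  have u_mono: "u r \<le> u s" if "r \<in> T" "s \<in> T" "a \<le> r" "r \<le> s" "s \<le> x" for s r
    using ts_int_lower[OF T that(1,2,4) sub, of 0] u_diff[OF that] that h0 by fastforce
  have ua: "u a = u0" by (simp add: u set_lebesgue_integral_def)
  have u_in: "u r \<in> {u0..u x}" if "r \<in> T" "a \<le> r" "r \<le> x" for r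
    using u_mono[of a r] u_mono[of r x] that ax ua by auto
  \<comment> \<open>\<open>u\<close> is the integral of a nonnegative function, hence monotone along
    \<open>T\<close>, and therefore Borel.\<close>
  have u_meas: "u \<in> measurable (restrict_space borel (T \<inter> {a..<x})) (restrict_space borel {u0..u x})"
  proof (rule measurable_restrict_space2)
    show "u \<in> space (restrict_space borel (T \<inter> {a..<x})) \<rightarrow> {u0..u x}"
      using u_in by (auto simp: space_restrict_space)
    show "u \<in> borel_measurable (restrict_space borel (T \<inter> {a..<x}))"
      by (intro borel_measurable_mono_on_fnc mono_onI) (auto intro: u_mono)
  qed
  have cmeas: "c \<in> borel_measurable (restrict_space borel {u0..u x})"
    using c by (rule borel_measurable_continuous_on_restrict)
  have "compact (c ` {u0..u x})" using c by (intro compact_continuous_image) auto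
  then have "bounded (c ` {u0..u x})" by (rule compact_imp_bounded)
  then obtain D where D: "D > 0" "\<And>z. z \<in> {u0..u x} \<Longrightarrow> \<bar>c z\<bar> \<le> D"
    unfolding bounded_pos by auto
  show cu: "bdd_meas (T \<inter> {a..<x}) (\<lambda>s. c (u s))"
    unfolding bdd_meas_def
  proof
    show "(\<lambda>s. c (u s)) \<in> borel_measurable (restrict_space borel (T \<inter> {a..<x}))"
      using measurable_comp[OF u_meas cmeas] by (simp add: comp_def)
    show "\<exists>C. \<forall>s\<in>T \<inter> {a..<x}. \<bar>c (u s)\<bar> \<le> C"
      using D u_in by (intro exI[of _ D]) auto
  qed
  have cuh: "bdd_meas (T \<inter> {a..<x}) (\<lambda>s. c (u s) * h s)" using cu h by (rule bdd_meas_mult)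
  have cuh_sub: "bdd_meas (T \<inter> {r..<s}) (\<lambda>s. c (u s) * h s)" if "a \<le> r" "s \<le> x" for r s
    using cuh by (rule bdd_meas_subset) (use that in auto)
  define V where "V r = \<psi> (u r) - ts_int T a r (\<lambda>s. c (u s) * h s)" for r
  have V_diff: "c (u r) * ts_int T r s h - ts_int T r s (\<lambda>s. c (u s) * h s) \<le> V s - V r"
    if "r \<in> T" "s \<in> T" "a \<le> r" "r \<le> s" "s \<le> x" for s r
  proof -
    have "\<psi> (u r) + c (u r) * (u s - u r) \<le> \<psi> (u s)"
      using u_in[of r] u_in[of s] u_mono[of r s] that by (intro conv) auto
    then show ?thesis
      using ts_int_split[OF T ax(1) that(1,2,3,4) cuh_sub] that u_diff[OF that] by (simp add: V_def)
  qed
  obtain C where C: "0 < C" "\<And>c d. c \<in> T \<Longrightarrow> d \<in> T \<Longrightarrow> a \<le> c \<Longrightarrow> c \<le> d \<Longrightarrow> d \<le> x \<Longrightarrow>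
        \<bar>ts_int T c d h\<bar> \<le> C * (d - c)" using ts_int_Lipschitz[OF T h] by blast
  \<comment> \<open>One uniform estimate serves both local hypotheses of \<open>ts_growth\<close>.
    Since \<open>u\<close> is Lipschitz with constant \<open>C\<close>, an oscillation of
    \<open>c\<close> by \<open>e / C\<close> costs at most \<open>e\<close> per unit length.\<close>
  have near: "\<exists>d>0. \<forall>r\<in>T. \<forall>s\<in>T. a \<le> r \<longrightarrow> r \<le> s \<longrightarrow> s \<le> x \<longrightarrow> s - r < d \<longrightarrow> V r - e * (s - r) \<le> V s"
    if e: "0 < e" for e
  proof -
    have "uniformly_continuous_on {u0..u x} c" using c by (intro compact_uniformly_continuous) auto
    then obtain d where d: "d > 0" "\<And>z z'. z \<in> {u0..u x} \<Longrightarrow> z' \<in> {u0..u x} \<Longrightarrow> \<bar>z' - z\<bar> < d \<Longrightarrow>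
        \<bar>c z' - c z\<bar> < e / C"
      using e C(1) unfolding uniformly_continuous_on_def dist_real_def by (metis divide_pos_pos)
    show ?thesis
    proof (intro exI[of _ "d / C"] conjI ballI impI)
      fix r s assume rs: "r \<in> T" "s \<in> T" "a \<le> r" "r \<le> s" "s \<le> x" "s - r < d / C"
      have small: "c (u q) \<le> c (u r) + e / C" if q: "q \<in> T" "r \<le> q" "q < s" for q
      proof -
        have "\<bar>u q - u r\<bar> \<le> C * (q - r)" using C(2)[of r q] u_diff[of r q] rs q by auto
        also have "\<dots> \<le> C * (s - r)" using q C(1) by simp
        also have "\<dots> < d" using rs C(1) by (simp add: field_simps)
        finally show ?thesis using d(2)[of "u r" "u q"] u_in rs q by force
      qed
      have "ts_int T r s (\<lambda>s. c (u s) * h s) \<le> ts_int T r s (\<lambda>s. (c (u r) + e / C) * h s)"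
        using rs small h0
        by (intro set_integral_mono ts_set_integrable T cuh_sub bdd_meas_mult bdd_meas_const sub mult_right_mono) auto
      also have "\<dots> = (c (u r) + e / C) * ts_int T r s h" by simp
      also have "\<dots> = c (u r) * ts_int T r s h + e / C * ts_int T r s h" by (simp add: algebra_simps)
      also have "e / C * ts_int T r s h \<le> e / C * (C * (s - r))"
        using C(2)[of r s] rs e C(1) by (intro mult_left_mono) auto
      also have "\<dots> = e * (s - r)" using C(1) by simp
      finally show "V r - e * (s - r) \<le> V s" using V_diff[of r s] rs by linarith
    qed (use d C in auto)
  qed
  have main: "V a - e * (x - a) \<le> V x" if e: "0 < e" for e
  proof (rule ts_growth[OF T ax])
    show "0 \<le> e" using e by simp
  next
    fix t assume t: "t \<in> T" "a \<le> t" "t < x" "t < forward_jump T t"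
    let ?\<sigma> = "forward_jump T t"
    have \<sigma>: "?\<sigma> \<in> T" "?\<sigma> \<le> x"
      using forward_jump_in[OF T t(1)] forward_jump_le[OF ax(2) t(3)] by auto
    have "ts_int T t ?\<sigma> h = h t * (?\<sigma> - t)"
      using t \<sigma> by (intro ts_int_scattered[OF T] sub)
    moreover have "ts_int T t ?\<sigma> (\<lambda>s. c (u s) * h s) = c (u t) * h t * (?\<sigma> - t)"
      using ts_int_scattered[OF T t(1), of "\<lambda>s. c (u s) * h s"] cuh_sub t \<sigma> by simp
    ultimately
    have "V t \<le> V ?\<sigma>" using V_diff[of t ?\<sigma>] t \<sigma> by (simp add: mult.assoc)
    then show "V t - e * (?\<sigma> - t) \<le> V ?\<sigma>" using e t by (smt (verit) mult_nonneg_nonneg)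
  next
    fix t assume t: "t \<in> T" "a \<le> t" "t < x" "forward_jump T t = t"
    from near[OF e] t show "\<exists>d>0. \<forall>s\<in>T. t < s \<longrightarrow> s < t + d \<longrightarrow> s \<le> x \<longrightarrow> V t - e * (s - t) \<le> V s"
      by (metis add.commute diff_less_eq less_imp_le)
  next
    fix t \<eta> :: real
    assume t: "t \<in> T" "a < t" "t \<le> x" and \<eta>: "0 < \<eta>"
    \<comment> \<open>For the left limit any fixed slack will do: with slack 1 the loss is
      \<open>t - s\<close>, which is below \<open>\<eta>\<close> once \<open>s\<close> is near
      \<open>t\<close>.\<close>
    from near[OF zero_less_one] obtain d where d: "d > 0"
      "\<And>r s. r \<in> T \<Longrightarrow> s \<in> T \<Longrightarrow> a \<le> r \<Longrightarrow> r \<le> s \<Longrightarrow> s \<le> x \<Longrightarrow> s - r < d \<Longrightarrow> V r - 1 * (s - r) \<le> V s"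
      by blast
    show "\<exists>d>0. \<forall>s\<in>T. a \<le> s \<longrightarrow> t - d < s \<longrightarrow> s < t \<longrightarrow> V s - \<eta> \<le> V t"
    proof (intro exI[of _ "min d \<eta>"] conjI ballI impI)
      fix s assume s: "s \<in> T" "a \<le> s" "t - min d \<eta> < s" "s < t"
      then have "t - s < d" "t - s < \<eta>" by auto
      then show "V s - \<eta> \<le> V t" using d(2)[of s t] t s by auto
    qed (use d \<eta> in auto)
  qed
  have "V a \<le> V x"
  proof (rule field_le_epsilon)
    fix e :: real assume e: "0 < e"
    have "e / (x - a + 1) * (x - a) \<le> e" using e ax by (simp add: field_simps)
    then show "V a \<le> V x + e" using main[of "e / (x - a + 1)"] e ax by simp
  qed
  then show "ts_int T a x (\<lambda>s. c (u s) * h s) \<le> \<psi> (u x) - \<psi> u0"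
    by (simp add: V_def ua set_lebesgue_integral_def)
qed

section \<open>Iterated integrals over boxes\<close>

locale delta_box =
  fixes n :: nat and T :: "nat \<Rightarrow> real set" and a b :: "nat \<Rightarrow> real"
  assumes T: "\<And>j. j < n \<Longrightarrow> time_scale (T j)"
    and aT: "\<And>j. j < n \<Longrightarrow> a j \<in> T j" and bT: "\<And>j. j < n \<Longrightarrow> b j \<in> T j"
    and ab: "\<And>j. j < n \<Longrightarrow> a j < b j"
begin

text \<open>The part of a box that a delta integral sees. Excluding the top faces keeps every point
  inside the domain of the mixed derivative; \<open>J\<close> varies because iterated integration
  fixes coordinates one by one.\<close>

definition ubox :: "(nat \<Rightarrow> real) \<Rightarrow> nat set \<Rightarrow> (nat \<Rightarrow> real) set" where
  "ubox x J = PiE J (\<lambda>j. T j \<inter> {a j..<x j})"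

abbreviation BM :: "nat set \<Rightarrow> (nat \<Rightarrow> real) measure" where
  "BM J \<equiv> restrict_space (PiM J (\<lambda>_. borel)) (ubox b J)"

text \<open>The counterpart of \<open>bdd_meas\<close> in several variables, chosen to be stable
  under integrating out a coordinate.\<close>

definition nice :: "nat set \<Rightarrow> ((nat \<Rightarrow> real) \<Rightarrow> real) \<Rightarrow> bool" where
  "nice J f \<longleftrightarrow> f \<in> borel_measurable (BM J) \<and> (\<exists>C. \<forall>t\<in>ubox b J. \<bar>f t\<bar> \<le> C)"

definition upper :: "(nat \<Rightarrow> real) \<Rightarrow> bool" where
  "upper x \<longleftrightarrow> (\<forall>j<n. x j \<in> T j \<and> a j \<le> x j \<and> x j \<le> b j)"

lemma upper_b: "upper b"
  using ab bT by (auto simp: upper_def less_imp_le)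

lemma upperD: "upper x \<Longrightarrow> j < n \<Longrightarrow> x j \<in> T j" "upper x \<Longrightarrow> j < n \<Longrightarrow> a j \<le> x j"
    "upper x \<Longrightarrow> j < n \<Longrightarrow> x j \<le> b j"
  by (auto simp: upper_def)

lemma side_borel [measurable]: "j < n \<Longrightarrow> T j \<inter> {a j..<x j} \<in> sets borel"
  using time_scale_borel[OF T] by auto

lemma ubox_subset: "upper x \<Longrightarrow> J \<subseteq> {..<n} \<Longrightarrow> ubox x J \<subseteq> ubox b J"
  unfolding ubox_def by (intro PiE_mono) (force dest: upperD(3))

lemma ubox_upd: "t \<in> ubox x J \<Longrightarrow> s \<in> T j \<inter> {a j..<x j} \<Longrightarrow> t(j := s) \<in> ubox x (insert j J)"
  unfolding ubox_def by (intro PiE_fun_upd)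

lemma space_BM [simp]: "space (BM J) = ubox b J"
  by (auto simp: space_restrict_space space_PiM ubox_def PiE_def)

lemma measurable_section:
  assumes "t \<in> ubox b J"
  shows "(\<lambda>s. t(j := s)) \<in> measurable (restrict_space borel (T j \<inter> {a j..<b j})) (BM (insert j J))"
proof (rule measurable_restrict_space2)
  show "(\<lambda>s. t(j := s)) \<in> space (restrict_space borel (T j \<inter> {a j..<b j})) \<rightarrow> ubox b (insert j J)"
    using ubox_upd[OF assms] by (auto simp: space_restrict_space)
  have t: "t \<in> space (PiM J (\<lambda>_. borel))" using assms by (auto simp: ubox_def space_PiM PiE_def)
  show "(\<lambda>s. t(j := s)) \<in> measurable (restrict_space borel (T j \<inter> {a j..<b j})) (PiM (insert j J) (\<lambda>_. borel))"
    using t by (intro measurable_fun_upd[where J=J] measurable_const measurable_restrict_space1) auto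
qed

lemma measurable_extend:
  "(\<lambda>p. (fst p)(j := snd p)) \<in>
    measurable (BM J \<Otimes>\<^sub>M restrict_space borel (T j \<inter> {a j..<b j})) (BM (insert j J))"
proof (rule measurable_restrict_space2)
  show "(\<lambda>p. (fst p)(j := snd p)) \<in> space (BM J \<Otimes>\<^sub>M restrict_space borel (T j \<inter> {a j..<b j})) \<rightarrow> ubox b (insert j J)"
    by (auto simp: space_restrict_space space_pair_measure space_PiM intro!: ubox_upd)
  have "fst \<in> measurable (BM J \<Otimes>\<^sub>M restrict_space borel (T j \<inter> {a j..<b j})) (PiM J (\<lambda>_. borel))"
    by (rule measurable_compose[OF measurable_fst measurable_restrict_space1]) simp
  moreover have "snd \<in> measurable (BM J \<Otimes>\<^sub>M restrict_space borel (T j \<inter> {a j..<b j})) borel"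
    by (rule measurable_compose[OF measurable_snd measurable_restrict_space1]) simp
  ultimately show "(\<lambda>p. (fst p)(j := snd p)) \<in>
      measurable (BM J \<Otimes>\<^sub>M restrict_space borel (T j \<inter> {a j..<b j})) (PiM (insert j J) (\<lambda>_. borel))"
    by (intro measurable_fun_upd[where J=J]) auto
qed

lemma nice_cong:
  assumes "nice J f" "\<And>t. t \<in> ubox b J \<Longrightarrow> f t = g t"
  shows "nice J g"
proof -
  have "f \<in> borel_measurable (BM J) \<longleftrightarrow> g \<in> borel_measurable (BM J)"
    using assms(2) by (intro measurable_cong) simp
  then show ?thesis using assms by (auto simp: nice_def)
qed

lemma nice_section:
  assumes "nice (insert j J) f" "t \<in> ubox b J"
  shows "bdd_meas (T j \<inter> {a j..<b j}) (\<lambda>s. f (t(j := s)))"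
proof -
  have "(\<lambda>s. f (t(j := s))) \<in> borel_measurable (restrict_space borel (T j \<inter> {a j..<b j}))"
    using assms measurable_compose[OF measurable_section[OF assms(2)]] by (auto simp: nice_def)
  then show ?thesis
    using assms ubox_upd[OF assms(2)] unfolding nice_def bdd_meas_def by blast
qed

lemma nice_section_upper:
  assumes "nice (insert j J) f" "t \<in> ubox b J" "upper x" "j < n"
  shows "bdd_meas (T j \<inter> {a j..<x j}) (\<lambda>s. f (t(j := s)))"
  by (rule bdd_meas_subset[OF nice_section[OF assms(1,2)]]) (use upperD(3)[OF assms(3,4)] in auto)

text \<open>Measurability of a parameter integral calls for a sigma-finite measure on a fixed space.
  The delta measure is finite on \<open>{a j..<b j}\<close>; the shorter range up to
  \<open>x j\<close> enters as an indicator.\<close>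

lemma nice_integral:
  assumes f: "nice (insert j J) f" and x: "upper x" and j: "j < n"
  shows "nice J (\<lambda>t. ts_int (T j) (a j) (x j) (\<lambda>s. f (t(j := s))))"
proof -
  let ?S = "T j \<inter> {a j..<b j}" and ?A = "T j \<inter> {a j..<x j}"
  define N where "N = restrict_space (ts_measure (T j)) ?S"
  have [measurable]: "?S \<in> sets borel" "?A \<in> sets borel" using j by auto
  have sets_N: "sets N = sets (restrict_space borel ?S)" unfolding N_def by (simp add: sets_restrict_space)
  have "emeasure N (space N) = emeasure (ts_measure (T j)) ?S"
    unfolding N_def by (simp add: emeasure_restrict_space space_restrict_space)
  also have "\<dots> = ennreal (b j - a j)"
    using j ab[OF j] by (intro emeasure_ts_measure_Ico T aT bT) auto
  finally interpret N: finite_measure N by (intro finite_measureI) simp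
  have eq: "ts_int (T j) (a j) (x j) g = (\<integral>s. indicator ?A s *\<^sub>R g s \<partial>N)" for g :: "real \<Rightarrow> real"
  proof -
    have "?A \<subseteq> ?S" using upperD(3)[OF x j] by auto
    then have "indicator ?S s *\<^sub>R indicator ?A s *\<^sub>R g s = indicator ?A s *\<^sub>R g s" for s
      by (auto simp: indicator_def)
    then show ?thesis unfolding N_def
      by (subst integral_restrict_space) (simp_all only: set_lebesgue_integral_def, auto)
  qed
  have meas_f: "f \<in> borel_measurable (BM (insert j J))" using f by (simp add: nice_def)
  have 1: "(\<lambda>p. f ((fst p)(j := snd p))) \<in> borel_measurable (BM J \<Otimes>\<^sub>M restrict_space borel ?S)"
    by (rule measurable_compose[OF measurable_extend meas_f])
  have "snd \<in> measurable (BM J \<Otimes>\<^sub>M restrict_space borel ?S) borel"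
    by (rule measurable_compose[OF measurable_snd measurable_restrict_space1]) simp
  then have "(\<lambda>p. indicator ?A (snd p) :: real) \<in> borel_measurable (BM J \<Otimes>\<^sub>M restrict_space borel ?S)"
    by (rule measurable_compose) auto
  then have "(\<lambda>p. indicator ?A (snd p) *\<^sub>R f ((fst p)(j := snd p))) \<in> borel_measurable (BM J \<Otimes>\<^sub>M restrict_space borel ?S)"
    using 1 by (intro borel_measurable_scaleR)
  also have "borel_measurable (BM J \<Otimes>\<^sub>M restrict_space borel ?S) = borel_measurable (BM J \<Otimes>\<^sub>M N)"
    by (intro measurable_cong_sets sets_pair_measure_cong) (simp_all add: sets_N)
  finally have "(\<lambda>t. \<integral>s. indicator ?A s *\<^sub>R f (t(j := s)) \<partial>N) \<in> borel_measurable (BM J)"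
    by (intro N.borel_measurable_lebesgue_integral) (simp only: case_prod_unfold)
  moreover obtain C where C: "\<And>t. t \<in> ubox b (insert j J) \<Longrightarrow> \<bar>f t\<bar> \<le> C"
    using f unfolding nice_def by blast
  have "\<bar>ts_int (T j) (a j) (x j) (\<lambda>s. f (t(j := s)))\<bar> \<le> C * (x j - a j)" if t: "t \<in> ubox b J" for t
  proof -
    have b: "\<bar>f (t(j := s))\<bar> \<le> C" if "s \<in> T j" "a j \<le> s" "s < x j" for s
      using ubox_upd[OF t, of s j] C that upperD(3)[OF x j] by auto
    have "ts_int (T j) (a j) (x j) (\<lambda>s. f (t(j := s))) \<le> C * (x j - a j)"
      using b by (intro ts_int_upper T aT upperD[OF x] j nice_section_upper[OF f t x]) (auto simp: abs_le_iff)
    moreover have "(- C) * (x j - a j) \<le> ts_int (T j) (a j) (x j) (\<lambda>s. f (t(j := s)))"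
      using b by (intro ts_int_lower T aT upperD[OF x] j nice_section_upper[OF f t x]) (force simp: abs_le_iff)
    ultimately show ?thesis by (simp add: abs_le_iff)
  qed
  ultimately show ?thesis unfolding nice_def eq[symmetric] by blast
qed

section \<open>Algebra of bounded measurable functions on boxes\<close>

lemma nice_const: "nice J (\<lambda>_. k)"
  by (auto simp: nice_def)

lemma nice_mult:
  assumes "nice J f" "nice J g"
  shows "nice J (\<lambda>s. f s * g s)"
proof -
  obtain C D where C: "\<And>s. s \<in> ubox b J \<Longrightarrow> \<bar>f s\<bar> \<le> C" and D: "\<And>s. s \<in> ubox b J \<Longrightarrow> \<bar>g s\<bar> \<le> D"
    using assms unfolding nice_def by metis
  have "\<bar>f s * g s\<bar> \<le> C * D" if "s \<in> ubox b J" for s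
    unfolding abs_mult using C[OF that] D[OF that] by (intro mult_mono) auto
  moreover have "(\<lambda>s. f s * g s) \<in> borel_measurable (BM J)"
    using assms unfolding nice_def by (intro borel_measurable_times) auto
  ultimately show ?thesis unfolding nice_def by blast
qed

lemma nice_add:
  assumes "nice J f" "nice J g"
  shows "nice J (\<lambda>s. f s + g s)"
proof -
  obtain C D where C: "\<And>s. s \<in> ubox b J \<Longrightarrow> \<bar>f s\<bar> \<le> C" and D: "\<And>s. s \<in> ubox b J \<Longrightarrow> \<bar>g s\<bar> \<le> D"
    using assms unfolding nice_def by metis
  have "\<bar>f s + g s\<bar> \<le> C + D" if "s \<in> ubox b J" for s
    using C[OF that] D[OF that] by linarith
  moreover have "(\<lambda>s. f s + g s) \<in> borel_measurable (BM J)"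
    using assms unfolding nice_def by (intro borel_measurable_add) auto
  ultimately show ?thesis unfolding nice_def by blast
qed

lemma nice_abs: "nice J f \<Longrightarrow> nice J (\<lambda>s. \<bar>f s\<bar>)"
  unfolding nice_def by (auto intro: borel_measurable_abs)

lemma nice_powr:
  assumes f: "nice J f" and pos: "\<And>t. t \<in> ubox b J \<Longrightarrow> 0 \<le> f t" and q: "0 \<le> q"
  shows "nice J (\<lambda>s. f s powr q)"
proof -
  obtain C where C: "\<And>s. s \<in> ubox b J \<Longrightarrow> \<bar>f s\<bar> \<le> C" using f unfolding nice_def by blast
  have "\<bar>f s powr q\<bar> \<le> C powr q" if "s \<in> ubox b J" for s
    using C[OF that] pos[OF that] q by (simp add: powr_mono2)
  moreover have "(\<lambda>s. f s powr q) \<in> borel_measurable (BM J)"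
    using f unfolding nice_def by (intro powr_real_measurable) auto
  ultimately show ?thesis unfolding nice_def by blast
qed

lemma nice_coord:
  assumes q: "bdd_meas (T j \<inter> {a j..<b j}) q" and j: "j \<in> J"
  shows "nice J (\<lambda>t. q (t j))"
proof -
  have "(\<lambda>t. t j) \<in> measurable (BM J) (restrict_space borel (T j \<inter> {a j..<b j}))"
  proof (rule measurable_restrict_space2)
    show "(\<lambda>t. t j) \<in> space (BM J) \<rightarrow> T j \<inter> {a j..<b j}"
      unfolding space_BM using j by (auto simp: ubox_def PiE_iff)
    show "(\<lambda>t. t j) \<in> borel_measurable (BM J)"
      using j by (intro measurable_restrict_space1 measurable_component_singleton)
  qed
  then have "(\<lambda>t. q (t j)) \<in> borel_measurable (BM J)"
    using q unfolding bdd_meas_def by (auto intro: measurable_compose)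
  moreover have "t j \<in> T j \<inter> {a j..<b j}" if "t \<in> ubox b J" for t
    using that j unfolding ubox_def by (rule PiE_mem)
  ultimately show ?thesis using q unfolding nice_def bdd_meas_def by blast
qed

section \<open>Iterated integrals: existence, monotonicity, linearity and Hoelder's
  inequality\<close>

lemma iter_Cons:
  assumes "nice (insert j J) (iter_integral T a x js f)" "upper x" "j < n" "t \<in> ubox b J"
  shows "iter_integral T a x (j # js) f t = ts_int (T j) (a j) (x j) (\<lambda>s. iter_integral T a x js f (t(j := s)))"
    and "delta_integrable (T j) (a j) (x j) (\<lambda>s. iter_integral T a x js f (t(j := s)))"
  using delta_integrable_ts_int[OF T[OF assms(3)] aT[OF assms(3)] upperD(1)[OF assms(2,3)]
      nice_section_upper[OF assms(1,4,2,3)]] by auto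

text \<open>\<open>J\<close> holds the coordinates fixed by outer integrals; each recursion step
  moves the head of the list into it.\<close>

lemma iter_nice:
  assumes "upper x" "distinct js" "set js \<subseteq> {..<n}" "J \<inter> set js = {}" "nice (J \<union> set js) f"
  shows "nice J (iter_integral T a x js f)"
  using assms
proof (induction js arbitrary: J)
  case Nil
  then show ?case by (simp add: nice_def)
next
  case (Cons j js)
  have j: "j < n" using Cons.prems by auto
  have IH: "nice (insert j J) (iter_integral T a x js f)"
    using Cons.prems by (intro Cons.IH) auto
  show ?case
    by (rule nice_cong[OF nice_integral[OF IH Cons.prems(1) j]])
      (rule iter_Cons(1)[OF IH Cons.prems(1) j, symmetric])
qed

lemma iter_Cons':
  assumes "upper x" "distinct (j # js)" "set (j # js) \<subseteq> {..<n}" "J \<inter> set (j # js) = {}"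
    "nice (J \<union> set (j # js)) f" "t \<in> ubox b J"
  shows "iter_integral T a x (j # js) f t = ts_int (T j) (a j) (x j) (\<lambda>s. iter_integral T a x js f (t(j := s)))"
    and "bdd_meas (T j \<inter> {a j..<b j}) (\<lambda>s. iter_integral T a x js f (t(j := s)))"
    and "delta_integrable (T j) (a j) (x j) (\<lambda>s. iter_integral T a x js f (t(j := s)))"
proof -
  have j: "j < n" using assms by auto
  have IH: "nice (insert j J) (iter_integral T a x js f)"
    using assms by (intro iter_nice) auto
  show "iter_integral T a x (j # js) f t = ts_int (T j) (a j) (x j) (\<lambda>s. iter_integral T a x js f (t(j := s)))"
    "delta_integrable (T j) (a j) (x j) (\<lambda>s. iter_integral T a x js f (t(j := s)))"
    using iter_Cons[OF IH assms(1) j assms(6)] by auto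
  show "bdd_meas (T j \<inter> {a j..<b j}) (\<lambda>s. iter_integral T a x js f (t(j := s)))"
    using IH assms(6) by (rule nice_section)
qed

lemma iter_integrable_nice:
  assumes "upper x" "distinct js" "set js \<subseteq> {..<n}" "J \<inter> set js = {}" "nice (J \<union> set js) f" "t \<in> ubox b J"
  shows "iter_integrable T a x js f t"
  using assms
proof (induction js arbitrary: J t)
  case (Cons j js)
  have j: "j < n" using Cons.prems by auto
  have "iter_integrable T a x js f (t(j := s))" if s: "s \<in> T j \<inter> {a j..<x j}" for s
  proof (rule Cons.IH[where J="insert j J"])
    show "t(j := s) \<in> ubox b (insert j J)"
      using s Cons.prems upperD(3)[OF Cons.prems(1) j] by (intro ubox_upd) auto
  qed (use Cons.prems in auto)
  then show ?case using iter_Cons'(3)[OF Cons.prems] by simp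
qed simp

text \<open>True for all integrands, since the integral of a non-integrable function is 0 by default
  and scaling respects this.\<close>

lemma iter_cmult: "iter_integral T a x js (\<lambda>t. k * f t) t = k * iter_integral T a x js f t"
  by (induction js arbitrary: t) (simp_all add: delta_integral_def)

lemma iter_integrable_cmult:
  "iter_integrable T a x js f t \<Longrightarrow> iter_integrable T a x js (\<lambda>t. k * f t) t"
  by (induction js arbitrary: t) (auto simp: delta_integrable_def iter_cmult elim!: eventually_mono)

lemma iter_pull:
  "j \<notin> set js \<Longrightarrow> iter_integral T a x js (\<lambda>t. q (t j) * f t) t = q (t j) * iter_integral T a x js f t"
  by (induction js arbitrary: t) (simp_all add: delta_integral_def)

text \<open>Stated for integrable rather than \<open>nice\<close> functions because the bracket of
  the conclusion is only known to be integrable. Inner integrability then holds almost everywhere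
  only, and so does the comparison of inner integrals.\<close>

lemma iter_mono:
  assumes "iter_integrable T a x js f t" "iter_integrable T a x js g t"
    and "\<And>s. s \<in> ubox x (J \<union> set js) \<Longrightarrow> f s \<le> g s" and "t \<in> ubox x J"
  shows "iter_integral T a x js f t \<le> iter_integral T a x js g t"
  using assms
proof (induction js arbitrary: J t)
  case (Cons j js)
  let ?A = "T j \<inter> {a j..<x j}"
  have "AE s in delta_measure (T j). indicator ?A s *\<^sub>R iter_integral T a x js f (t(j := s))
      \<le> indicator ?A s *\<^sub>R iter_integral T a x js g (t(j := s))"
  proof -
    have "AE s in delta_measure (T j). s \<in> ?A \<longrightarrow> iter_integrable T a x js f (t(j := s))"
      "AE s in delta_measure (T j). s \<in> ?A \<longrightarrow> iter_integrable T a x js g (t(j := s))"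
      using Cons.prems by auto
    then show ?thesis
    proof eventually_elim
      case (elim s)
      show ?case
      proof (cases "s \<in> ?A")
        case True
        have "iter_integral T a x js f (t(j := s)) \<le> iter_integral T a x js g (t(j := s))"
        proof (rule Cons.IH[where J="insert j J"])
          show "t(j := s) \<in> ubox x (insert j J)" using Cons.prems(4) True by (rule ubox_upd)
          show "iter_integrable T a x js f (t(j := s))" "iter_integrable T a x js g (t(j := s))"
            using elim True by blast+
          show "f r \<le> g r" if "r \<in> ubox x (insert j J \<union> set js)" for r
            using Cons.prems(3)[of r] that by simp
        qed
        then show ?thesis by (simp add: indicator_def)
      qed simp
    qed
  qed
  then show ?case using Cons.prems
    by (auto simp: delta_integral_def delta_integrable_def set_integrable_def set_lebesgue_integral_def
        intro!: integral_mono_AE)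
qed (simp)

lemma iter_cong:
  assumes "\<And>s. s \<in> ubox x (J \<union> set js) \<Longrightarrow> f s = g s" and "t \<in> ubox x J"
  shows "iter_integral T a x js f t = iter_integral T a x js g t"
  using assms
proof (induction js arbitrary: J t)
  case (Cons j js)
  have "iter_integral T a x js f (t(j := s)) = iter_integral T a x js g (t(j := s))"
    if "s \<in> T j \<inter> {a j..<x j}" for s
  proof (rule Cons.IH[where J="insert j J"])
    show "t(j := s) \<in> ubox x (insert j J)" using Cons.prems(2) that by (rule ubox_upd)
  qed (use Cons.prems in auto)
  then have "indicator (T j \<inter> {a j..<x j}) s *\<^sub>R iter_integral T a x js f (t(j := s))
      = indicator (T j \<inter> {a j..<x j}) s *\<^sub>R iter_integral T a x js g (t(j := s))" for s
    by (auto simp: indicator_def)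
  then show ?case by (simp only: iter_integral.simps delta_integral_def set_lebesgue_integral_def)
qed simp

text \<open>Monotonicity for \<open>f\<close> and for \<open>(-1) * f\<close>; integrability
  suffices, as needed for the integrand containing \<open>\<Phi>\<close>.\<close>

lemma iter_abs_le:
  assumes f: "iter_integrable T a x js f t" and g: "iter_integrable T a x js g t"
    and le: "\<And>s. s \<in> ubox x (J \<union> set js) \<Longrightarrow> \<bar>f s\<bar> \<le> g s" and t: "t \<in> ubox x J"
  shows "\<bar>iter_integral T a x js f t\<bar> \<le> iter_integral T a x js g t"
proof -
  have "iter_integral T a x js f t \<le> iter_integral T a x js g t"
    using le by (intro iter_mono[OF f g _ t]) (auto simp: abs_le_iff)
  moreover have "iter_integral T a x js (\<lambda>t. (-1) * f t) t \<le> iter_integral T a x js g t"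
    using le by (intro iter_mono[OF iter_integrable_cmult[OF f] g _ t]) (auto simp: abs_le_iff)
  ultimately show ?thesis unfolding iter_cmult by (simp add: abs_le_iff)
qed

lemma iter_add:
  assumes "upper x" "distinct js" "set js \<subseteq> {..<n}" "J \<inter> set js = {}"
    "nice (J \<union> set js) f" "nice (J \<union> set js) g" "t \<in> ubox b J"
  shows "iter_integral T a x js (\<lambda>t. f t + g t) t = iter_integral T a x js f t + iter_integral T a x js g t"
  using assms
proof (induction js arbitrary: J t)
  case (Cons j js)
  have j: "j < n" using Cons.prems by auto
  let ?A = "T j \<inter> {a j..<x j}"
  have eq: "iter_integral T a x js (\<lambda>t. f t + g t) (t(j := s))
      = iter_integral T a x js f (t(j := s)) + iter_integral T a x js g (t(j := s))" if s: "s \<in> ?A" for s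
  proof (rule Cons.IH[where J="insert j J"])
    show "t(j := s) \<in> ubox b (insert j J)"
      using s Cons.prems upperD(3)[OF Cons.prems(1) j] by (intro ubox_upd) auto
  qed (use Cons.prems in auto)
  have "iter_integral T a x (j # js) (\<lambda>t. f t + g t) t
    = delta_integral (T j) (a j) (x j) (\<lambda>s. iter_integral T a x js f (t(j := s)) + iter_integral T a x js g (t(j := s)))"
    unfolding iter_integral.simps delta_integral_def set_lebesgue_integral_def
    using eq by (intro Bochner_Integration.integral_cong) (auto simp: indicator_def)
  also have "\<dots> = iter_integral T a x (j # js) f t + iter_integral T a x (j # js) g t"
    using iter_Cons'(3)[OF Cons.prems(1-5,7)] iter_Cons'(3)[OF Cons.prems(1-4,6,7)]
    by (simp add: delta_integral_def delta_integrable_def set_integral_add)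
  finally show ?case .
qed simp

lemma iter_one:
  assumes "upper x" "distinct js" "set js \<subseteq> {..<n}"
  shows "iter_integral T a x js (\<lambda>_. k) t = k * (\<Prod>j\<in>set js. x j - a j)"
  using assms
proof (induction js arbitrary: t)
  case (Cons j js)
  have j: "j < n" using Cons.prems by auto
  have "iter_integral T a x (j # js) (\<lambda>_. k) t
      = delta_integral (T j) (a j) (x j) (\<lambda>_. k * (\<Prod>j\<in>set js. x j - a j))"
    using Cons by simp
  also have "\<dots> = (k * (\<Prod>j\<in>set js. x j - a j)) * (x j - a j)"
    using j Cons.prems
    by (simp add: delta_integrable_ts_int(2) T aT upperD bdd_meas_const ts_int_const)
  finally show ?case using Cons.prems by simp
qed simp

text \<open>Both claims go through one induction: nonnegativity of the inner integral makes the
  additional stretch from \<open>x j\<close> to \<open>x' j\<close> contribute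
  nonnegatively.\<close>

lemma iter_upper_mono:
  assumes "upper x" "upper x'" "distinct js" "set js \<subseteq> {..<n}" "J \<inter> set js = {}"
    "nice (J \<union> set js) f" "\<And>j. j \<in> set js \<Longrightarrow> x j \<le> x' j" "\<And>s. s \<in> ubox b (J \<union> set js) \<Longrightarrow> 0 \<le> f s"
    "t \<in> ubox b J"
  shows "0 \<le> iter_integral T a x js f t \<and> iter_integral T a x js f t \<le> iter_integral T a x' js f t"
  using assms
proof (induction js arbitrary: J t)
  case (Cons j js)
  have j: "j < n" using Cons.prems by auto
  note x = upperD[OF Cons.prems(1) j] and x' = upperD[OF Cons.prems(2) j]
  have xx': "x j \<le> x' j" using Cons.prems by simp
  note F = iter_Cons'[OF Cons.prems(1,3,4,5,6,9)] and F' = iter_Cons'[OF Cons.prems(2,3,4,5,6,9)]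
  let ?F = "\<lambda>s. iter_integral T a x js f (t(j := s))" and ?F' = "\<lambda>s. iter_integral T a x' js f (t(j := s))"
  have IH: "0 \<le> ?F s \<and> ?F s \<le> ?F' s" if s: "s \<in> T j \<inter> {a j..<b j}" for s
  proof (rule Cons.IH[where J="insert j J"])
    show "t(j := s) \<in> ubox b (insert j J)" using s Cons.prems by (intro ubox_upd) auto
  qed (use Cons.prems in auto)
  have sub: "bdd_meas (T j \<inter> {c..<d}) ?F" "bdd_meas (T j \<inter> {c..<d}) ?F'" if "a j \<le> c" "d \<le> b j" for c d
    using that by (auto intro!: bdd_meas_subset[OF F(2)] bdd_meas_subset[OF F'(2)])
  have "0 * (x j - a j) \<le> ts_int (T j) (a j) (x j) ?F"
    using x j IH by (intro ts_int_lower T aT sub) auto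
  moreover have "ts_int (T j) (a j) (x j) ?F \<le> ts_int (T j) (a j) (x j) ?F'"
    using x j IH by (intro set_integral_mono ts_set_integrable T aT sub) auto
  moreover have "0 * (x' j - x j) \<le> ts_int (T j) (x j) (x' j) ?F'"
    using x x' xx' j IH by (intro ts_int_lower T aT sub) force+
  moreover have "ts_int (T j) (a j) (x' j) ?F' = ts_int (T j) (a j) (x j) ?F' + ts_int (T j) (x j) (x' j) ?F'"
    using x x' xx' j by (intro ts_int_split T aT sub) auto
  ultimately show ?case unfolding F(1) F'(1) by simp
qed (simp add: ubox_def)

text \<open>Young's inequality is integrated after normalising both factors. Adding
  \<open>\<eta>\<close> keeps the normalising constants positive when an integral vanishes; at the
  end \<open>\<eta>\<close> tends to 0.\<close>

lemma iter_Holder: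
  assumes x: "upper x" and js: "distinct js" "set js \<subseteq> {..<n}" "J \<inter> set js = {}" and J: "J \<subseteq> {..<n}"
    and f: "nice (J \<union> set js) f" "\<And>s. s \<in> ubox b (J \<union> set js) \<Longrightarrow> 0 \<le> f s"
    and g: "nice (J \<union> set js) g" "\<And>s. s \<in> ubox b (J \<union> set js) \<Longrightarrow> 0 \<le> g s"
    and PQ: "1 < P" "1 < Q" "1 / P + 1 / Q = 1" and t: "t \<in> ubox x J"
  shows "iter_integral T a x js (\<lambda>t. f t * g t) t \<le>
    iter_integral T a x js (\<lambda>t. f t powr P) t powr (1 / P) * iter_integral T a x js (\<lambda>t. g t powr Q) t powr (1 / Q)"
proof -
  let ?L = "\<lambda>h. iter_integral T a x js h t"
  have tb: "t \<in> ubox b J" using t ubox_subset[OF x J] by auto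
  have xb: "ubox x (J \<union> set js) \<subseteq> ubox b (J \<union> set js)" using J js by (intro ubox_subset[OF x]) auto
  define F G where "F = ?L (\<lambda>t. f t powr P)" and "G = ?L (\<lambda>t. g t powr Q)"
  have nf: "nice (J \<union> set js) (\<lambda>t. f t powr P)" using f PQ by (intro nice_powr) auto
  have ng: "nice (J \<union> set js) (\<lambda>t. g t powr Q)" using g PQ by (intro nice_powr) auto
  have F0: "0 \<le> F" and G0: "0 \<le> G"
    unfolding F_def G_def using iter_upper_mono[OF x x js nf _ _ tb] iter_upper_mono[OF x x js ng _ _ tb] by auto
  have bound: "?L (\<lambda>t. f t * g t) \<le> (F + \<eta>) powr (1 / P) * (G + \<eta>) powr (1 / Q)" if \<eta>: "\<eta> > 0" for \<eta>
  proof -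
    define c d where "c = (F + \<eta>) powr (1 / P)" and "d = (G + \<eta>) powr (1 / Q)"
    have cd: "c > 0" "d > 0" using F0 G0 \<eta> by (auto simp: c_def d_def)
    have cP: "c powr P = F + \<eta>" and dQ: "d powr Q = G + \<eta>"
      using PQ F0 G0 \<eta> by (auto simp: c_def d_def powr_powr)
    let ?h = "\<lambda>t. (c * d / ((F + \<eta>) * P)) * f t powr P + (c * d / ((G + \<eta>) * Q)) * g t powr Q"
    have pw: "f s * g s \<le> ?h s" if "s \<in> ubox x (J \<union> set js)" for s
    proof -
      have fs: "0 \<le> f s" "0 \<le> g s" using that xb f g by auto
      have "(f s / c) * (g s / d) \<le> (f s / c) powr P / P + (g s / d) powr Q / Q"
        using PQ fs cd by (intro Youngs_inequality) auto
      also have "\<dots> = f s powr P / ((F + \<eta>) * P) + g s powr Q / ((G + \<eta>) * Q)"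
        using fs cd by (simp add: powr_divide cP dQ)
      finally have "(c * d) * ((f s / c) * (g s / d)) \<le> (c * d) * (f s powr P / ((F + \<eta>) * P) + g s powr Q / ((G + \<eta>) * Q))"
        using cd by (intro mult_left_mono) auto
      then show ?thesis using cd by (simp add: distrib_left)
    qed
    have n1: "nice (J \<union> set js) (\<lambda>t. (c * d / ((F + \<eta>) * P)) * f t powr P)"
      and n2: "nice (J \<union> set js) (\<lambda>t. (c * d / ((G + \<eta>) * Q)) * g t powr Q)"
      by (intro nice_mult nice_const nf ng)+
    have "?L (\<lambda>t. f t * g t) \<le> ?L ?h"
      using pw t by (intro iter_mono[where J=J] iter_integrable_nice[OF x js _ tb] nice_mult nice_add n1 n2 f(1) g(1))
        auto
    also have "\<dots> = (c * d / ((F + \<eta>) * P)) * F + (c * d / ((G + \<eta>) * Q)) * G"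
      unfolding iter_add[OF x js n1 n2 tb] iter_cmult by (simp only: F_def G_def)
    also have "\<dots> = c * d * ((F / (F + \<eta>)) / P + (G / (G + \<eta>)) / Q)" by (simp add: field_simps)
    also have "\<dots> \<le> c * d * (1 / P + 1 / Q)"
      using PQ F0 G0 \<eta> cd by (intro mult_left_mono add_mono divide_right_mono) auto
    finally show ?thesis using PQ by (simp add: c_def d_def)
  qed
  have "((\<lambda>\<eta>. (F + \<eta>) powr (1 / P) * (G + \<eta>) powr (1 / Q)) \<longlongrightarrow> (F + 0) powr (1 / P) * (G + 0) powr (1 / Q)) (at_right 0)"
    using PQ F0 G0
    by (intro tendsto_mult tendsto_powr' tendsto_add tendsto_const tendsto_ident_at)
      (auto simp: eventually_at intro!: exI[of _ 1])
  then have "?L (\<lambda>t. f t * g t) \<le> (F + 0) powr (1 / P) * (G + 0) powr (1 / Q)"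
    by (rule tendsto_lowerbound) (use bound in \<open>auto simp: eventually_at intro!: exI[of _ 1]\<close>)
  then show ?thesis by (simp add: F_def G_def)
qed

end

section \<open>Rd-continuous functions\<close>

text \<open>A basic open set constrains each coordinate separately, and the points of a box agree
  from index \<open>n\<close> on. So one common radius for the first \<open>n\<close> coordinates is
  enough.\<close>

lemma eventually_nhds_fun:
  fixes x :: "nat \<Rightarrow> real"
  assumes "eventually P (nhds x)"
  obtains e where "0 < e" "\<And>t. (\<And>j. j < n \<Longrightarrow> \<bar>t j - x j\<bar> < e) \<Longrightarrow> (\<And>j. n \<le> j \<Longrightarrow> t j = x j) \<Longrightarrow> P t"
proof -
  obtain U where U: "open U" "x \<in> U" "\<And>t. t \<in> U \<Longrightarrow> P t"
    using assms unfolding eventually_nhds by blast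
  obtain X where X: "x \<in> PiE UNIV X" "\<And>i. open (X i)" "PiE UNIV X \<subseteq> U"
    using product_topology_open_contains_basis[of "\<lambda>_. euclidean" UNIV U x] U(1,2)
    unfolding open_fun_def by auto
  have "\<exists>e>0. \<forall>y. \<bar>y - x i\<bar> < e \<longrightarrow> y \<in> X i" for i
    using X(1,2) open_dist[of "X i"] by (auto simp: PiE_iff dist_real_def)
  then obtain d where d: "\<And>i. 0 < d i" "\<And>i y. \<bar>y - x i\<bar> < d i \<Longrightarrow> y \<in> X i" by metis
  \<comment> \<open>Inserting 1 keeps the minimum defined for \<open>n = 0\<close>.\<close>
  define e where "e = Min (insert 1 (d ` {..<n}))"
  have e: "0 < e" "\<And>i. i < n \<Longrightarrow> e \<le> d i" using d(1) by (auto simp: e_def)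
  show ?thesis
  proof (rule that[OF e(1)])
    fix t assume t: "\<And>j. j < n \<Longrightarrow> \<bar>t j - x j\<bar> < e" "\<And>j. n \<le> j \<Longrightarrow> t j = x j"
    have "t i \<in> X i" for i
    proof (cases "i < n")
      case True
      then show ?thesis using t(1)[OF True] e(2)[OF True] by (intro d(2)) simp
    next
      case False
      then show ?thesis using t(2)[of i] X(1) by (auto simp: PiE_iff)
    qed
    then have "t \<in> PiE UNIV X" by (simp add: PiE_iff)
    then show "P t" using X(3) U(3) by (meson subsetD)
  qed
qed

text \<open>Being \<open>undefined\<close> outside \<open>{..<n}\<close> amounts to singleton
  factors in a full product, to which Tychonoff's theorem applies.\<close>

lemma compact_PiE_lessThan:
  fixes S :: "nat \<Rightarrow> real set"
  assumes "\<And>j. j < n \<Longrightarrow> compact (S j)"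
  shows "compact (PiE {..<n} S)"
proof -
  have eq: "PiE {..<n} S = PiE UNIV (\<lambda>j. if j < n then S j else {undefined})"
    by (rule set_eqI) (simp add: PiE_iff extensional_def split: if_split, blast)
  have "compactin (product_topology (\<lambda>_. euclidean) UNIV) (PiE UNIV (\<lambda>j. if j < n then S j else {undefined}))"
    using assms by (auto simp: compactin_PiE)
  then show ?thesis unfolding eq by (simp add: euclidean_product_topology)
qed

lemma rd_continuous_onD:
  assumes "rd_continuous_on n T X f" "x \<in> X"
  shows "J \<subseteq> {..<n} \<Longrightarrow>
      \<exists>l. (f \<longlongrightarrow> l) (inf (nhds x) (principal {t\<in>X. (\<forall>j\<in>J. t j < x j) \<and> (\<forall>j\<in>{..<n} - J. x j \<le> t j)}))"
    and "(f \<longlongrightarrow> f x) (inf (nhds x) (principal {t\<in>X. \<forall>j\<in>{..<n}. x j \<le> t j}))"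
proof -
  note * = assms(1)[unfolded rd_continuous_on_def Let_def, rule_format, OF assms(2)]
  show "J \<subseteq> {..<n} \<Longrightarrow>
      \<exists>l. (f \<longlongrightarrow> l) (inf (nhds x) (principal {t\<in>X. (\<forall>j\<in>J. t j < x j) \<and> (\<forall>j\<in>{..<n} - J. x j \<le> t j)}))"
    by (rule *[THEN conjunct1])
  have "(f \<longlongrightarrow> f x) (inf (nhds x) (principal {t\<in>X. (\<forall>j\<in>{}. t j < x j) \<and> (\<forall>j\<in>{..<n} - {}. x j \<le> t j)}))"
    by (rule *[of "{}", THEN conjunct2, THEN mp]) simp_all
  then show "(f \<longlongrightarrow> f x) (inf (nhds x) (principal {t\<in>X. \<forall>j\<in>{..<n}. x j \<le> t j}))" by simp
qed

text \<open>Around a point the set splits into finitely many orthants, one for each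
  \<open>J\<close>. A limit along each gives a local bound, and compactness a global one.\<close>

lemma rd_continuous_on_bounded:
  assumes S: "\<And>j. j < n \<Longrightarrow> compact (S j)" and f: "rd_continuous_on n T (PiE {..<n} S) f"
  shows "\<exists>C. \<forall>t\<in>PiE {..<n} S. \<bar>f t\<bar> \<le> C"
proof -
  let ?X = "PiE {..<n} S"
  have "\<exists>U C. open U \<and> x \<in> U \<and> (\<forall>t\<in>U \<inter> ?X. \<bar>f t\<bar> \<le> C)" if x: "x \<in> ?X" for x
  proof -
    define Or where "Or J = {t\<in>?X. (\<forall>j\<in>J. t j < x j) \<and> (\<forall>j\<in>{..<n} - J. x j \<le> t j)}" for J
    have "\<exists>C. \<forall>\<^sub>F t in nhds x. t \<in> Or J \<longrightarrow> \<bar>f t\<bar> \<le> C" if J: "J \<subseteq> {..<n}" for J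
    proof -
      obtain l where "(f \<longlongrightarrow> l) (inf (nhds x) (principal (Or J)))"
        using rd_continuous_onD(1)[OF f x J] unfolding Or_def by (elim exE)
      from tendstoD[OF this zero_less_one]
      have "\<forall>\<^sub>F t in nhds x. t \<in> Or J \<longrightarrow> dist (f t) l < 1" by (simp add: eventually_inf_principal)
      then have "\<forall>\<^sub>F t in nhds x. t \<in> Or J \<longrightarrow> \<bar>f t\<bar> \<le> \<bar>l\<bar> + 1"
        by eventually_elim (auto simp: dist_real_def)
      then show ?thesis by blast
    qed
    then obtain C where C: "\<And>J. J \<subseteq> {..<n} \<Longrightarrow> \<forall>\<^sub>F t in nhds x. t \<in> Or J \<longrightarrow> \<bar>f t\<bar> \<le> C J" by metis
    define D where "D = Max (C ` Pow {..<n})"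
    have D: "C J \<le> D" if "J \<subseteq> {..<n}" for J using that by (auto simp: D_def)
    have "\<forall>\<^sub>F t in nhds x. \<forall>J\<in>Pow {..<n}. t \<in> Or J \<longrightarrow> \<bar>f t\<bar> \<le> C J"
      using C by (intro eventually_ball_finite) auto
    then obtain U where U: "open U" "x \<in> U" "\<forall>t\<in>U. \<forall>J\<in>Pow {..<n}. t \<in> Or J \<longrightarrow> \<bar>f t\<bar> \<le> C J"
      unfolding eventually_nhds by metis
    have "\<bar>f t\<bar> \<le> D" if "t \<in> U \<inter> ?X" for t
    proof -
      \<comment> \<open>The orthant of \<open>t\<close> is given by the coordinates in which it lies
        strictly left of \<open>x\<close>.\<close>
      have "t \<in> Or {j\<in>{..<n}. t j < x j}" using that by (simp add: Or_def Ball_def not_less) (metis not_less)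
      then have "\<bar>f t\<bar> \<le> C {j\<in>{..<n}. t j < x j}"
        using U(3)[rule_format, of t "{j\<in>{..<n}. t j < x j}"] that
        by (simp only: Int_iff Pow_iff Collect_restrict)
      then show ?thesis using D[OF Collect_restrict, of "\<lambda>j. t j < x j"] by linarith
    qed
    then show ?thesis using U by blast
  qed
  then have "\<forall>x\<in>?X. \<exists>p. open (fst p) \<and> x \<in> fst p \<and> (\<forall>t\<in>fst p \<inter> ?X. \<bar>f t\<bar> \<le> snd p)"
    by (intro ballI) (simp only: split_paired_Ex fst_conv snd_conv)
  from bchoice[OF this] obtain q where
    q: "\<forall>x\<in>?X. open (fst (q x)) \<and> x \<in> fst (q x) \<and> (\<forall>t\<in>fst (q x) \<inter> ?X. \<bar>f t\<bar> \<le> snd (q x))"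
    by (elim exE)
  define U C where "U x = fst (q x)" and "C x = snd (q x)" for x
  have U: "open (U x)" "x \<in> U x" and C: "t \<in> U x \<Longrightarrow> t \<in> ?X \<Longrightarrow> \<bar>f t\<bar> \<le> C x" if "x \<in> ?X" for x t
    using q[rule_format, OF that] by (simp_all add: U_def C_def)
  have "?X \<subseteq> (\<Union>x\<in>?X. U x)" using U(2) by (intro subsetI UN_I) assumption+
  from compactE_image[OF compact_PiE_lessThan[OF S] U(1) this]
  obtain F where F: "F \<subseteq> ?X" "finite F" "?X \<subseteq> (\<Union>x\<in>F. U x)" by metis
  show ?thesis
  proof (intro exI[of _ "Max (insert 0 (C ` F))"] ballI)
    fix t assume t: "t \<in> ?X"
    from subsetD[OF F(3) t] obtain x where x: "x \<in> F" "t \<in> U x" by (elim UN_E) simp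
    then have "\<bar>f t\<bar> \<le> C x" using C[OF subsetD[OF F(1)]] t by simp
    also have "\<dots> \<le> Max (insert 0 (C ` F))" using x F by (intro Max_ge) auto
    finally show "\<bar>f t\<bar> \<le> Max (insert 0 (C ` F))" .
  qed
qed

text \<open>\<open>q\<close> depends on \<open>s\<close> only through an integer, so it takes
  countably many values. The \<open>+ 1\<close> puts the grid mark at or above \<open>s\<close>, so
  that \<open>q\<close> approximates \<open>s\<close> from the right without leaving
  \<open>S\<close>.\<close>

lemma grid_above:
  fixes S :: "real set" and k :: nat
  assumes "closed S" "s \<in> S"
  defines "q \<equiv> Sup {u \<in> S. u \<le> (of_int \<lfloor>real (Suc k) * s\<rfloor> + 1) / real (Suc k)}"
  shows "q \<in> S" "s \<le> q" "q \<le> s + 1 / real (Suc k)"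
proof -
  let ?c = "(of_int \<lfloor>real (Suc k) * s\<rfloor> + 1) / real (Suc k)"
  let ?R = "{u \<in> S. u \<le> ?c}"
  have "real (Suc k) * s \<le> of_int \<lfloor>real (Suc k) * s\<rfloor> + 1" by linarith
  then have sc: "s \<le> ?c" by (simp add: pos_le_divide_eq mult.commute)
  have "of_int \<lfloor>real (Suc k) * s\<rfloor> + 1 \<le> real (Suc k) * s + 1" by simp
  then have "?c \<le> (real (Suc k) * s + 1) / real (Suc k)" by (intro divide_right_mono) auto
  also have "\<dots> = s + 1 / real (Suc k)" by (simp add: add_divide_distrib del: of_nat_Suc)
  finally have cs: "?c \<le> s + 1 / real (Suc k)" .
  have sR: "s \<in> ?R" using assms sc by simp
  have bdd: "bdd_above ?R" by (rule bdd_aboveI[of _ ?c]) simp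
  show "s \<le> q" unfolding q_def using sR bdd by (rule cSup_upper)
  have "q \<le> ?c" unfolding q_def using sR by (intro cSup_least) auto
  then show "q \<le> s + 1 / real (Suc k)" using cs by simp
  have "q \<in> closure ?R" unfolding q_def using sR bdd by (intro closure_contains_Sup) auto
  also have "\<dots> \<subseteq> S" using assms(1) by (intro closure_minimal) auto
  finally show "q \<in> S" .
qed

text \<open>An rd-continuous function is the pointwise limit of its compositions with discretisations
  that move every coordinate to the right: rd-continuity with \<open>J = {}\<close> is continuity from the
  right in all coordinates.\<close>

lemma rd_continuous_on_measurable:
  assumes S: "\<And>j. j < n \<Longrightarrow> closed (S j)" and f: "rd_continuous_on n T (PiE {..<n} S) f"
  shows "f \<in> borel_measurable (restrict_space (PiM {..<n} (\<lambda>_. borel)) (PiE {..<n} S))"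
proof -
  let ?X = "PiE {..<n} S" and ?M = "restrict_space (PiM {..<n} (\<lambda>_. borel :: real measure)) (PiE {..<n} S)"
  have "?X \<subseteq> space (PiM {..<n} (\<lambda>_. borel :: real measure))"
    by (intro subsetI) (simp add: space_PiM PiE_iff)
  then have sp: "space ?M = ?X" by (simp only: space_restrict_space Int_absorb2)
  define Q where "Q k l = (\<lambda>j\<in>{..<n}. Sup {u \<in> S j. u \<le> (of_int (l ! j) + 1) / real (Suc k)})" for k :: nat and l :: "int list"
  define L where "L k x = map (\<lambda>j. \<lfloor>real (Suc k) * x j\<rfloor>) [0..<n]" for k and x :: "nat \<Rightarrow> real"
  \<comment> \<open>Lists of integers form a countable type, so any function of the grid cell is
    measurable, whatever \<open>f\<close> does to it.\<close>
  have L: "L k \<in> measurable ?M (count_space UNIV)" for k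
  proof (rule measurableI)
    fix A :: "int list set"
    have m: "{x \<in> space ?M. \<lfloor>real (Suc k) * x j\<rfloor> = i} \<in> sets ?M" if "j < n" for j i
    proof -
      have "(\<lambda>x. x j) \<in> borel_measurable ?M"
        using that by (intro measurable_restrict_space1 measurable_component_singleton) auto
      then have "(\<lambda>x. real (Suc k) * x j) \<in> borel_measurable ?M"
        by (intro borel_measurable_times borel_measurable_const)
      then have "(\<lambda>x. \<lfloor>real (Suc k) * x j\<rfloor>) \<in> measurable ?M (count_space UNIV)"
        by (rule measurable_compose[OF _ measurable_real_floor])
      from measurable_sets[OF this, of "{i}"] show ?thesis
        by (simp add: vimage_def Collect_conj_eq Int_commute del: of_nat_Suc)
    qed
    have single: "{x \<in> space ?M. L k x = l} \<in> sets ?M" for l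
    proof (cases "length l = n")
      case True
      have "{x \<in> space ?M. L k x = l} = {x \<in> space ?M. \<forall>j\<in>{..<n}. \<lfloor>real (Suc k) * x j\<rfloor> = l ! j}"
        using True unfolding L_def by (intro Collect_cong) (simp add: list_eq_iff_nth_eq Ball_def del: of_nat_Suc)
      then show ?thesis using m by (simp only:, intro sets.sets_Collect_finite_All) (simp_all del: of_nat_Suc)
    next
      case False
      then have "{x \<in> space ?M. L k x = l} = {}" unfolding L_def by (intro Collect_empty_eq[THEN iffD2]) auto
      then show ?thesis by (simp only: sets.empty_sets)
    qed
    have "L k -` A \<inter> space ?M = (\<Union>l\<in>A. {x \<in> space ?M. L k x = l})" by blast
    then show "L k -` A \<inter> space ?M \<in> sets ?M"
      using single by (simp only:, intro sets.countable_UN' countableI_type) auto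
  qed simp
  have Qx: "Q k (L k x) \<in> ?X" "\<And>j. j < n \<Longrightarrow> x j \<le> Q k (L k x) j \<and> Q k (L k x) j \<le> x j + 1 / real (Suc k)"
    if x: "x \<in> ?X" for x k
  proof -
    have "Q k (L k x) j = Sup {u \<in> S j. u \<le> (of_int \<lfloor>real (Suc k) * x j\<rfloor> + 1) / real (Suc k)}" if "j < n" for j
      using that by (simp add: Q_def L_def)
    moreover have "x j \<in> S j" if "j < n" for j using x that by (auto simp: PiE_iff)
    ultimately have *: "Q k (L k x) j \<in> S j \<and> x j \<le> Q k (L k x) j \<and> Q k (L k x) j \<le> x j + 1 / real (Suc k)" if "j < n" for j
      using grid_above[OF S[OF that], of "x j" k] that by simp
    then show "Q k (L k x) \<in> ?X" by (simp add: PiE_iff extensional_def) (simp add: Q_def)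
    show "\<And>j. j < n \<Longrightarrow> x j \<le> Q k (L k x) j \<and> Q k (L k x) j \<le> x j + 1 / real (Suc k)" using * by blast
  qed
  show ?thesis
  proof (rule borel_measurable_LIMSEQ_real)
    fix k
    show "(\<lambda>x. f (Q k (L k x))) \<in> borel_measurable ?M"
      by (rule measurable_compose[OF L]) simp
  next
    fix x assume "x \<in> space ?M"
    then have x: "x \<in> ?X" by (simp only: sp)
    have lim: "(f \<longlongrightarrow> f x) (inf (nhds x) (principal {t\<in>?X. \<forall>j\<in>{..<n}. x j \<le> t j}))"
      using f x by (rule rd_continuous_onD(2))
    show "(\<lambda>k. f (Q k (L k x))) \<longlonglongrightarrow> f x"
    proof (rule filterlim_compose[OF lim])
      show "filterlim (\<lambda>k. Q k (L k x)) (inf (nhds x) (principal {t\<in>?X. \<forall>j\<in>{..<n}. x j \<le> t j})) sequentially"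
      proof (rule filterlim_inf[THEN iffD2], rule conjI)
        show "filterlim (\<lambda>k. Q k (L k x)) (principal {t\<in>?X. \<forall>j\<in>{..<n}. x j \<le> t j}) sequentially"
          using Qx[OF x] by (auto simp: filterlim_principal intro!: always_eventually)
        show "filterlim (\<lambda>k. Q k (L k x)) (nhds x) sequentially"
          unfolding filterlim_iff
        proof (intro allI impI)
          fix P assume "eventually P (nhds x)"
          from eventually_nhds_fun[OF this, of n] obtain e where e: "0 < e"
            "\<And>t. (\<And>j. j < n \<Longrightarrow> \<bar>t j - x j\<bar> < e) \<Longrightarrow> (\<And>j. n \<le> j \<Longrightarrow> t j = x j) \<Longrightarrow> P t" by blast
          have "\<forall>\<^sub>F k in sequentially. inverse (real (Suc k)) < e"
            using LIMSEQ_inverse_real_of_nat e(1) by (rule order_tendstoD)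
          then show "\<forall>\<^sub>F k in sequentially. P (Q k (L k x))"
          proof eventually_elim
            case (elim k)
            show "P (Q k (L k x))"
            proof (rule e(2))
              show "\<bar>Q k (L k x) j - x j\<bar> < e" if "j < n" for j
                using Qx(2)[OF x that, of k] elim by (simp add: inverse_eq_divide)
              show "Q k (L k x) j = x j" if "n \<le> j" for j
                using Qx(1)[OF x, of k] x that by (auto simp: PiE_iff extensional_def)
            qed
          qed
        qed
      qed
    qed
  qed
qed

lemma rd_continuous_on_right:
  assumes f: "rd_continuous_on n T X f" and x: "x \<in> X" "x \<in> extensional {..<n}" and k: "k < n" and e: "0 < e"
  shows "\<exists>d>0. \<forall>s. x k < s \<longrightarrow> s < x k + d \<longrightarrow> x(k := s) \<in> X \<longrightarrow> \<bar>f (x(k := s)) - f x\<bar> < e"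
proof -
  have "(f \<longlongrightarrow> f x) (inf (nhds x) (principal {t\<in>X. \<forall>j\<in>{..<n}. x j \<le> t j}))"
    using f x(1) by (rule rd_continuous_onD(2))
  from tendstoD[OF this e]
  have "\<forall>\<^sub>F t in nhds x. t \<in> {t\<in>X. \<forall>j\<in>{..<n}. x j \<le> t j} \<longrightarrow> dist (f t) (f x) < e"
    by (simp add: eventually_inf_principal)
  from eventually_nhds_fun[OF this, of n] obtain d where d: "0 < d"
    "\<And>t. (\<And>j. j < n \<Longrightarrow> \<bar>t j - x j\<bar> < d) \<Longrightarrow> (\<And>j. n \<le> j \<Longrightarrow> t j = x j) \<Longrightarrow>
      t \<in> {t\<in>X. \<forall>j\<in>{..<n}. x j \<le> t j} \<longrightarrow> dist (f t) (f x) < e" by blast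
  show ?thesis
  proof (intro exI[of _ d] conjI allI impI)
    fix s assume s: "x k < s" "s < x k + d" "x(k := s) \<in> X"
    show "\<bar>f (x(k := s)) - f x\<bar> < e"
      using d(1) d(2)[of "x(k := s)"] s k by (simp add: dist_real_def)
  qed (rule d(1))
qed

section \<open>Recovering a function from its mixed derivative\<close>

text \<open>A left-scattered maximum is isolated, so removing it leaves the part of \<open>S\<close>
  up to its backward jump. This makes the domains of the derivatives compact.\<close>

lemma ts_kappa_closed:
  assumes "closed S"
  shows "closed (ts_kappa S)"
proof (cases "\<exists>t\<in>S. (\<forall>s\<in>S. s \<le> t) \<and> backward_jump S t < t")
  case True
  then obtain t where t: "t \<in> S" "\<And>s. s \<in> S \<Longrightarrow> s \<le> t" "backward_jump S t < t" by blast
  have below: "s \<le> backward_jump S t" if "s \<in> S" "s < t" for s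
  proof -
    have "s \<le> Sup {s \<in> S. s < t}"
      using that by (intro cSup_upper) (auto intro!: bdd_aboveI[of _ t])
    then show ?thesis using that by (auto simp: backward_jump_def)
  qed
  have "ts_kappa S = S \<inter> {..backward_jump S t}"
  proof (intro equalityI subsetI)
    fix s assume s: "s \<in> ts_kappa S"
    then have "s \<noteq> t" using t by (auto simp: ts_kappa_def)
    then show "s \<in> S \<inter> {..backward_jump S t}"
      using s t(2)[of s] below[of s] by (auto simp: ts_kappa_def)
  next
    fix s assume s: "s \<in> S \<inter> {..backward_jump S t}"
    then have "s < t" using t(3) by simp
    then show "s \<in> ts_kappa S" using s t(1) by (force simp: ts_kappa_def)
  qed
  then show ?thesis using assms by (simp add: closed_Int)
next
  case False
  then have "ts_kappa S = S" by (auto simp: ts_kappa_def)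
  then show ?thesis using assms by simp
qed

text \<open>\<open>Lim\<close> identifies a limit only along a proper filter. The second point
  \<open>r\<close> excludes a one-point time scale, whose point lies in \<open>ts_kappa\<close> but
  cannot be approached.\<close>

lemma delta_filter_nontrivial:
  assumes S: "time_scale S" and t: "t \<in> ts_kappa S" and r: "r \<in> S" "r \<noteq> t"
  shows "delta_filter S t \<noteq> bot"
proof
  assume "delta_filter S t = bot"
  then have "eventually (\<lambda>_. False) (delta_filter S t)" by simp
  then obtain d where d: "0 < d" "\<And>s. s \<in> S \<Longrightarrow> s \<noteq> forward_jump S t \<Longrightarrow> \<bar>s - t\<bar> < d \<Longrightarrow> False"
    unfolding eventually_delta_filter by blast
  have tS: "t \<in> S" using t by (simp add: ts_kappa_def)
  have \<sigma>: "forward_jump S t = t" using d(2)[OF tS] d(1) by (cases "t = forward_jump S t") auto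
  show False
  proof (cases "\<exists>s\<in>S. t < s")
    case True
    then have "\<exists>s\<in>{s \<in> S. t < s}. s < t + d"
      using \<sigma> d(1) by (intro cInf_lessD) (auto simp: forward_jump_def)
    then obtain s where "s \<in> S" "t < s" "s < t + d" by blast
    then show False using d(2)[of s] \<sigma> by simp
  next
    case False
    then have "\<forall>s\<in>S. s \<le> t" by force
    then have bj: "\<not> backward_jump S t < t" using t by (simp add: ts_kappa_def)
    have "r < t" using r False by force
    then have ex: "\<exists>s\<in>S. s < t" using r by blast
    have "\<exists>s\<in>{s \<in> S. s < t}. t - d < s"
    proof (rule less_cSupD)
      show "{s \<in> S. s < t} \<noteq> {}" using ex by blast
      show "t - d < Sup {s \<in> S. s < t}"
        using bj ex d(1) by (simp add: backward_jump_def)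
    qed
    then obtain s where "s \<in> S" "s < t" "t - d < s" by blast
    then show False using d(2)[of s] \<sigma> by simp
  qed
qed

lemma delta_integral_cong:
  assumes "\<And>s. s \<in> T \<inter> {c..<d} \<Longrightarrow> f s = g s"
  shows "delta_integral T c d f = delta_integral T c d g"
proof -
  have "indicator (T \<inter> {c..<d}) s *\<^sub>R f s = indicator (T \<inter> {c..<d}) s *\<^sub>R g s" for s
    using assms by (simp add: indicator_def)
  then show ?thesis by (simp only: delta_integral_def set_lebesgue_integral_def)
qed

section \<open>Boundary values, regularity and iterated integration of mixed derivatives\<close>

context delta_box
begin

lemma cut_time_scale: "j < n \<Longrightarrow> time_scale (cut T a b j)"
  unfolding cut_def using ab[of j] by (intro time_scale_cut T bT) auto

lemma cut_ends: "j < n \<Longrightarrow> a j \<in> cut T a b j" "j < n \<Longrightarrow> b j \<in> cut T a b j"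
  using ab[of j] aT bT by (auto simp: cut_def)

lemma cut_compact: "j < n \<Longrightarrow> compact (cut T a b j)"
  using T[of j] unfolding cut_def time_scale_def by (intro closed_Int_compact) auto

lemma kappa_compact: "j < n \<Longrightarrow> compact (if j < k then ts_kappa (cut T a b j) else cut T a b j)"
proof -
  assume j: "j < n"
  have "ts_kappa (cut T a b j) \<subseteq> cut T a b j" by (auto simp: ts_kappa_def)
  then have "ts_kappa (cut T a b j) = cut T a b j \<inter> ts_kappa (cut T a b j)" by (rule Int_absorb1[symmetric])
  moreover have "compact (cut T a b j \<inter> ts_kappa (cut T a b j))"
    using cut_compact[OF j] by (intro compact_Int_closed ts_kappa_closed compact_imp_closed)
  ultimately show ?thesis using cut_compact[OF j] by simp
qed

lemma delta_filter_cut_nontrivial: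
  assumes "j < n" "t \<in> ts_kappa (cut T a b j)"
  shows "delta_filter (cut T a b j) t \<noteq> bot"
proof -
  have "a j \<noteq> t \<or> b j \<noteq> t" using ab[OF assms(1)] by auto
  then show ?thesis
    using delta_filter_nontrivial[OF cut_time_scale[OF assms(1)] assms(2)] cut_ends[OF assms(1)] by blast
qed

lemma Omega_kappa_0: "Omega_kappa n T a b 0 = Omega n T a b"
  by (simp add: Omega_kappa_def Omega_def cut_def)

lemma Omega_kappa_iff:
  "x \<in> Omega_kappa n T a b k \<longleftrightarrow>
    (\<forall>j<n. x j \<in> cut T a b j \<and> (j < k \<longrightarrow> x j \<in> ts_kappa (cut T a b j))) \<and> (\<forall>j\<ge>n. x j = undefined)"
proof -
  have "ts_kappa (cut T a b j) \<subseteq> cut T a b j" for j by (auto simp: ts_kappa_def)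
  then have *: "(x j \<in> (if j < k then ts_kappa (cut T a b j) else cut T a b j)) \<longleftrightarrow>
      (x j \<in> cut T a b j \<and> (j < k \<longrightarrow> x j \<in> ts_kappa (cut T a b j)))" for j by auto
  show ?thesis unfolding Omega_kappa_def PiE_iff * extensional_def by (simp add: Ball_def not_less)
qed

lemma Omega_kappa_in:
  assumes "x \<in> Omega_kappa n T a b k" "j < n"
  shows "x j \<in> cut T a b j" "j < k \<Longrightarrow> x j \<in> ts_kappa (cut T a b j)"
  using assms unfolding Omega_kappa_iff by blast+

lemma Omega_kappa_upd:
  assumes "x \<in> Omega_kappa n T a b k" "k < n"
  shows "s \<in> ts_kappa (cut T a b k) \<Longrightarrow> x(k := s) \<in> Omega_kappa n T a b (Suc k)"
    and "s \<in> cut T a b k \<Longrightarrow> x(k := s) \<in> Omega_kappa n T a b k"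
  using assms unfolding Omega_kappa_iff by (simp_all add: less_Suc_eq) (simp add: ts_kappa_def)

lemma Omega_kappa_Suc_subset:
  assumes "x \<in> Omega_kappa n T a b (Suc k)"
  shows "x \<in> Omega_kappa n T a b k"
  using assms unfolding Omega_kappa_iff by simp

text \<open>Differentiation in a variable other than \<open>j\<close> stays on the face
  \<open>x j = a j\<close>, where all quotients vanish. With \<open>j = k\<close> this removes the
  boundary term when the derivative in variable \<open>k\<close> is integrated back.\<close>

lemma delta_D_zero:
  assumes y0: "\<And>x j. x \<in> Omega n T a b \<Longrightarrow> j < n \<Longrightarrow> x j = a j \<Longrightarrow> y x = 0"
    and "x \<in> Omega_kappa n T a b k" "k \<le> j" "j < n" "x j = a j"
  shows "delta_D (cut T a b) y k x = 0"
  using assms(2-)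
proof (induction k arbitrary: x)
  case 0
  then show ?case using y0 by (simp add: Omega_kappa_0)
next
  case (Suc k)
  have k: "k < n" "k \<noteq> j" using Suc.prems by auto
  let ?S = "cut T a b k"
  have xk: "x k \<in> ts_kappa ?S" using Omega_kappa_in(2)[OF Suc.prems(1) k(1)] by simp
  have 0: "delta_D (cut T a b) y k (x(k := s)) = 0" if "s \<in> ?S" for s
    using Suc.prems k
    by (intro Suc.IH[OF Omega_kappa_upd(2)[OF Omega_kappa_Suc_subset[OF Suc.prems(1)] k(1) that]]) auto
  have "forward_jump ?S (x k) \<in> ?S"
    using xk by (intro forward_jump_in cut_time_scale k) (simp add: ts_kappa_def)
  then have "\<forall>\<^sub>F s in delta_filter ?S (x k). delta_quotient (cut T a b) k (delta_D (cut T a b) y k) x s = 0"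
    unfolding eventually_delta_filter by (intro exI[of _ 1]) (auto simp: delta_quotient_def 0)
  then have "(delta_quotient (cut T a b) k (delta_D (cut T a b) y k) x \<longlongrightarrow> 0) (delta_filter ?S (x k))"
    by (rule tendsto_eventually)
  from tendsto_Lim[OF delta_filter_cut_nontrivial[OF k(1) xk] this]
  show ?case by (simp add: partial_delta_deriv_def)
qed

lemma rd_section:
  assumes f: "rd_continuous_on n T (Omega_kappa n T a b m) f" and x: "x \<in> Omega_kappa n T a b k" and k: "k < n" and m: "m = Suc k"
  shows "bdd_meas (T k \<inter> {a k..<b k}) (\<lambda>s. f (x(k := s)))"
proof -
  let ?X = "Omega_kappa n T a b m" and ?R = "T k \<inter> {a k..<b k}"
  have in_X: "x(k := s) \<in> ?X" if "s \<in> ?R" for s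
    unfolding m using that ab[OF k] cut_ends(2)[OF k]
    by (intro Omega_kappa_upd(1)[OF x k] ts_kappa_below_max[of "b k"]) (auto simp: cut_def)
  note kc = kappa_compact[where k=m]
  have "\<exists>C. \<forall>t\<in>?X. \<bar>f t\<bar> \<le> C"
    unfolding Omega_kappa_def by (rule rd_continuous_on_bounded[OF kc f[unfolded Omega_kappa_def]])
  then obtain C where "\<forall>t\<in>?X. \<bar>f t\<bar> \<le> C" by (elim exE)
  note C = this[rule_format]
  have fm: "f \<in> borel_measurable (restrict_space (PiM {..<n} (\<lambda>_. borel)) ?X)"
    unfolding Omega_kappa_def
    by (rule rd_continuous_on_measurable[OF compact_imp_closed[OF kc] f[unfolded Omega_kappa_def]])
  have "(\<lambda>s. x(k := s)) \<in> measurable (restrict_space borel ?R) (restrict_space (PiM {..<n} (\<lambda>_. borel)) ?X)"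
  proof (rule measurable_restrict_space2)
    show "(\<lambda>s. x(k := s)) \<in> space (restrict_space borel ?R) \<rightarrow> ?X"
      using in_X by (simp add: space_restrict_space Pi_def)
    have "x \<in> space (PiM {..<n} (\<lambda>_. borel :: real measure))"
      using x unfolding Omega_kappa_def by (simp add: space_PiM PiE_iff)
    then show "(\<lambda>s. x(k := s)) \<in> measurable (restrict_space borel ?R) (PiM {..<n} (\<lambda>_. borel))"
      using k by (intro measurable_fun_upd[where J="{..<n}"] measurable_const measurable_restrict_space1) auto
  qed
  from measurable_compose[OF this fm] show ?thesis
    unfolding bdd_meas_def by (intro conjI exI[of _ C] ballI C in_X)
qed

lemma rd_nice:
  assumes f: "rd_continuous_on n T (PiE {..<n} S) f"
    and S: "\<And>j. j < n \<Longrightarrow> compact (S j)" "\<And>j. j < n \<Longrightarrow> T j \<inter> {a j..<b j} \<subseteq> S j"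
  shows "nice {..<n} f"
proof -
  have sub: "ubox b {..<n} \<subseteq> PiE {..<n} S" unfolding ubox_def using S(2) by (intro PiE_mono) simp
  show ?thesis
    unfolding nice_def
  proof
    show "f \<in> borel_measurable (BM {..<n})"
      using rd_continuous_on_measurable[OF compact_imp_closed[OF S(1)] f] sub
      by (rule measurable_restrict_mono)
    have "\<exists>C. \<forall>t\<in>PiE {..<n} S. \<bar>f t\<bar> \<le> C" by (rule rd_continuous_on_bounded[OF S(1) f])
    then obtain C where "\<forall>t\<in>PiE {..<n} S. \<bar>f t\<bar> \<le> C" by (elim exE)
    note C = this[rule_format, OF subsetD[OF sub]]
    show "\<exists>C. \<forall>t\<in>ubox b {..<n}. \<bar>f t\<bar> \<le> C"
      by (intro exI[of _ C] ballI C)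
  qed
qed

lemma ubox_Omega_kappa: "ubox b {..<n} \<subseteq> Omega_kappa n T a b k"
proof -
  have "T j \<inter> {a j..<b j} \<subseteq> ts_kappa (cut T a b j)" if "j < n" for j
    using cut_ends(2)[OF that] by (auto simp: cut_def intro!: ts_kappa_below_max[of "b j"])
  then show ?thesis unfolding ubox_def Omega_kappa_def by (intro PiE_mono) (auto simp: cut_def)
qed

lemma mixed_deriv_nice:
  assumes "rd_continuous_on n T (Omega_kappa n T a b n) f"
  shows "nice {..<n} f"
proof (rule rd_nice[OF assms[unfolded Omega_kappa_def]])
  show "compact (if j < n then ts_kappa (cut T a b j) else cut T a b j)" if "j < n" for j
    by (rule kappa_compact[OF that])
  show "T j \<inter> {a j..<b j} \<subseteq> (if j < n then ts_kappa (cut T a b j) else cut T a b j)" if "j < n" for j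
    using that cut_ends(2)[OF that] by (auto simp: cut_def intro!: ts_kappa_below_max[of "b j"])
qed

text \<open>The derivative is a true limit because the quotient converges along a proper filter, and
  its continuity from the right in coordinate \<open>k\<close> is the case \<open>J = {}\<close> of
  rd-continuity. The lower boundary term vanishes by \<open>delta_D_zero\<close>.\<close>

lemma partial_FTC:
  assumes y: "y \<in> L_class n T a b p" and k: "k < n" and x: "x \<in> Omega_kappa n T a b k"
  shows "delta_integral (T k) (a k) (x k) (\<lambda>s. delta_D (cut T a b) y (Suc k) (x(k := s)))
    = delta_D (cut T a b) y k x"
proof -
  let ?S = "cut T a b k" and ?D = "delta_D (cut T a b) y"
  have diff: "partial_delta_differentiable (cut T a b) k (?D k) z" if "z \<in> Omega_kappa n T a b (Suc k)" for z
    using y k that unfolding L_class_def by blast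
  have rd: "rd_continuous_on n T (Omega_kappa n T a b (Suc k)) (?D (Suc k))"
    using y k unfolding L_class_def by blast
  have y0: "\<And>x j. x \<in> Omega n T a b \<Longrightarrow> j < n \<Longrightarrow> x j = a j \<Longrightarrow> y x = 0"
    using y unfolding L_class_def by blast
  have xk: "x k \<in> T k" "a k \<le> x k" "x k \<le> b k"
    using Omega_kappa_in(1)[OF x k] by (auto simp: cut_def)
  have bm: "bdd_meas (T k \<inter> {a k..<b k}) (\<lambda>s. ?D (Suc k) (x(k := s)))"
    by (rule rd_section[OF rd x k refl])
  have "ts_int (T k) (a k) (x k) (\<lambda>s. ?D (Suc k) (x(k := s))) = ?D k (x(k := x k)) - ?D k (x(k := a k))"
  proof (rule ts_FTC[OF T[OF k] aT[OF k] bT[OF k] xk bm])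
    show "?S = T k \<inter> {a k..b k}" by (simp add: cut_def)
  next
    fix t assume t: "t \<in> ts_kappa ?S"
    let ?z = "x(k := t)"
    have z: "?z \<in> Omega_kappa n T a b (Suc k)" by (rule Omega_kappa_upd(1)[OF x k t])
    obtain l where l: "(delta_quotient (cut T a b) k (?D k) ?z \<longlongrightarrow> l) (delta_filter ?S (?z k))"
      using diff[OF z] unfolding partial_delta_differentiable_def by blast
    moreover have "?D (Suc k) ?z = l"
      using tendsto_Lim[OF _ l] delta_filter_cut_nontrivial[OF k t] by (simp add: partial_delta_deriv_def)
    ultimately show "((\<lambda>s. (?D k (x(k := forward_jump ?S t)) - ?D k (x(k := s))) / (forward_jump ?S t - s))
        \<longlongrightarrow> ?D (Suc k) ?z) (delta_filter ?S t)"
      by (simp add: delta_quotient_def[abs_def] del: delta_D.simps)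
  next
    fix t e :: real assume t: "t \<in> T k" "a k \<le> t" "t < b k" and e: "0 < e"
    have k': "s \<in> ts_kappa ?S" if "s \<in> T k" "a k \<le> s" "s < b k" for s
      using that cut_ends(2)[OF k] by (intro ts_kappa_below_max[of "b k"]) (auto simp: cut_def)
    have z: "x(k := t) \<in> Omega_kappa n T a b (Suc k)" by (rule Omega_kappa_upd(1)[OF x k k'[OF t]])
    have "x(k := t) \<in> extensional {..<n}" using z by (simp add: Omega_kappa_def PiE_iff)
    from rd_continuous_on_right[OF rd z this k e] obtain d where d: "d > 0"
      "\<forall>s. (x(k := t)) k < s \<longrightarrow> s < (x(k := t)) k + d \<longrightarrow> (x(k := t))(k := s) \<in> Omega_kappa n T a b (Suc k) \<longrightarrow>
         \<bar>?D (Suc k) ((x(k := t))(k := s)) - ?D (Suc k) (x(k := t))\<bar> < e" by (elim exE conjE)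
    show "\<exists>d>0. \<forall>s\<in>T k. t < s \<longrightarrow> s < t + d \<longrightarrow> s < b k \<longrightarrow>
        \<bar>?D (Suc k) (x(k := s)) - ?D (Suc k) (x(k := t))\<bar> < e"
    proof (intro exI[of _ d] conjI ballI impI)
      fix s assume s: "s \<in> T k" "t < s" "s < t + d" "s < b k"
      have "x(k := s) \<in> Omega_kappa n T a b (Suc k)"
        using s t by (intro Omega_kappa_upd(1)[OF x k k']) auto
      then show "\<bar>?D (Suc k) (x(k := s)) - ?D (Suc k) (x(k := t))\<bar> < e"
        using d(2)[rule_format, of s] s by (simp del: delta_D.simps)
    qed (rule d(1))
  qed
  moreover have "?D k (x(k := a k)) = 0"
    using k by (intro delta_D_zero[OF y0, where j=k] Omega_kappa_upd(2)[OF x] cut_ends) auto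
  moreover have "delta_integral (T k) (a k) (x k) (\<lambda>s. ?D (Suc k) (x(k := s)))
      = ts_int (T k) (a k) (x k) (\<lambda>s. ?D (Suc k) (x(k := s)))"
    using xk by (intro delta_integrable_ts_int(2) T aT k bdd_meas_subset[OF bm]) auto
  ultimately show ?thesis by (simp del: delta_D.simps)
qed

lemma Omega_upper: "x \<in> Omega n T a b \<Longrightarrow> upper x"
  unfolding Omega_def upper_def by (auto dest!: PiE_mem)

text \<open>The innermost integral is over the last coordinate, which was differentiated last, so
  each integration undoes the most recent derivative.\<close>

lemma Omega_integral_mixed_deriv:
  assumes y: "y \<in> L_class n T a b p" and x: "x \<in> Omega n T a b"
  shows "Omega_integral n T a x (mixed_deriv n T a b y) = y x"
proof -
  let ?D = "delta_D (cut T a b) y"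
  note up = upperD[OF Omega_upper[OF x]]
  have x_ext: "x j = undefined" if "n \<le> j" for j
    using x that by (auto simp: Omega_def PiE_iff extensional_def)
  \<comment> \<open>Coordinates below \<open>k\<close> are fixed by outer integrals and lie strictly
    below \<open>b\<close>, hence in \<open>ts_kappa\<close>; the others have already reached their
    upper limit in \<open>x\<close>.\<close>
  have main: "iter_integral T a x [k..<n] (?D n) t = ?D k (\<lambda>j. if j < k then t j else x j)"
    if "k \<le> n" "t \<in> ubox x {..<k}" for k t
    using that
  proof (induction k arbitrary: t rule: inc_induct)
    case base
    have "(\<lambda>j. if j < n then t j else x j) = t"
      using base x_ext by (auto simp: ubox_def PiE_iff extensional_def fun_eq_iff)
    then show ?case by simp
  next
    case (step k)
    let ?z = "\<lambda>j. if j < k then t j else x j"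
    have z: "?z \<in> Omega_kappa n T a b k"
      unfolding Omega_kappa_def PiE_iff
    proof (intro conjI ballI)
      fix j assume j: "j \<in> {..<n}"
      show "?z j \<in> (if j < k then ts_kappa (cut T a b j) else cut T a b j)"
      proof (cases "j < k")
        case True
        then have "t j \<in> T j \<inter> {a j..<x j}" using step.prems by (simp add: ubox_def PiE_iff)
        then have "t j \<in> ts_kappa (cut T a b j)"
          using cut_ends(2)[of j] up(3)[of j] j by (intro ts_kappa_below_max[of "b j"]) (auto simp: cut_def)
        then show ?thesis using True by simp
      next
        case False
        then show ?thesis using up[of j] j by (simp add: cut_def)
      qed
    next
      show "?z \<in> extensional {..<n}"
        using step.hyps x_ext by (simp add: extensional_def)
    qed
    have "iter_integral T a x [k..<n] (?D n) t
      = delta_integral (T k) (a k) (x k) (\<lambda>s. iter_integral T a x [Suc k..<n] (?D n) (t(k := s)))"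
      using step.hyps by (simp add: upt_conv_Cons)
    also have "\<dots> = delta_integral (T k) (a k) (x k) (\<lambda>s. ?D (Suc k) (?z(k := s)))"
    proof (rule delta_integral_cong)
      fix s assume s: "s \<in> T k \<inter> {a k..<x k}"
      have "t(k := s) \<in> ubox x {..<Suc k}"
        using ubox_upd[OF step.prems s] by (simp only: lessThan_Suc)
      then have "iter_integral T a x [Suc k..<n] (?D n) (t(k := s))
          = ?D (Suc k) (\<lambda>j. if j < Suc k then (t(k := s)) j else x j)" by (rule step.IH)
      also have "(\<lambda>j. if j < Suc k then (t(k := s)) j else x j) = ?z(k := s)"
        by (auto simp: fun_eq_iff)
      finally show "iter_integral T a x [Suc k..<n] (?D n) (t(k := s)) = ?D (Suc k) (?z(k := s))" .
    qed
    also have "\<dots> = ?D k ?z" using partial_FTC[OF y step.hyps(2) z] by (simp del: delta_D.simps)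
    finally show ?case .
  qed
  have "(\<lambda>_. undefined) \<in> ubox x {..<0}" by (simp add: ubox_def)
  from main[OF _ this] show ?thesis
    by (simp add: Omega_integral_def mixed_deriv_def)
qed

end

section \<open>Opial's and Bihari's inequalities\<close>

text \<open>Differentiability is asked for only inside the interval, because the power functions are
  used with left end 0.\<close>

lemma tangent_below:
  fixes \<psi> c :: "real \<Rightarrow> real"
  assumes "z \<le> z'" "continuous_on {z..z'} \<psi>"
    and d: "\<And>t. z < t \<Longrightarrow> t < z' \<Longrightarrow> (\<psi> has_real_derivative c t) (at t)"
    and c: "\<And>t. z < t \<Longrightarrow> t < z' \<Longrightarrow> c z \<le> c t"
  shows "\<psi> z + c z * (z' - z) \<le> \<psi> z'"
proof (cases "z = z'")
  case False
  then have zz: "z < z'" using assms by simp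
  from MVT[OF zz assms(2)] d obtain l t where t: "z < t" "t < z'" "DERIV \<psi> t :> l" "\<psi> z' - \<psi> z = (z' - z) * l"
    unfolding real_differentiable_def by blast
  then have "l = c t" using d DERIV_unique by blast
  then have "c z * (z' - z) \<le> l * (z' - z)" using c t zz by (intro mult_right_mono) auto
  then show ?thesis using t(4) by (simp add: mult.commute)
qed simp

lemma powr_div_derivative:
  fixes e t :: real
  assumes "0 < t" "e \<noteq> 0"
  shows "((\<lambda>z. z powr e / e) has_real_derivative t powr (e - 1)) (at t)"
  using assms by (auto intro!: derivative_eq_intros)

lemma continuous_on_powr_pos: "0 < e \<Longrightarrow> continuous_on {0..d} (\<lambda>z::real. z powr e)" for e d :: real
  by (intro continuous_on_powr' continuous_intros) auto

lemma powr_tangent: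
  fixes e z z' :: real
  assumes e: "0 < e" and z: "0 \<le> z" "z \<le> z'"
  shows "z powr (e + 1) / (e + 1) + z powr e * (z' - z) \<le> z' powr (e + 1) / (e + 1)"
proof (rule tangent_below[where c="\<lambda>z. z powr e"])
  show "continuous_on {z..z'} (\<lambda>z. z powr (e + 1) / (e + 1))"
    using z e by (intro continuous_on_divide continuous_on_const
        continuous_on_subset[OF continuous_on_powr_pos[of "e + 1" z']]) auto
  fix t assume t: "z < t" "t < z'"
  then show "((\<lambda>z. z powr (e + 1) / (e + 1)) has_real_derivative t powr e) (at t)"
    using powr_div_derivative[of t "e + 1"] z e by simp
  show "z powr e \<le> t powr e" using t z e by (intro powr_mono2) auto
qed (use z in auto)

text \<open>The constant is the maximum of \<open>g powr \<gamma> - g\<close>, attained at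
  \<open>\<gamma> powr (1 / (1 - \<gamma>))\<close>. Splitting off
  \<open>\<gamma> powr \<gamma>\<close> makes Young's inequality with exponents
  \<open>1 / \<gamma>\<close> and \<open>1 / (1 - \<gamma>)\<close> return exactly
  \<open>g\<close>.\<close>

lemma powr_gamma_le:
  fixes g \<gamma> :: real
  assumes "0 < \<gamma>" "\<gamma> < 1" "0 \<le> g"
  shows "g powr \<gamma> \<le> (1 - \<gamma>) * \<gamma> powr (\<gamma> / (1 - \<gamma>)) + g"
proof -
  have "(g / \<gamma>) powr \<gamma> * \<gamma> powr \<gamma>
      \<le> ((g / \<gamma>) powr \<gamma>) powr (1 / \<gamma>) / (1 / \<gamma>) + (\<gamma> powr \<gamma>) powr (1 / (1 - \<gamma>)) / (1 / (1 - \<gamma>))"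
    using assms by (intro Youngs_inequality) auto
  moreover have "(g / \<gamma>) powr \<gamma> * \<gamma> powr \<gamma> = g powr \<gamma>"
    using assms by (simp add: powr_divide)
  moreover have "((g / \<gamma>) powr \<gamma>) powr (1 / \<gamma>) / (1 / \<gamma>) = g"
    using assms by (simp add: powr_powr)
  moreover have "(\<gamma> powr \<gamma>) powr (1 / (1 - \<gamma>)) / (1 / (1 - \<gamma>)) = (1 - \<gamma>) * \<gamma> powr (\<gamma> / (1 - \<gamma>))"
    by (simp add: powr_powr)
  ultimately show ?thesis by linarith
qed

context delta_box
begin

abbreviation undef_pt :: "nat \<Rightarrow> real" where "undef_pt \<equiv> \<lambda>_. undefined"

lemma undef_in: "undef_pt \<in> ubox x {}"
  by (simp add: ubox_def)

lemma ubox_upper: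
  assumes "s \<in> ubox x {..<n}" "upper x"
  shows "upper s"
  unfolding upper_def
proof (intro allI impI)
  fix j assume j: "j < n"
  then show "s j \<in> T j \<and> a j \<le> s j \<and> s j \<le> b j"
    using PiE_mem[OF assms(1)[unfolded ubox_def], of j] upperD(3)[OF assms(2) j] by simp
qed

lemma nice_prod:
  assumes "finite I" "\<And>i. i \<in> I \<Longrightarrow> nice J (f i)"
  shows "nice J (\<lambda>s. \<Prod>i\<in>I. f i s)"
  using assms
proof (induction I rule: finite_induct)
  case empty
  then show ?case by (simp add: nice_const)
next
  case (insert i I)
  then have "nice J (\<lambda>s. f i s * (\<Prod>i\<in>I. f i s))" by (intro nice_mult) auto
  then show ?case using insert by simp
qed

lemma nice_vol: "nice {..<n} (vol n a)"
proof -
  have "bdd_meas (T j \<inter> {a j..<b j}) (\<lambda>r. r - a j)" for j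
    unfolding bdd_meas_def
    by (intro conjI exI[of _ "b j - a j"] measurable_restrict_space1) auto
  from nice_coord[OF this] have "nice {..<n} (\<lambda>s. \<Prod>j<n. s j - a j)" by (intro nice_prod) auto
  then show ?thesis by (simp add: vol_def[abs_def])
qed

lemma vol_nonneg: "upper s \<Longrightarrow> 0 \<le> vol n a s"
  unfolding vol_def by (intro prod_nonneg) (auto simp: upper_def)

lemma Omega_integral_vol: "upper x \<Longrightarrow> Omega_integral n T a x (\<lambda>_. 1) = vol n a x"
  unfolding Omega_integral_def vol_def by (subst iter_one) (auto simp: atLeast0LessThan)

lemma Omega_integral_upper_mono:
  assumes "upper x" "upper x'" "nice {..<n} f" "\<And>j. j < n \<Longrightarrow> x j \<le> x' j" "\<And>s. s \<in> ubox b {..<n} \<Longrightarrow> 0 \<le> f s"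
  shows "0 \<le> Omega_integral n T a x f" "Omega_integral n T a x f \<le> Omega_integral n T a x' f"
  using iter_upper_mono[OF assms(1,2), of "[0..<n]" "{}" f undef_pt] assms undef_in
  by (auto simp: Omega_integral_def atLeast0LessThan)

lemma Omega_integrable_nice: "upper x \<Longrightarrow> nice {..<n} f \<Longrightarrow> Omega_integrable n T a x f"
  unfolding Omega_integrable_def
  by (intro iter_integrable_nice[where J="{}"]) (auto simp: atLeast0LessThan undef_in)

lemma Omega_integral_mono:
  assumes "Omega_integrable n T a x f" "Omega_integrable n T a x g"
    "\<And>s. s \<in> ubox x {..<n} \<Longrightarrow> f s \<le> g s"
  shows "Omega_integral n T a x f \<le> Omega_integral n T a x g"
  unfolding Omega_integral_def
  using assms by (intro iter_mono[where J="{}"]) (auto simp: Omega_integrable_def atLeast0LessThan undef_in)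

lemma Omega_integral_abs_le:
  assumes "Omega_integrable n T a x f" "Omega_integrable n T a x g"
    "\<And>s. s \<in> ubox x {..<n} \<Longrightarrow> \<bar>f s\<bar> \<le> g s"
  shows "\<bar>Omega_integral n T a x f\<bar> \<le> Omega_integral n T a x g"
  unfolding Omega_integral_def
  using assms by (intro iter_abs_le[where J="{}"]) (auto simp: Omega_integrable_def atLeast0LessThan undef_in)

lemma Omega_integral_Holder:
  assumes "upper x" "nice {..<n} f" "\<And>s. s \<in> ubox b {..<n} \<Longrightarrow> 0 \<le> f s"
    "nice {..<n} g" "\<And>s. s \<in> ubox b {..<n} \<Longrightarrow> 0 \<le> g s" "1 < P" "1 < Q" "1 / P + 1 / Q = 1"
  shows "Omega_integral n T a x (\<lambda>t. f t * g t) \<le>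
    Omega_integral n T a x (\<lambda>t. f t powr P) powr (1 / P) * Omega_integral n T a x (\<lambda>t. g t powr Q) powr (1 / Q)"
  unfolding Omega_integral_def
  using assms by (intro iter_Holder[where J="{}"]) (auto simp: atLeast0LessThan undef_in)

section \<open>Slices along the first coordinate\<close>

lemma iter_integral_upd:
  "j \<notin> set js \<Longrightarrow> iter_integral T a (x(j := r)) js f t = iter_integral T a x js f t"
  by (induction js arbitrary: t) auto

text \<open>What the outermost integration acts on: all coordinates but the first are integrated up
  to their limits in \<open>x\<close>. It does not depend on \<open>x 0\<close>, so one function
  serves for every upper limit in the first coordinate.\<close>

definition slice :: "(nat \<Rightarrow> real) \<Rightarrow> ((nat \<Rightarrow> real) \<Rightarrow> real) \<Rightarrow> real \<Rightarrow> real" where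
  "slice x f s = iter_integral T a x [1..<n] f (undef_pt(0 := s))"

lemma slice_integral:
  assumes n: "0 < n" and x: "upper x" and f: "nice {..<n} f"
  shows "Omega_integral n T a x f = ts_int (T 0) (a 0) (x 0) (slice x f)"
    and "bdd_meas (T 0 \<inter> {a 0..<b 0}) (slice x f)"
proof -
  have eq: "[0..<n] = 0 # [1..<n]" using n by (simp add: upt_conv_Cons)
  have set: "set (0 # [1..<n]) = {..<n}" unfolding eq[symmetric] by (simp add: atLeast0LessThan)
  have dist: "distinct (0 # [1..<n])" by simp
  have "{} \<inter> set (0 # [1..<n]) = {}" "nice ({} \<union> set (0 # [1..<n])) f"
    using f unfolding set by simp_all
  note * = iter_Cons'[OF x dist eq_refl[OF set] this undef_in]
  show "Omega_integral n T a x f = ts_int (T 0) (a 0) (x 0) (slice x f)"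
    unfolding Omega_integral_def eq slice_def[abs_def] by (rule *(1))
  show "bdd_meas (T 0 \<inter> {a 0..<b 0}) (slice x f)"
    unfolding slice_def[abs_def] by (rule *(2))
qed

lemma slice_nonneg:
  assumes n: "0 < n" and x: "upper x" and f: "nice {..<n} f" "\<And>s. s \<in> ubox b {..<n} \<Longrightarrow> 0 \<le> f s"
    and s: "s \<in> T 0" "a 0 \<le> s" "s < b 0"
  shows "0 \<le> slice x f s"
proof -
  have "undef_pt(0 := s) \<in> ubox b (insert 0 {})" using s by (intro ubox_upd undef_in) auto
  moreover have "{0} \<union> set [1..<n] = {..<n}" "set [1..<n] \<subseteq> {..<n}" using n by auto
  ultimately show ?thesis unfolding slice_def
    using iter_upper_mono[OF x x, of "[1..<n]" "{0}" f "undef_pt(0 := s)"] f by simp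
qed

lemma slice_mult: "slice x (\<lambda>t. q (t 0) * f t) s = q s * slice x f s"
  unfolding slice_def by (subst iter_pull) auto

lemma slice_mono:
  assumes n: "0 < n" and x: "upper x" and fg: "nice {..<n} f" "nice {..<n} g"
    "\<And>s. s \<in> ubox x {..<n} \<Longrightarrow> f s \<le> g s" and s: "s \<in> T 0" "a 0 \<le> s" "s < x 0"
  shows "slice x f s \<le> slice x g s"
proof -
  have set: "{0} \<union> set [1..<n] = {..<n}" using n by auto
  have t: "undef_pt(0 := s) \<in> ubox x {0}" using ubox_upd[OF undef_in, of s 0 x] s by simp
  have tb: "undef_pt(0 := s) \<in> ubox b {0}" using ubox_subset[OF x, of "{0}"] n t by auto
  have sub: "set [1..<n] \<subseteq> {..<n}" by auto
  have int: "iter_integrable T a x [1..<n] h (undef_pt(0 := s))" if "nice {..<n} h" for h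
  proof (rule iter_integrable_nice[OF x _ sub _ _ tb])
    show "nice ({0} \<union> set [1..<n]) h" unfolding set by (rule that)
  qed simp_all
  show ?thesis unfolding slice_def
  proof (rule iter_mono[OF int int _ t])
    fix r assume "r \<in> ubox x ({0} \<union> set [1..<n])"
    then show "f r \<le> g r" unfolding set by (rule fg(3))
  qed (rule fg)+
qed

lemma slice_one: "upper x \<Longrightarrow> slice x (\<lambda>_. 1) s = (\<Prod>j\<in>{1..<n}. x j - a j)"
  unfolding slice_def by (subst iter_one) auto

lemma slice_upd: "slice (x(0 := r)) f s = slice x f s"
  unfolding slice_def by (rule iter_integral_upd) simp

lemma upper_upd: "upper x \<Longrightarrow> r \<in> T 0 \<Longrightarrow> a 0 \<le> r \<Longrightarrow> r \<le> b 0 \<Longrightarrow> upper (x(0 := r))"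
  by (auto simp: upper_def)

text \<open>Integrals over \<open>Omega\<close> are dominated by a function of the first coordinate alone, so that
  one-dimensional chain rules apply to the integral over that coordinate.\<close>

lemma Omega_integral_le_first:
  assumes n: "0 < n" and x: "upper x" and f: "nice {..<n} f" "\<And>s. s \<in> ubox b {..<n} \<Longrightarrow> 0 \<le> f s"
    and s: "s \<in> ubox x {..<n}"
  shows "Omega_integral n T a s f \<le> ts_int (T 0) (a 0) (s 0) (slice x f)"
proof -
  have sj: "s j \<in> T j \<and> a j \<le> s j \<and> s j < x j" if "j < n" for j
    using s that by (auto simp: ubox_def PiE_iff)
  have up: "upper (x(0 := s 0))"
    using sj[OF n] upperD(3)[OF x n] by (intro upper_upd x) auto
  have "Omega_integral n T a s f \<le> Omega_integral n T a (x(0 := s 0)) f"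
    using sj by (intro Omega_integral_upper_mono(2) ubox_upper[OF s x] up f) (auto simp: less_imp_le)
  also have "\<dots> = ts_int (T 0) (a 0) (s 0) (slice x f)"
    using slice_integral(1)[OF n up f(1)] by (simp add: slice_upd[abs_def])
  finally show ?thesis .
qed

lemma ts_int_slice_nonneg:
  assumes n: "0 < n" and x: "upper x" and f: "nice {..<n} f" "\<And>s. s \<in> ubox b {..<n} \<Longrightarrow> 0 \<le> f s"
    and r: "r \<in> T 0" "a 0 \<le> r" "r \<le> b 0"
  shows "0 \<le> ts_int (T 0) (a 0) r (slice x f)"
proof -
  have "0 * (r - a 0) \<le> ts_int (T 0) (a 0) r (slice x f)"
    using r by (intro ts_int_lower T[OF n] aT[OF n] slice_nonneg[OF n x f] bdd_meas_subset[OF slice_integral(2)[OF n x f(1)]]) auto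
  then show ?thesis by simp
qed

text \<open>Hoelder with exponents \<open>p / \<beta>\<close> and \<open>p / \<alpha>\<close>
  separates the known data from \<open>g\<close>. The power \<open>p / \<beta>\<close> of
  \<open>f1\<close> is the integrand of \<open>K\<close>. The power \<open>p / \<alpha>\<close> of
  \<open>f2\<close> is U^(\<beta>/\<alpha>) times g^p, which the convex chain inequality integrates
  to at most \<alpha>/p times the final U^(p/\<alpha>); taking the root produces the constant
  \<open>(\<alpha> / p) powr (\<alpha> / p)\<close> and leaves \<open>G\<close> to the first
  power.\<close>

lemma Omega_opial:
  fixes \<alpha> \<beta> :: real
  assumes n: "0 < n" and x: "upper x" and \<alpha>: "0 < \<alpha>" and \<beta>: "0 < \<beta>" and p: "p = \<alpha> + \<beta>" "1 < p"
    and g: "nice {..<n} g" "\<And>s. s \<in> ubox b {..<n} \<Longrightarrow> 0 \<le> g s"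
    and \<omega>: "nice {..<n} \<omega>" "\<And>s. s \<in> ubox b {..<n} \<Longrightarrow> 0 \<le> \<omega> s"
    and h: "Omega_integrable n T a x h"
    and h_le: "\<And>s. s \<in> ubox x {..<n} \<Longrightarrow> \<bar>h s\<bar> \<le> \<omega> s * Omega_integral n T a s g powr \<beta> * g s powr \<alpha>"
  shows "\<bar>Omega_integral n T a x h\<bar> \<le> ((\<alpha> / p) powr (\<alpha> / p) *
      (Omega_integral n T a x (\<lambda>t. vol n a t powr (p - 1) * \<omega> t powr (p / \<beta>))) powr (\<beta> / p)) *
      Omega_integral n T a x (\<lambda>t. g t powr p)"
proof -
  let ?L = "Omega_integral n T a"
  define gp where "gp = (\<lambda>t. g t powr p)"
  define H where "H = slice x gp"
  \<comment> \<open>The summand 0 is the starting value \<open>u0\<close> in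
    \<open>ts_convex_chain\<close>.\<close>
  define U where "U = (\<lambda>r. 0 + ts_int (T 0) (a 0) r H)"
  have pos: "0 < p" "\<alpha> < p" "\<beta> < p" using \<alpha> \<beta> p by auto
  have gp: "nice {..<n} gp" "\<And>s. s \<in> ubox b {..<n} \<Longrightarrow> 0 \<le> gp s"
    unfolding gp_def using g pos by (auto intro!: nice_powr)
  have xb: "ubox x {..<n} \<subseteq> ubox b {..<n}" using x by (intro ubox_subset) auto
  note Hm = slice_integral(2)[OF n x gp(1), folded H_def]
  have H0: "\<And>s. s \<in> T 0 \<Longrightarrow> a 0 \<le> s \<Longrightarrow> s < b 0 \<Longrightarrow> 0 \<le> H s"
    unfolding H_def by (rule slice_nonneg[OF n x gp])
  note x0 = upperD[OF x n]
  have b0: "b 0 \<in> T 0" "a 0 \<le> b 0" using ab[OF n] bT[OF n] by auto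
  have Ux: "U (x 0) = ?L x gp" using slice_integral(1)[OF n x gp(1)] by (simp add: U_def H_def)
  let ?q = "\<beta> / \<alpha>"
  have convex: "(\<alpha> / p) * z powr (p / \<alpha>) + z powr ?q * (z' - z) \<le> (\<alpha> / p) * z' powr (p / \<alpha>)"
    if "0 \<le> z" "z \<le> z'" for z z'
  proof -
    have eq: "?q + 1 = p / \<alpha>" using \<alpha> p by (simp add: field_simps)
    show ?thesis using powr_tangent[OF _ that, of ?q] \<alpha> \<beta> unfolding eq by (simp add: mult.commute)
  qed
  \<comment> \<open>Only the measurability half of the chain lemma is used here; the tangent
    inequality for powers supplies its premises for any positive exponent.\<close>
  have cU: "bdd_meas (T 0 \<inter> {a 0..<b 0}) (\<lambda>r. U r powr e)" if e: "0 < e" for e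
    by (rule ts_convex_chain(1)[OF T[OF n] aT[OF n] b0 Hm H0 U_def continuous_on_powr_pos[OF e] powr_tangent[OF e]])
  define f1 where "f1 = (\<lambda>s. vol n a s powr (\<beta> * (p - 1) / p) * \<omega> s)"
  define f2 where "f2 = (\<lambda>s. U (s 0) powr (\<beta> / p) * g s powr \<alpha>)"
  have vol0: "0 \<le> vol n a s" if "s \<in> ubox b {..<n}" for s
    using vol_nonneg[OF ubox_upper[OF that upper_b]] .
  have f1: "nice {..<n} f1" "\<And>s. s \<in> ubox b {..<n} \<Longrightarrow> 0 \<le> f1 s"
    unfolding f1_def using \<omega> vol0 \<beta> p by (auto intro!: nice_mult nice_powr nice_vol)
  have f2: "nice {..<n} f2" "\<And>s. s \<in> ubox b {..<n} \<Longrightarrow> 0 \<le> f2 s"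
    unfolding f2_def using g \<alpha> \<beta> pos n by (auto intro!: nice_mult nice_powr nice_coord[OF cU])
  have main: "\<bar>h s\<bar> \<le> f1 s * f2 s" if s: "s \<in> ubox x {..<n}" for s
  proof -
    have sb: "s \<in> ubox b {..<n}" using s xb by auto
    have us: "upper s" using s x by (rule ubox_upper)
    have G0: "0 \<le> ?L s gp" "0 \<le> ?L s g"
      using Omega_integral_upper_mono(1)[OF us us gp(1) _ gp(2)] Omega_integral_upper_mono(1)[OF us us g(1) _ g(2)] by auto
    \<comment> \<open>The factor 1 lets Hoelder with exponents \<open>p / (p - 1)\<close> and
      \<open>p\<close> bring in the volume as the integral of a constant.\<close>
    have "?L s (\<lambda>t. 1 * g t) \<le> ?L s (\<lambda>t. 1 powr (p / (p - 1))) powr (1 / (p / (p - 1))) * ?L s (\<lambda>t. g t powr p) powr (1 / p)"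
      using p g by (intro Omega_integral_Holder us nice_const) (auto simp: field_simps)
    then have "?L s g \<le> vol n a s powr ((p - 1) / p) * ?L s gp powr (1 / p)"
      using Omega_integral_vol[OF us] by (simp add: gp_def)
    also have "\<dots> \<le> vol n a s powr ((p - 1) / p) * U (s 0) powr (1 / p)"
      using Omega_integral_le_first[OF n x gp s] G0 pos
      by (intro mult_left_mono powr_mono2) (auto simp: U_def H_def)
    finally have "?L s g powr \<beta> \<le> (vol n a s powr ((p - 1) / p) * U (s 0) powr (1 / p)) powr \<beta>"
      using G0 \<beta> by (intro powr_mono2) auto
    also have "\<dots> = vol n a s powr (\<beta> * (p - 1) / p) * U (s 0) powr (\<beta> / p)"
      by (simp add: powr_mult powr_powr mult.commute)
    finally have "\<omega> s * ?L s g powr \<beta> * g s powr \<alpha>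
        \<le> \<omega> s * (vol n a s powr (\<beta> * (p - 1) / p) * U (s 0) powr (\<beta> / p)) * g s powr \<alpha>"
      using \<omega>(2)[OF sb] by (intro mult_right_mono mult_left_mono) auto
    then show ?thesis using h_le[OF s] by (simp add: f1_def f2_def mult_ac)
  qed
  have "\<bar>?L x h\<bar> \<le> ?L x (\<lambda>s. f1 s * f2 s)"
    by (intro Omega_integral_abs_le h Omega_integrable_nice x nice_mult f1 f2 main)
  also have "\<dots> \<le> ?L x (\<lambda>t. f1 t powr (p / \<beta>)) powr (1 / (p / \<beta>)) * ?L x (\<lambda>t. f2 t powr (p / \<alpha>)) powr (1 / (p / \<alpha>))"
  proof (intro Omega_integral_Holder x f1 f2)
    have "(\<alpha> + \<beta>) / p = 1" using p by simp
    then show "1 / (p / \<beta>) + 1 / (p / \<alpha>) = 1" by (simp add: add_divide_distrib)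
  qed (use \<alpha> \<beta> pos in auto)
  finally have 1: "\<bar>?L x h\<bar> \<le>
      ?L x (\<lambda>t. f1 t powr (p / \<beta>)) powr (1 / (p / \<beta>)) * ?L x (\<lambda>t. f2 t powr (p / \<alpha>)) powr (1 / (p / \<alpha>))" .
  have 2: "?L x (\<lambda>t. f1 t powr (p / \<beta>)) = ?L x (\<lambda>t. vol n a t powr (p - 1) * \<omega> t powr (p / \<beta>))"
    unfolding Omega_integral_def
  proof (rule iter_cong[where J="{}"])
    fix s assume "s \<in> ubox x ({} \<union> set [0..<n])"
    then have "s \<in> ubox b {..<n}" using xb by (auto simp: atLeast0LessThan)
    then show "f1 s powr (p / \<beta>) = vol n a s powr (p - 1) * \<omega> s powr (p / \<beta>)"
      using \<omega>(2) \<beta> pos by (simp add: f1_def powr_mult powr_powr)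
  qed (rule undef_in)
  have "?L x (\<lambda>t. f2 t powr (p / \<alpha>)) = ?L x (\<lambda>t. U (t 0) powr ?q * gp t)"
    unfolding Omega_integral_def
  proof (rule iter_cong[where J="{}"])
    fix s assume "s \<in> ubox x ({} \<union> set [0..<n])"
    then have "s \<in> ubox b {..<n}" using xb by (auto simp: atLeast0LessThan)
    then show "f2 s powr (p / \<alpha>) = U (s 0) powr ?q * gp s"
      using g(2) \<alpha> pos by (simp add: f2_def gp_def powr_mult powr_powr)
  qed (rule undef_in)
  \<comment> \<open>The factor depends on the first coordinate alone and leaves the inner integrals;
    what remains of them is \<open>H\<close>, the integrand of \<open>U\<close>.\<close>
  also have "?L x (\<lambda>t. U (t 0) powr ?q * gp t) = ts_int (T 0) (a 0) (x 0) (\<lambda>r. U r powr ?q * H r)"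
  proof -
    have "nice {..<n} (\<lambda>t. U (t 0) powr ?q * gp t)"
      using \<alpha> \<beta> n by (intro nice_mult gp nice_coord[OF cU]) auto
    from slice_integral(1)[OF n x this] show ?thesis
      by (simp add: slice_mult[where q="\<lambda>r. U r powr ?q", abs_def] H_def)
  qed
  also have "\<dots> \<le> (\<alpha> / p) * ?L x gp powr (p / \<alpha>)"
  proof -
    have "ts_int (T 0) (a 0) (x 0) (\<lambda>r. U r powr ?q * H r)
        \<le> (\<alpha> / p) * U (x 0) powr (p / \<alpha>) - (\<alpha> / p) * 0 powr (p / \<alpha>)"
    proof (rule ts_convex_chain(2)[OF T[OF n] aT[OF n] x0(1,2) _ _ U_def, where c="\<lambda>z. z powr ?q"])
      show "bdd_meas (T 0 \<inter> {a 0..<x 0}) H" using Hm by (rule bdd_meas_subset) (use x0 in auto)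
      show "continuous_on {0..U (x 0)} (\<lambda>z. z powr ?q)" using \<alpha> \<beta> by (intro continuous_on_powr_pos) auto
    qed (use H0 x0 convex in auto)
    then show ?thesis by (simp add: Ux)
  qed
  finally have 3: "?L x (\<lambda>t. f2 t powr (p / \<alpha>)) \<le> (\<alpha> / p) * ?L x gp powr (p / \<alpha>)" .
  have "nice {..<n} (\<lambda>t. f2 t powr (p / \<alpha>))" using f2 \<alpha> pos by (intro nice_powr) auto
  then have "0 \<le> ?L x (\<lambda>t. f2 t powr (p / \<alpha>))" by (intro Omega_integral_upper_mono(1)[OF x x]) auto
  then have "?L x (\<lambda>t. f2 t powr (p / \<alpha>)) powr (1 / (p / \<alpha>)) \<le> ((\<alpha> / p) * ?L x gp powr (p / \<alpha>)) powr (1 / (p / \<alpha>))"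
    using 3 \<alpha> pos by (intro powr_mono2) auto
  then have "\<bar>?L x h\<bar> \<le> ?L x (\<lambda>t. vol n a t powr (p - 1) * \<omega> t powr (p / \<beta>)) powr (1 / (p / \<beta>)) *
      ((\<alpha> / p) * ?L x gp powr (p / \<alpha>)) powr (1 / (p / \<alpha>))"
    using 1 unfolding 2 by (elim order_trans) (intro mult_left_mono, auto)
  moreover have "((\<alpha> / p) * ?L x gp powr (p / \<alpha>)) powr (1 / (p / \<alpha>)) = (\<alpha> / p) powr (\<alpha> / p) * ?L x gp"
    using \<alpha> pos Omega_integral_upper_mono(1)[OF x x gp(1) _ gp(2)] by (subst powr_mult) (simp_all add: powr_powr)
  ultimately show ?thesis by (simp add: gp_def mult_ac)
qed

text \<open>Separation of variables for the majorant \<open>z\<close>, whose integrand B0 H is at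
  most B0 V z^p. The function \<open>\<psi>\<close> is a primitive of -z^(-p), both convex and
  decreasing: convexity gives the chain inequality in the right direction, and monotonicity turns a
  lower bound for \<open>z powr (1 - p)\<close> into an upper bound for \<open>z\<close>. Positivity
  of \<open>A0\<close> keeps \<open>z\<close> away from the singularity at 0.\<close>

lemma Omega_bihari:
  fixes A0 B0 p :: real
  assumes n: "0 < n" and x: "upper x" and p: "1 < p" and A0: "0 < A0" and B0: "0 \<le> B0"
    and g: "nice {..<n} g" "\<And>s. s \<in> ubox b {..<n} \<Longrightarrow> 0 \<le> g s"
    and g_le: "\<And>s. s \<in> ubox x {..<n} \<Longrightarrow> g s \<le> A0 + B0 * Omega_integral n T a s (\<lambda>t. g t powr p)"
    and D: "0 < A0 powr (1 - p) + (1 - p) * B0 * vol n a x"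
  shows "A0 + B0 * Omega_integral n T a x (\<lambda>t. g t powr p)
    \<le> (A0 powr (1 - p) + (1 - p) * B0 * vol n a x) powr (1 / (1 - p))"
proof -
  define gp where "gp = (\<lambda>t. g t powr p)"
  define H where "H = slice x gp"
  define z where "z = (\<lambda>r. A0 + ts_int (T 0) (a 0) r (\<lambda>s. B0 * H s))"
  define V where "V = (\<Prod>j\<in>{1..<n}. x j - a j)"
  have gp: "nice {..<n} gp" "\<And>s. s \<in> ubox b {..<n} \<Longrightarrow> 0 \<le> gp s"
    unfolding gp_def using g p by (auto intro!: nice_powr)
  have xb: "ubox x {..<n} \<subseteq> ubox b {..<n}" using x by (intro ubox_subset) auto
  note Hm = slice_integral(2)[OF n x gp(1), folded H_def]
  have H0: "\<And>s. s \<in> T 0 \<Longrightarrow> a 0 \<le> s \<Longrightarrow> s < b 0 \<Longrightarrow> 0 \<le> H s"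
    unfolding H_def by (rule slice_nonneg[OF n x gp])
  note x0 = upperD[OF x n]
  have b0: "b 0 \<in> T 0" "a 0 \<le> b 0" using ab[OF n] bT[OF n] by auto
  have z_eq: "z r = A0 + B0 * ts_int (T 0) (a 0) r H" for r by (simp add: z_def)
  have zA: "A0 \<le> z r" if "r \<in> T 0" "a 0 \<le> r" "r \<le> b 0" for r
    using ts_int_slice_nonneg[OF n x gp that] B0 by (simp add: z_eq H_def)
  have zx: "z (x 0) = A0 + B0 * Omega_integral n T a x gp"
    using slice_integral(1)[OF n x gp(1)] by (simp add: z_eq H_def)
  have BHm: "bdd_meas (T 0 \<inter> {a 0..<b 0}) (\<lambda>s. B0 * H s)" by (intro bdd_meas_mult bdd_meas_const Hm)
  have cont: "continuous_on {A0..d} (\<lambda>t. t powr e)" for d e :: real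
    using A0 by (intro continuous_intros) auto
  have zp: "bdd_meas (T 0 \<inter> {a 0..<b 0}) (\<lambda>r. z r powr p)"
  proof (rule ts_convex_chain(1)[OF T[OF n] aT[OF n] b0 BHm _ z_def, where c="\<lambda>z. z powr p" and \<psi>="\<lambda>z. z powr (p + 1) / (p + 1)"])
    show "0 \<le> B0 * H s" if "s \<in> T 0" "a 0 \<le> s" "s < b 0" for s using H0[OF that] B0 by simp
    show "continuous_on {A0..z (b 0)} (\<lambda>z. z powr p)" by (rule cont)
    show "t powr (p + 1) / (p + 1) + t powr p * (t' - t) \<le> t' powr (p + 1) / (p + 1)"
      if "A0 \<le> t" "t \<le> t'" for t t' using powr_tangent[of p t t'] that A0 p by auto
  qed
  \<comment> \<open>Once \<open>g\<close> is bounded by a function of the first coordinate, the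
    other integrations contribute only the constant factor \<open>V\<close>.\<close>
  have H_le: "H r \<le> z r powr p * V" if r: "r \<in> T 0" "a 0 \<le> r" "r < x 0" for r
  proof -
    have "H r \<le> slice x (\<lambda>t. z (t 0) powr p * 1) r"
      unfolding H_def
    proof (rule slice_mono[OF n x gp(1)])
      show "nice {..<n} (\<lambda>t. z (t 0) powr p * 1)"
        using n by (intro nice_mult nice_const nice_coord[OF zp]) auto
      fix s assume s: "s \<in> ubox x {..<n}"
      have "g s \<le> A0 + B0 * Omega_integral n T a s gp" using g_le[OF s] by (simp add: gp_def)
      also have "\<dots> \<le> z (s 0)"
        unfolding z_eq using Omega_integral_le_first[OF n x gp s] B0
        by (intro add_left_mono mult_left_mono) (auto simp: H_def)
      finally have "gp s \<le> z (s 0) powr p"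
        unfolding gp_def using g(2)[of s] s xb p by (intro powr_mono2) auto
      then show "gp s \<le> z (s 0) powr p * 1" by simp
    qed (use r in auto)
    also have "\<dots> = z r powr p * V"
      by (subst slice_mult) (simp add: slice_one[OF x] V_def)
    finally show ?thesis .
  qed
  define c where "c = (\<lambda>z::real. - (z powr (- p)))"
  define \<psi> where "\<psi> = (\<lambda>z::real. z powr (1 - p) / (p - 1))"
  have ccont: "continuous_on {A0..d} c" for d unfolding c_def by (intro continuous_on_minus cont)
  have conv: "\<psi> t + c t * (t' - t) \<le> \<psi> t'" if t: "A0 \<le> t" "t \<le> t'" for t t'
  proof (rule tangent_below)
    show "continuous_on {t..t'} \<psi>"
      unfolding \<psi>_def using t p A0 by (intro continuous_intros) auto
    fix r assume r: "t < r" "r < t'"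
    show "(\<psi> has_real_derivative c r) (at r)"
    proof -
      have "0 < r" using t r A0 by simp
      from DERIV_minus[OF powr_div_derivative[OF this, of "1 - p"]] p
      have "((\<lambda>z. - (z powr (1 - p) / (1 - p))) has_real_derivative - (r powr (1 - p - 1))) (at r)" by simp
      moreover have "- (z powr (1 - p) / (1 - p)) = \<psi> z" for z
        using minus_divide_right[of "z powr (1 - p)" "1 - p"] by (simp add: \<psi>_def)
      ultimately show ?thesis by (simp add: c_def)
    qed
    show "c t \<le> c r" unfolding c_def using t r A0 p by (auto intro!: powr_mono2')
  qed (use t in auto)
  have chain1: "bdd_meas (T 0 \<inter> {a 0..<x 0}) (\<lambda>s. c (z s))"
    and chain2: "ts_int (T 0) (a 0) (x 0) (\<lambda>s. c (z s) * (B0 * H s)) \<le> \<psi> (z (x 0)) - \<psi> A0"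
  proof -
    have m: "bdd_meas (T 0 \<inter> {a 0..<x 0}) (\<lambda>s. B0 * H s)" using BHm by (rule bdd_meas_subset) (use x0 in auto)
    have nn: "0 \<le> B0 * H s" if "s \<in> T 0" "a 0 \<le> s" "s < x 0" for s
      using H0[of s] that x0 B0 by auto
    show "bdd_meas (T 0 \<inter> {a 0..<x 0}) (\<lambda>s. c (z s))"
      by (rule ts_convex_chain(1)[OF T[OF n] aT[OF n] x0(1,2) m nn z_def ccont conv])
    show "ts_int (T 0) (a 0) (x 0) (\<lambda>s. c (z s) * (B0 * H s)) \<le> \<psi> (z (x 0)) - \<psi> A0"
      by (rule ts_convex_chain(2)[OF T[OF n] aT[OF n] x0(1,2) m nn z_def ccont conv])
  qed
  \<comment> \<open>The weight \<open>z powr (- p)\<close> cancels the power in \<open>H_le\<close>,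
    so the integrand is bounded below by a constant, and \<open>V\<close> times the first side
    length is the volume.\<close>
  have "(- (B0 * V)) * (x 0 - a 0) \<le> ts_int (T 0) (a 0) (x 0) (\<lambda>s. c (z s) * (B0 * H s))"
  proof (rule ts_int_lower[OF T[OF n] aT[OF n] x0(1,2)])
    show "bdd_meas (T 0 \<inter> {a 0..<x 0}) (\<lambda>s. c (z s) * (B0 * H s))"
      by (intro bdd_meas_mult chain1 bdd_meas_subset[OF BHm]) (use x0 in auto)
    fix s assume s: "s \<in> T 0" "a 0 \<le> s" "s < x 0"
    have zs: "0 < z s" using zA[of s] s x0 A0 by auto
    have "z s powr (- p) * (B0 * H s) \<le> z s powr (- p) * (B0 * (z s powr p * V))"
      using H_le[OF s] B0 by (intro mult_left_mono) auto
    also have "\<dots> = B0 * V" using zs by (simp add: powr_minus field_simps)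
    finally show "- (B0 * V) \<le> c (z s) * (B0 * H s)" by (simp add: c_def)
  qed
  moreover have "V * (x 0 - a 0) = vol n a x"
  proof -
    have "{..<n} = insert 0 {1..<n}" using n by auto
    then show ?thesis by (simp add: vol_def V_def)
  qed
  ultimately have "- (B0 * vol n a x) \<le> \<psi> (z (x 0)) - \<psi> A0"
    using chain2 by (simp add: mult.assoc)
  then have "- (B0 * vol n a x) * (p - 1) \<le> (\<psi> (z (x 0)) - \<psi> A0) * (p - 1)"
    using p by (intro mult_right_mono) auto
  also have "\<dots> = z (x 0) powr (1 - p) - A0 powr (1 - p)" using p by (simp add: \<psi>_def left_diff_distrib)
  finally have *: "A0 powr (1 - p) + (1 - p) * B0 * vol n a x \<le> z (x 0) powr (1 - p)"
    by (simp add: algebra_simps)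
  have zpos: "0 < z (x 0)" using zA[of "x 0"] x0 A0 by auto
  \<comment> \<open>The exponent is negative, so the inequality is reversed; \<open>D\<close> makes
    the smaller side positive.\<close>
  have "(z (x 0) powr (1 - p)) powr (1 / (1 - p)) \<le> (A0 powr (1 - p) + (1 - p) * B0 * vol n a x) powr (1 / (1 - p))"
    using D * p by (intro powr_mono2') (auto simp: divide_le_0_iff)
  then show ?thesis using zpos p zx by (simp add: powr_powr gp_def)
qed

end

section \<open>From the dynamic equation to the explicit bound\<close>

theorem theorem4p2:
  fixes n :: nat and T :: "nat \<Rightarrow> real set" and a b :: "nat \<Rightarrow> real"
    and \<alpha> \<beta> \<gamma> :: real
    and \<omega> w1 w2 w3 K A B y dy I :: "(nat \<Rightarrow> real) \<Rightarrow> real"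
    and \<zeta> \<Phi> :: "(nat \<Rightarrow> real) \<Rightarrow> real \<Rightarrow> real \<Rightarrow> real"
  assumes n: "1 \<le> n"
    and T: "\<And>j. j < n \<Longrightarrow> time_scale (T j)"
    and a: "a \<in> PiE {..<n} T" and b: "b \<in> PiE {..<n} T"
    and ab: "\<And>j. j < n \<Longrightarrow> a j < b j"
    and \<alpha>: "0 < \<alpha>" and \<beta>: "0 < \<beta>" and \<alpha>\<beta>: "1 < \<alpha> + \<beta>"
    and \<gamma>: "0 < \<gamma>" "\<gamma> < 1"
    and \<omega>: "\<omega> \<in> W_class n T a b"
    and w: "\<And>x. x \<in> Omega n T a b \<Longrightarrow> 0 \<le> w1 x \<and> 0 \<le> w2 x \<and> 0 \<le> w3 x"
    and w2: "\<And>x. x \<in> Omega n T a b \<Longrightarrow> w2 x < 1"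
    and y: "y \<in> L_class n T a b (\<alpha> + \<beta>)"
    and dy: "dy = mixed_deriv n T a b y"
    and I: "I = (\<lambda>x. Omega_integral n T a x (\<lambda>t. \<Phi> t (y t) (dy t)))"
    and I_exists: "\<And>x. x \<in> Omega_kappa n T a b n \<Longrightarrow>
          Omega_integrable n T a x (\<lambda>t. \<Phi> t (y t) (dy t))"
    and equation: "\<And>x. x \<in> Omega_kappa n T a b n \<Longrightarrow> dy x = \<zeta> x (dy x) (I x)"
    and initial: "\<And>x j. x \<in> Omega n T a b \<Longrightarrow> j < n \<Longrightarrow> x j = a j \<Longrightarrow> y x = 0"
    and \<Phi>_bound: "\<And>x. x \<in> Omega_kappa n T a b n \<Longrightarrow>
          \<bar>\<Phi> x (y x) (dy x)\<bar> \<le> \<omega> x * \<bar>y x\<bar> powr \<beta> * \<bar>dy x\<bar> powr \<alpha>"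
    and \<zeta>_bound: "\<And>x. x \<in> Omega_kappa n T a b n \<Longrightarrow>
          \<bar>\<zeta> x (dy x) (I x)\<bar> \<le> w1 x + w2 x * \<bar>dy x\<bar> powr \<gamma> + w3 x * \<bar>I x\<bar>"
    and K: "K = (\<lambda>x. (\<alpha> / (\<alpha> + \<beta>)) powr (\<alpha> / (\<alpha> + \<beta>)) *
          (Omega_integral n T a x
             (\<lambda>t. vol n a t powr (\<alpha> + \<beta> - 1) * \<omega> t powr ((\<alpha> + \<beta>) / \<beta>)))
          powr (\<beta> / (\<alpha> + \<beta>)))"
    and A: "A = (\<lambda>x. SUP t\<in>Omega n T a x.
          (w1 t + (1 - \<gamma>) * \<gamma> powr (\<gamma> / (1 - \<gamma>))) / (1 - w2 t))"
    and B: "B = (\<lambda>x. SUP t\<in>Omega n T a x. w3 t * K t / (1 - w2 t))"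
  shows "\<forall>x\<in>Omega n T a b.
    (\<forall>t\<in>Omega n T a x. (\<forall>j<n. t j < x j) \<longrightarrow>
       bdd_above ((\<lambda>s. (w1 s + (1 - \<gamma>) * \<gamma> powr (\<gamma> / (1 - \<gamma>))) / (1 - w2 s)) ` Omega n T a t) \<and>
       bdd_above ((\<lambda>s. w3 s * K s / (1 - w2 s)) ` Omega n T a t) \<and>
       0 < A t powr (1 - \<alpha> - \<beta>) + (1 - \<alpha> - \<beta>) * B t * vol n a t) \<and>
    Omega_integrable n T a x (\<lambda>t. (A t powr (1 - \<alpha> - \<beta>)
       + (1 - \<alpha> - \<beta>) * B t * vol n a t) powr (1 / (1 - \<alpha> - \<beta>)))
    \<longrightarrow> y x \<le> Omega_integral n T a x (\<lambda>t. (A t powr (1 - \<alpha> - \<beta>)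
       + (1 - \<alpha> - \<beta>) * B t * vol n a t) powr (1 / (1 - \<alpha> - \<beta>)))"
proof (intro ballI impI, elim conjE)
  fix x
  let ?F = "\<lambda>t. (A t powr (1 - \<alpha> - \<beta>) + (1 - \<alpha> - \<beta>) * B t * vol n a t) powr (1 / (1 - \<alpha> - \<beta>))"
  assume x: "x \<in> Omega n T a b"
    and adm: "\<forall>t\<in>Omega n T a x. (\<forall>j<n. t j < x j) \<longrightarrow>
       bdd_above ((\<lambda>s. (w1 s + (1 - \<gamma>) * \<gamma> powr (\<gamma> / (1 - \<gamma>))) / (1 - w2 s)) ` Omega n T a t) \<and>
       bdd_above ((\<lambda>s. w3 s * K s / (1 - w2 s)) ` Omega n T a t) \<and>
       0 < A t powr (1 - \<alpha> - \<beta>) + (1 - \<alpha> - \<beta>) * B t * vol n a t"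
    and F: "Omega_integrable n T a x ?F"
  interpret delta_box n T a b
    using T a b ab by unfold_locales (auto simp: PiE_iff)
  define p where "p = \<alpha> + \<beta>"
  define c where "c = (1 - \<gamma>) * \<gamma> powr (\<gamma> / (1 - \<gamma>))"
  define g where "g = (\<lambda>s. \<bar>dy s\<bar>)"
  define G where "G = (\<lambda>s. Omega_integral n T a s (\<lambda>t. g t powr p))"
  have n0: "0 < n" using n by simp
  have c: "0 < c" using \<gamma> by (simp add: c_def)
  have rd: "rd_continuous_on n T (Omega_kappa n T a b n) dy"
  proof -
    obtain m where m: "n = Suc m" using n by (cases n) auto
    show ?thesis using y unfolding L_class_def dy mixed_deriv_def m by blast
  qed
  have dy_nice: "nice {..<n} dy" by (rule mixed_deriv_nice[OF rd])
  have g: "nice {..<n} g" "\<And>s. 0 \<le> g s" unfolding g_def using nice_abs[OF dy_nice] by auto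
  have gp: "nice {..<n} (\<lambda>t. g t powr p)" using g \<alpha> \<beta> by (intro nice_powr) (auto simp: p_def)
  have \<omega>_rd: "rd_continuous_on n T (PiE {..<n} (cut T a b)) \<omega>" and \<omega>_pos: "\<And>s. s \<in> Omega n T a b \<Longrightarrow> 0 < \<omega> s"
    using \<omega> by (auto simp: W_class_def Omega_def cut_def[abs_def])
  have \<omega>_nice: "nice {..<n} \<omega>" by (rule rd_nice[OF \<omega>_rd cut_compact]) (auto simp: cut_def)
  have boxes: "s \<in> ubox b {..<n}" "s \<in> Omega n T a b" "s \<in> Omega_kappa n T a b n"
    if "s \<in> ubox b {..<n}" for s
    using that ubox_Omega_kappa[of n] ubox_Omega_kappa[of 0] unfolding Omega_kappa_0 by auto
  have G0: "0 \<le> G s" if "upper s" for s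
    unfolding G_def using g by (intro Omega_integral_upper_mono(1)[OF that that gp]) auto
  \<comment> \<open>The suprema defining \<open>A t\<close> and \<open>B t\<close> run over a closed
    box. As \<open>t\<close> is strictly below \<open>b\<close>, that box still lies in the
    half-open one, where the equation and the bounds hold.\<close>
  have below: "s \<in> ubox b {..<n}" if t: "t \<in> ubox b {..<n}" and s: "s \<in> Omega n T a t" for s t
    unfolding ubox_def PiE_iff
  proof (intro conjI ballI)
    show "s \<in> extensional {..<n}" using s by (simp add: Omega_def PiE_iff)
    fix j assume j: "j \<in> {..<n}"
    show "s j \<in> T j \<inter> {a j..<b j}"
      using PiE_mem[OF s[unfolded Omega_def] j] PiE_mem[OF t[unfolded ubox_def] j] by auto
  qed
  have K0: "0 \<le> K s" for s unfolding K by simp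
  have I_le: "\<bar>I s\<bar> \<le> K s * G s" if s: "s \<in> ubox b {..<n}" for s
    unfolding I K G_def p_def[symmetric]
  proof (rule Omega_opial[OF n0 _ \<alpha> \<beta> p_def])
    show up: "upper s" using s upper_b by (rule ubox_upper)
    show "Omega_integrable n T a s (\<lambda>t. \<Phi> t (y t) (dy t))" by (rule I_exists[OF boxes(3)[OF s]])
    show "1 < p" using \<alpha>\<beta> by (simp add: p_def)
    fix r assume "r \<in> ubox s {..<n}"
    then have r: "r \<in> ubox b {..<n}" using ubox_subset[OF up, of "{..<n}"] by auto
    \<comment> \<open>Replacing \<open>\<bar>y r\<bar>\<close> by the integral of \<open>g\<close>
      brings the growth condition on \<open>\<Phi>\<close> into the form required by
      \<open>Omega_opial\<close>.\<close>
    have "y r = Omega_integral n T a r dy"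
      unfolding dy by (rule Omega_integral_mixed_deriv[OF y boxes(2)[OF r], symmetric])
    also have "\<bar>\<dots>\<bar> \<le> Omega_integral n T a r g"
      using ubox_upper[OF r upper_b] dy_nice g
      by (intro Omega_integral_abs_le Omega_integrable_nice) (auto simp: g_def)
    finally have "\<bar>y r\<bar> powr \<beta> \<le> Omega_integral n T a r g powr \<beta>" using \<beta> by (intro powr_mono2) auto
    then have "\<omega> r * \<bar>y r\<bar> powr \<beta> * \<bar>dy r\<bar> powr \<alpha> \<le> \<omega> r * Omega_integral n T a r g powr \<beta> * g r powr \<alpha>"
      unfolding g_def using \<omega>_pos[OF boxes(2)[OF r]] by (intro mult_right_mono mult_left_mono) auto
    then show "\<bar>\<Phi> r (y r) (dy r)\<bar> \<le> \<omega> r * Omega_integral n T a r g powr \<beta> * g r powr \<alpha>"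
      using \<Phi>_bound[OF boxes(3)[OF r]] by linarith
  qed (use g \<omega>_nice \<omega>_pos boxes(2) in \<open>auto simp: less_imp_le\<close>)
  have pointwise: "g s \<le> (w1 s + c) / (1 - w2 s) + w3 s * K s / (1 - w2 s) * G s" if s: "s \<in> ubox b {..<n}" for s
  proof -
    note ws = w[OF boxes(2)[OF s]] w2[OF boxes(2)[OF s]]
    have "g s \<le> w1 s + w2 s * g s powr \<gamma> + w3 s * \<bar>I s\<bar>"
      using \<zeta>_bound[OF boxes(3)[OF s]] equation[OF boxes(3)[OF s]] by (simp add: g_def)
    moreover have "w3 s * \<bar>I s\<bar> \<le> w3 s * (K s * G s)" using I_le[OF s] ws by (intro mult_left_mono) auto
    \<comment> \<open>The sublinear term becomes linear and is absorbed on the left because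
      \<open>w2 s < 1\<close>; relaxing \<open>w2 s * c\<close> to \<open>c\<close> yields the
      numerator in \<open>A\<close>.\<close>
    moreover have "w2 s * g s powr \<gamma> \<le> w2 s * (c + g s)"
      using powr_gamma_le[OF \<gamma> g(2)] ws by (intro mult_left_mono) (auto simp: c_def)
    moreover have "w2 s * c \<le> c" using ws c by (simp add: mult_left_le_one_le)
    ultimately have "g s * (1 - w2 s) \<le> (w1 s + c) + w3 s * K s * G s" by (simp add: algebra_simps)
    then have "g s \<le> ((w1 s + c) + w3 s * K s * G s) / (1 - w2 s)" using ws by (simp add: pos_le_divide_eq)
    then show ?thesis by (simp add: add_divide_distrib)
  qed
  have upx: "upper x" by (rule Omega_upper[OF x])
  \<comment> \<open>The final integral sees only points strictly below \<open>x\<close>, exactly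
    those at which the admissibility conditions are assumed.\<close>
  have main: "dy t \<le> ?F t" if t: "t \<in> ubox x {..<n}" for t
  proof -
    have tb: "t \<in> ubox b {..<n}" using t ubox_subset[OF upx, of "{..<n}"] by auto
    have upt: "upper t" using t upx by (rule ubox_upper)
    have "t j \<in> T j \<inter> {a j..<x j}" if "j < n" for j using t that by (auto simp: ubox_def PiE_iff)
    moreover have t_ext: "t \<in> extensional {..<n}" using t by (simp add: ubox_def PiE_iff)
    ultimately have tx: "t \<in> Omega n T a x" "\<forall>j<n. t j < x j"
      unfolding Omega_def PiE_iff by (auto simp: less_imp_le)
    from adm tx have bA: "bdd_above ((\<lambda>s. (w1 s + c) / (1 - w2 s)) ` Omega n T a t)"
      and bB: "bdd_above ((\<lambda>s. w3 s * K s / (1 - w2 s)) ` Omega n T a t)"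
      and D: "0 < A t powr (1 - p) + (1 - p) * B t * vol n a t"
      unfolding c_def p_def by (simp_all add: diff_diff_eq)
    have tt: "t \<in> Omega n T a t" using upt t_ext unfolding Omega_def PiE_iff upper_def by auto
    have A_ge: "(w1 s + c) / (1 - w2 s) \<le> A t" and B_ge: "w3 s * K s / (1 - w2 s) \<le> B t"
      if "s \<in> Omega n T a t" for s
      unfolding A B c_def[symmetric] using bA bB that by (auto intro: cSUP_upper)
    \<comment> \<open>Strict positivity comes from the constant \<open>c\<close>, since
      \<open>w1\<close> may vanish.\<close>
    have A0: "0 < A t"
      using A_ge[OF tt] w[OF boxes(2)[OF tb]] w2[OF boxes(2)[OF tb]] c
      by (intro less_le_trans[OF _ A_ge[OF tt]] divide_pos_pos) auto
    have B0: "0 \<le> B t"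
      using w[OF boxes(2)[OF tb]] w2[OF boxes(2)[OF tb]] K0
      by (intro order_trans[OF _ B_ge[OF tt]] divide_nonneg_nonneg mult_nonneg_nonneg) auto
    \<comment> \<open>The suprema at \<open>t\<close> dominate the coefficients at every
      \<open>s\<close> below \<open>t\<close>, which gives constant coefficients on the whole
      box.\<close>
    have le: "g s \<le> A t + B t * G s" if s: "s \<in> Omega n T a t" for s
    proof -
      have sb: "s \<in> ubox b {..<n}" by (rule below[OF tb s])
      show ?thesis
        using pointwise[OF sb] A_ge[OF s] mult_right_mono[OF B_ge[OF s] G0[OF ubox_upper[OF sb upper_b]]] by linarith
    qed
    have "dy t \<le> A t + B t * G t" using le[OF tt] by (simp add: g_def)
    also have "\<dots> \<le> (A t powr (1 - p) + (1 - p) * B t * vol n a t) powr (1 / (1 - p))"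
      unfolding G_def
    proof (rule Omega_bihari[OF n0 upt _ A0 B0 g(1) _ _ D])
      fix s assume s: "s \<in> ubox t {..<n}"
      have "s \<in> Omega n T a t" using s unfolding ubox_def Omega_def by (rule subsetD[OF PiE_mono, rotated]) auto
      from le[OF this] show "g s \<le> A t + B t * Omega_integral n T a s (\<lambda>t. g t powr p)" by (simp add: G_def)
    qed (use g \<alpha>\<beta> in \<open>auto simp: p_def\<close>)
    also have "\<dots> = ?F t" by (simp add: p_def diff_diff_eq)
    finally show ?thesis .
  qed
  have "y x = Omega_integral n T a x dy"
    unfolding dy by (rule Omega_integral_mixed_deriv[OF y x, symmetric])
  also have "\<dots> \<le> Omega_integral n T a x ?F"
    by (intro Omega_integral_mono Omega_integrable_nice upx dy_nice F main)
  finally show "y x \<le> Omega_integral n T a x ?F" .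
qed

end
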